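(* For the two-hop, two-user interference channel with limited Shannon feedback, $\mathbf{d}^{\rm lS}=\tfrac{4}{3}$.
   Context: Two-hop, two-user interference channel: sources $S_1,S_2$, relays $R_1,R_2$, destinations $D_1,D_2$. At channel use $t$, $Y_{R_i}(t)=H_{i1}(t)X_{S_1}(t)+H_{i2}(t)X_{S_2}(t)+Z_{R_i}(t)$ and $Y_{D_i}(t)=G_{i1}(t)X_{R_1}(t)+G_{i2}(t)X_{R_2}(t)+Z_{D_i}(t)$, $i=1,2$, with complex signals, power constraint $P$ on every transmitted signal, and all $H_{ij}(t),G_{ij}(t),Z_{R_i}(t),Z_{D_i}(t)$ i.i.d. $\mathcal{CN}(0,1)$ across $i,j,t$. Relays transmit causal functions of their past received signals and available side information. Destinations know all channel coefficients. Source $S_i$ sends message $\mathcal{M}_i$ at rate $r_i$ to $D_i$; achievability means vanishing error probability at each destination as blocklength grows; $C_{\rm sum}(P)$ is the maximal sum rate and DoF $=\lim_{P\to\infty}C_{\rm sum}(P)/\log_2P$. Limited Shannon feedback: both relays know the first-hop coefficients $\{H_{ij}(t)\}$ instantaneously and the second-hop coefficients $\{G_{ij}(t)\}$ at time $t+1$; relay $R_i$ additionally knows the output $Y_{D_i}(t)$ at time $t+1$; the sources have no side information whatsoever. $\mathbf{d}^{\rm lS}$ denotes the DoF under this model. *)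

theory Defs
  imports "HOL-Probability.Probability"
begin

datatype idx = One | Two

text \<open>The i.i.d. CN(0,1) random variables of one channel use:
  first-hop coefficients H i j, second-hop coefficients G i j,
  relay noise ZR i, destination noise ZD i.\<close>
datatype rv = H idx idx | G idx idx | ZR idx | ZD idx

text \<open>What relay R_i can observe (one entry per time index s):
  its own received signal, the output of destination D_i (fed back),
  the first-hop and the second-hop coefficients.\<close>
datatype robs = RY | RDY | RH idx idx | RG idx idx

datatype dobs = DY | DH idx idx | DG idx idx

definition CN :: "complex measure" where
  "CN = density lborel (\<lambda>z. ennreal (exp (- (cmod z)\<^sup>2) / pi))"

definition noise :: "nat \<Rightarrow> (nat \<times> rv \<Rightarrow> complex) measure" where
  "noise n = PiM ({..<n} \<times> UNIV) (\<lambda>_. CN)"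

text \<open>A coding scheme: message set sizes, source encoders (functions of the message only),
  relay functions (applied to the causally available observations), decoders.\<close>
record code =
  msz :: "idx \<Rightarrow> nat"
  enc :: "idx \<Rightarrow> nat \<Rightarrow> nat \<Rightarrow> complex"            \<comment> \<open>source i, message, time\<close>
  relf :: "idx \<Rightarrow> nat \<Rightarrow> (nat \<Rightarrow> robs \<Rightarrow> complex) \<Rightarrow> complex"
  dec :: "idx \<Rightarrow> (nat \<Rightarrow> dobs \<Rightarrow> complex) \<Rightarrow> nat"

definition msg :: "nat \<Rightarrow> nat \<Rightarrow> idx \<Rightarrow> nat" where
  "msg m1 m2 i = (case i of One \<Rightarrow> m1 | Two \<Rightarrow> m2)"

definition XS :: "code \<Rightarrow> nat \<Rightarrow> nat \<Rightarrow> idx \<Rightarrow> nat \<Rightarrow> complex" where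
  "XS c m1 m2 i t = enc c i (msg m1 m2 i) t"

definition YR :: "code \<Rightarrow> nat \<Rightarrow> nat \<Rightarrow> (nat \<times> rv \<Rightarrow> complex) \<Rightarrow> idx \<Rightarrow> nat \<Rightarrow> complex" where
  "YR c m1 m2 \<omega> i t =
     \<omega> (t, H i One) * XS c m1 m2 One t + \<omega> (t, H i Two) * XS c m1 m2 Two t + \<omega> (t, ZR i)"

definition YD :: "(nat \<Rightarrow> idx \<Rightarrow> complex) \<Rightarrow> (nat \<times> rv \<Rightarrow> complex) \<Rightarrow> idx \<Rightarrow> nat \<Rightarrow> complex" where
  "YD h \<omega> i t = \<omega> (t, G i One) * h t One + \<omega> (t, G i Two) * h t Two + \<omega> (t, ZD i)"

text \<open>Information available at relay i when transmitting at time t (limited Shannon feedback):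
  Y_{R_i}(s) for s < t, Y_{D_i}(s) for s < t, H(s) for s \<le> t, G(s) for s < t.
  Entries not available are masked to 0 (so relay functions are causal by construction).\<close>
definition relay_view :: "code \<Rightarrow> nat \<Rightarrow> nat \<Rightarrow> (nat \<times> rv \<Rightarrow> complex) \<Rightarrow>
    (nat \<Rightarrow> idx \<Rightarrow> complex) \<Rightarrow> idx \<Rightarrow> nat \<Rightarrow> nat \<Rightarrow> robs \<Rightarrow> complex" where
  "relay_view c m1 m2 \<omega> h i t s k =
     (case k of
        RY \<Rightarrow> if s < t then YR c m1 m2 \<omega> i s else 0
      | RDY \<Rightarrow> if s < t then YD h \<omega> i s else 0
      | RH a b \<Rightarrow> if s \<le> t then \<omega> (s, H a b) else 0
      | RG a b \<Rightarrow> if s < t then \<omega> (s, G a b) else 0)"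

text \<open>Relay transmit history: XRhist ... t s i = X_{R_i}(s) for s < t.\<close>
fun XRhist :: "code \<Rightarrow> nat \<Rightarrow> nat \<Rightarrow> (nat \<times> rv \<Rightarrow> complex) \<Rightarrow> nat \<Rightarrow> nat \<Rightarrow> idx \<Rightarrow> complex" where
  "XRhist c m1 m2 \<omega> 0 = (\<lambda>s i. 0)"
| "XRhist c m1 m2 \<omega> (Suc t) =
     (let h = XRhist c m1 m2 \<omega> t
      in h(t := (\<lambda>i. relf c i t (relay_view c m1 m2 \<omega> h i t))))"

definition XR :: "code \<Rightarrow> nat \<Rightarrow> nat \<Rightarrow> (nat \<times> rv \<Rightarrow> complex) \<Rightarrow> idx \<Rightarrow> nat \<Rightarrow> complex" where
  "XR c m1 m2 \<omega> i t = XRhist c m1 m2 \<omega> (Suc t) t i"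

definition dest_view :: "code \<Rightarrow> nat \<Rightarrow> nat \<Rightarrow> nat \<Rightarrow> (nat \<times> rv \<Rightarrow> complex) \<Rightarrow> idx \<Rightarrow>
    nat \<Rightarrow> dobs \<Rightarrow> complex" where
  "dest_view c n m1 m2 \<omega> i s k =
     (if s < n then
        (case k of
           DY \<Rightarrow> YD (XRhist c m1 m2 \<omega> n) \<omega> i s
         | DH a b \<Rightarrow> \<omega> (s, H a b)
         | DG a b \<Rightarrow> \<omega> (s, G a b))
      else 0)"

definition decoded :: "code \<Rightarrow> nat \<Rightarrow> nat \<Rightarrow> nat \<Rightarrow> (nat \<times> rv \<Rightarrow> complex) \<Rightarrow> idx \<Rightarrow> nat" where
  "decoded c n m1 m2 \<omega> i = dec c i (dest_view c n m1 m2 \<omega> i)"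

definition err_prob :: "code \<Rightarrow> nat \<Rightarrow> idx \<Rightarrow> real" where
  "err_prob c n i =
     (\<Sum>m1<msz c One. \<Sum>m2<msz c Two.
        measure (noise n) {\<omega> \<in> space (noise n). decoded c n m1 m2 \<omega> i \<noteq> msg m1 m2 i})
     / (real (msz c One) * real (msz c Two))"

definition valid_code :: "real \<Rightarrow> nat \<Rightarrow> code \<Rightarrow> bool" where
  "valid_code P n c \<longleftrightarrow>
     (\<forall>i. msz c i \<ge> 1) \<and>
     (\<forall>i m. m < msz c i \<longrightarrow> (\<Sum>t<n. (cmod (enc c i m t))\<^sup>2) \<le> real n * P) \<and>
     (\<forall>m1 < msz c One. \<forall>m2 < msz c Two.
        (\<forall>i. \<forall>t<n. (\<lambda>\<omega>. XR c m1 m2 \<omega> i t) \<in> borel_measurable (noise n)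
                  \<and> integrable (noise n) (\<lambda>\<omega>. (cmod (XR c m1 m2 \<omega> i t))\<^sup>2)) \<and>
        (\<forall>i. (\<Sum>t<n. \<integral>\<omega>. (cmod (XR c m1 m2 \<omega> i t))\<^sup>2 \<partial>noise n) \<le> real n * P) \<and>
        (\<forall>i. (\<lambda>\<omega>. decoded c n m1 m2 \<omega> i) \<in> measurable (noise n) (count_space UNIV)))"

definition achievable :: "real \<Rightarrow> real \<Rightarrow> real \<Rightarrow> bool" where
  "achievable P r1 r2 \<longleftrightarrow> r1 \<ge> 0 \<and> r2 \<ge> 0 \<and>
     (\<exists>c :: nat \<Rightarrow> code.
        eventually (\<lambda>n. valid_code P n (c n) \<and>
                         real (msz (c n) One) \<ge> 2 powr (real n * r1) \<and>
                         real (msz (c n) Two) \<ge> 2 powr (real n * r2)) sequentially \<and>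
        (\<lambda>n. err_prob (c n) n One) \<longlonglongrightarrow> 0 \<and>
        (\<lambda>n. err_prob (c n) n Two) \<longlonglongrightarrow> 0)"

definition Csum :: "real \<Rightarrow> real" where
  "Csum P = Sup {r1 + r2 | r1 r2. achievable P r1 r2}"

end

theory Submission
  imports Defs "HOL-Real_Asymp.Real_Asymp"
begin

text \<open>
  Converse. Fix the destination \<open>u\<close>, let \<open>v\<close> be the other one, and average over the message of \<open>v\<close>.
  Conditionally on the message of \<open>u\<close> and on the past, let \<open>F u\<close> and \<open>F v\<close> be the densities of the two
  outputs at time \<open>t\<close>. As the relay inputs do not depend on the second-hop coefficients of time \<open>t\<close>,
  both outputs have the same conditional law, and \<open>E (ln (F u)) = E (ln (F v))\<close>. Comparing with a law under
  which \<open>Y u\<close> is independent Gaussian noise bounds \<open>n r\<^sub>u\<close> by the sum of \<open>E (ln (F u)) + ln P + O(1)\<close>;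
  comparing with the product law \<open>F u F v\<close> bounds \<open>n r\<^sub>v\<close> by the sum of \<open>- 2 E (ln (F u)) + O(1)\<close>. Hence
  \<open>2 r\<^sub>u + r\<^sub>v \<le> 2 log P + O(1)\<close>, and adding the two versions gives \<open>4/3\<close>.

  Achievability. In three channel uses the sources send \<open>u1, u2, u2\<close> and \<open>v1, v1, v2\<close>. From the first two
  uses each relay cancels \<open>v1\<close> and keeps a combination \<open>\<alpha>\<^sub>i\<close> of \<open>u1, u2\<close>; from the last two it cancels
  \<open>u2\<close> and keeps a combination \<open>\<beta>\<^sub>i\<close> of \<open>v1, v2\<close>. In the next three uses the relays send \<open>\<alpha>\<^sub>i\<close>, then
  \<open>\<beta>\<^sub>i\<close>, and then the fed-back outputs that were useless at their own destination, so that each destination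
  can subtract the one it knows and is left with two equations for its two symbols. Consecutive blocks
  overlap, four symbols are delivered every three uses, and a Gilbert-Varshamov code over a grid of
  symbols corrects the small fraction of blocks in which the channel is too bad.
\<close>

section \<open>Gaussian product measures\<close>

text \<open>Feedback makes every output a recursive function of the noise, which is awkward to
  condition on. The remedy is a change of variables: the outputs become the coordinates, the noise
  measure stays the reference, and the channel law becomes the explicit density \<open>Lik\<close>,
  a product of conditional densities. Causality lets the last factor integrate to one, so
  expectations are computed by peeling factors off. Expected logarithms of densities then play the
  role of entropies. The value 4/3 comes from a mismatch: with both outputs at its disposal,
  \<open>v\<close> meets the term \<open>E (ln F)\<close> twice with a minus sign, while
  \<open>u\<close> meets it once with a plus sign. The weights 2 and 1 cancel it. In the scheme the
  grid spacing grows like a small power of \<open>P\<close>. A block fails only if a random variable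
  that involves neither \<open>P\<close> nor the symbols exceeds a fixed fraction of this spacing.
  For large \<open>P\<close> the failure probability is below any prescribed level, and an outer
  code that corrects a small fraction of the blocks costs little rate.\<close>

lemma nn_integral_exp_real:
  assumes r: "0 < r"
  shows "(\<integral>\<^sup>+x. ennreal (exp (- r * x\<^sup>2)) \<partial>lborel) = ennreal (sqrt (pi / r))"
proof -
  define \<sigma> where "\<sigma> = 1 / sqrt (2 * r)"
  have \<sigma>: "\<sigma> > 0" "\<sigma>\<^sup>2 = 1 / (2 * r)" using r by (auto simp: \<sigma>_def power_divide)
  have eq: "exp (- r * x\<^sup>2) = sqrt (pi / r) * normal_density 0 \<sigma> x" for x
    using r by (simp add: normal_density_def \<sigma> real_sqrt_divide field_simps)
  have "(\<integral>\<^sup>+x. ennreal (normal_density 0 \<sigma> x) \<partial>lborel) = 1"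
    using \<sigma>(1) by (subst nn_integral_eq_integral) (auto simp: integral_normal_density)
  then show ?thesis
    unfolding eq using r by (simp add: ennreal_mult nn_integral_cmult)
qed

lemma nn_integral_exp_complex:
  assumes r: "0 < r"
  shows "(\<integral>\<^sup>+z. ennreal (exp (- r * (cmod z)\<^sup>2)) \<partial>lborel) = ennreal (pi / r)"
proof -
  have eq: "ennreal (exp (- r * (cmod z)\<^sup>2)) = (\<Prod>b\<in>Basis. ennreal (exp (- r * (z \<bullet> b)\<^sup>2)))" for z
    by (simp add: Basis_complex_def cmod_power2 inner_complex_def exp_add[symmetric] algebra_simps
        ennreal_mult[symmetric] complex_eq_iff)
  show ?thesis
    unfolding eq using r
    by (subst nn_integral_lborel_prod)
      (simp_all only: nn_integral_exp_real, auto simp: Basis_complex_def complex_eq_iff ennreal_mult[symmetric])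
qed

lemma sets_CN [measurable_cong, simp]: "sets CN = sets borel"
  and space_CN [simp]: "space CN = UNIV"
  by (simp_all add: CN_def)

lemma nn_integral_CN:
  assumes [measurable]: "f \<in> borel_measurable borel"
  shows "(\<integral>\<^sup>+z. f z \<partial>CN) = (\<integral>\<^sup>+z. ennreal (exp (- (cmod z)\<^sup>2) / pi) * f z \<partial>lborel)"
  unfolding CN_def by (subst nn_integral_density) auto

text \<open>One integral for three purposes: \<open>r = 1\<close> makes \<open>CN\<close> a
  probability measure, \<open>r = 1/2\<close> bounds its second moment, and \<open>r = 1 / P\<close>
  normalises the comparison Gaussian \<open>Q\<close>.\<close>

lemma nn_integral_CN_exp:
  assumes r: "0 < r"
  shows "(\<integral>\<^sup>+z. ennreal (exp ((cmod z)\<^sup>2 - r * (cmod z)\<^sup>2)) \<partial>CN) = ennreal (1 / r)"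
proof -
  have "(\<integral>\<^sup>+z. ennreal (exp ((cmod z)\<^sup>2 - r * (cmod z)\<^sup>2)) \<partial>CN)
      = (\<integral>\<^sup>+z. ennreal (1 / pi) * ennreal (exp (- r * (cmod z)\<^sup>2)) \<partial>lborel)"
    by (subst nn_integral_CN)
       (auto intro!: nn_integral_cong simp: ennreal_mult[symmetric] exp_minus exp_diff field_simps)
  also have "\<dots> = ennreal (1 / r)"
    by (subst nn_integral_cmult, measurable, subst nn_integral_exp_complex[OF r])
      (use r in \<open>simp add: ennreal_mult[symmetric]\<close>)
  finally show ?thesis .
qed

lemma prob_space_CN: "prob_space CN"
  by standard (use nn_integral_CN_exp[of 1] in \<open>simp\<close>)

text \<open>The density of \<open>a + Z\<close> with respect to the law \<open>CN\<close> of \<open>Z\<close>.\<close>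
definition shift_dens :: "complex \<Rightarrow> complex \<Rightarrow> real" where
  "shift_dens a y = exp ((cmod y)\<^sup>2 - (cmod (y - a))\<^sup>2)"

lemma shift_dens_pos [simp]: "0 < shift_dens a y" "0 \<le> shift_dens a y" "shift_dens a y \<noteq> 0" by (auto simp: shift_dens_def)

lemma measurable_shift_dens [measurable (raw)]:
  assumes [measurable]: "f \<in> borel_measurable M" "g \<in> borel_measurable M"
  shows "(\<lambda>x. shift_dens (f x) (g x)) \<in> borel_measurable M"
  unfolding shift_dens_def by measurable

lemma nn_integral_CN_shift:
  assumes [measurable]: "f \<in> borel_measurable borel"
  shows "(\<integral>\<^sup>+y. f (y - a) * ennreal (shift_dens a y) \<partial>CN) = (\<integral>\<^sup>+z. f z \<partial>CN)"
proof -
  have "(\<integral>\<^sup>+z. f z \<partial>CN) = (\<integral>\<^sup>+z. ennreal (exp (- (cmod z)\<^sup>2) / pi) * f z \<partial>distr lborel borel ((+) (- a)))"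
    by (subst lborel_distr_plus) (rule nn_integral_CN, measurable)
  also have "\<dots> = (\<integral>\<^sup>+y. ennreal (exp (- (cmod (y - a))\<^sup>2) / pi) * f (y - a) \<partial>lborel)"
    by (subst nn_integral_distr) auto
  also have "\<dots> = (\<integral>\<^sup>+y. f (y - a) * ennreal (shift_dens a y) \<partial>CN)"
    by (subst nn_integral_CN)
       (auto intro!: nn_integral_cong simp: shift_dens_def mult.assoc[symmetric] ennreal_mult[symmetric] exp_diff exp_minus field_simps)
  finally show ?thesis ..
qed

lemma nn_integral_shift_dens: "(\<integral>\<^sup>+y. ennreal (shift_dens a y) \<partial>CN) = 1"
  using nn_integral_CN_shift[of "\<lambda>_. 1" a] prob_space.emeasure_space_1[OF prob_space_CN] by simp

text \<open>Second moment of the noise. It only enters the bounded term \<open>9 * \<kappa>\<close>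
  of the converse, so finiteness is what has to be shown.\<close>

definition \<kappa> :: real where "\<kappa> = enn2real (\<integral>\<^sup>+z. ennreal ((cmod z)\<^sup>2) \<partial>CN)"

lemma nn_integral_CN_sq: "(\<integral>\<^sup>+z. ennreal ((cmod z)\<^sup>2) \<partial>CN) = ennreal \<kappa>"
proof -
  have "(cmod z)\<^sup>2 \<le> 2 * exp ((cmod z)\<^sup>2 - 1/2 * (cmod z)\<^sup>2)" for z
  proof -
    have "2 * (1 + (cmod z)\<^sup>2 / 2) \<le> 2 * exp ((cmod z)\<^sup>2 / 2)"
      by (intro mult_left_mono exp_ge_add_one_self) auto
    then show ?thesis by simp
  qed
  then have "(\<integral>\<^sup>+z. ennreal ((cmod z)\<^sup>2) \<partial>CN) \<le> (\<integral>\<^sup>+z. ennreal 2 * ennreal (exp ((cmod z)\<^sup>2 - 1/2 * (cmod z)\<^sup>2)) \<partial>CN)"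
    by (intro nn_integral_mono) (simp add: ennreal_mult[symmetric] del: ennreal_numeral)
  also have "\<dots> = ennreal 2 * ennreal (1 / (1 / 2))"
    by (subst nn_integral_cmult, measurable, subst nn_integral_CN_exp) auto
  also have "\<dots> < top" by (simp add: ennreal_mult_less_top)
  finally show ?thesis by (simp add: \<kappa>_def)
qed

lemma \<kappa>_nonneg: "0 \<le> \<kappa>" by (simp add: \<kappa>_def)

lemma emeasure_CN_singleton: "emeasure CN {z} = 0"
proof -
  have "AE y in lborel. y \<notin> {z}" using AE_lborel_singleton[of z] by simp
  then have "AE y in CN. y \<notin> {z}" unfolding CN_def by (subst AE_density) auto
  then show ?thesis by (subst (asm) AE_iff_measurable[of "{z}"]) auto
qed

section \<open>Redrawing, integrating out and shifting a single noise coordinate\<close>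

lemma UNIV_idx: "UNIV = {One, Two}" using idx.exhaust by auto

instance idx :: finite by standard (simp add: UNIV_idx)

lemma finite_UNIV_rv: "finite (UNIV :: rv set)"
proof -
  have "UNIV = case_prod H ` UNIV \<union> case_prod G ` UNIV \<union> range ZR \<union> range ZD"
    using rv.exhaust by (auto simp: image_iff) (metis rv.exhaust)
  then show ?thesis by (metis finite_UnI finite_imageI finite)
qed

instance rv :: finite by standard (rule finite_UNIV_rv)

interpretation CN: prob_space CN by (rule prob_space_CN)

interpretation CNP: product_prob_space "\<lambda>_::nat \<times> rv. CN" UNIV by standard

interpretation noise: prob_space "noise n" for n
  unfolding noise_def by (intro prob_space_PiM prob_space_CN)

lemma measurable_noise_coord [measurable]:
  "(\<lambda>w. w (t, k)) \<in> borel_measurable (noise n)" if "t < n"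
proof -
  have "(\<lambda>w. w (t, k)) \<in> noise n \<rightarrow>\<^sub>M CN" unfolding noise_def
    by (rule measurable_component_singleton) (use that in auto)
  then show ?thesis by (simp cong: measurable_cong_sets)
qed

lemma measurable_noise_upd:
  assumes "t < n" "f \<in> M \<rightarrow>\<^sub>M noise n" "g \<in> borel_measurable M"
  shows "(\<lambda>x. (f x)((t, k) := g x)) \<in> M \<rightarrow>\<^sub>M noise n"
proof -
  have *: "insert (t, k) ({..<n} \<times> UNIV) = {..<n} \<times> UNIV" using assms(1) by auto
  have "(\<lambda>x. (f x)((t, k) := g x)) \<in> M \<rightarrow>\<^sub>M PiM (insert (t, k) ({..<n} \<times> UNIV)) (\<lambda>_. CN)"
    by (rule measurable_fun_upd[where J="{..<n} \<times> UNIV"])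
      (use assms in \<open>auto simp: noise_def cong: measurable_cong_sets\<close>)
  then show ?thesis unfolding * noise_def .
qed

lemma measurable_comp_upd:
  assumes "t < n" "f \<in> borel_measurable (noise n)"
  shows "(\<lambda>x. f ((fst x)((t, k) := snd x))) \<in> borel_measurable (noise n \<Otimes>\<^sub>M CN)"
  by (rule measurable_compose[OF measurable_noise_upd[OF assms(1)] assms(2)])
    (auto simp: measurable_cong_sets[OF refl sets_CN[symmetric]])

text \<open>Fubini for one coordinate, stated without leaving \<open>noise n\<close>: the inner
  integral is the conditional expectation given all other coordinates.\<close>

lemma nn_integral_resample:
  assumes t: "t < n" and f: "f \<in> borel_measurable (noise n)"
  shows "(\<integral>\<^sup>+w. f w \<partial>noise n) = (\<integral>\<^sup>+w. \<integral>\<^sup>+z. f (w((t, k) := z)) \<partial>CN \<partial>noise n)"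
proof -
  let ?I = "({..<n} \<times> UNIV) - {(t, k)}"
  have I: "insert (t, k) ?I = {..<n} \<times> UNIV" using t by auto
  have fin: "finite ?I" by auto
  have n: "noise n = PiM (insert (t, k) ?I) (\<lambda>_. CN)" unfolding I noise_def ..
  have *: "(\<integral>\<^sup>+w. g w \<partial>noise n) = (\<integral>\<^sup>+x. \<integral>\<^sup>+y. g (x((t, k) := y)) \<partial>CN \<partial>PiM ?I (\<lambda>_. CN))"
    if "g \<in> borel_measurable (noise n)" for g :: "_ \<Rightarrow> ennreal"
    unfolding n by (rule CNP.product_nn_integral_insert[OF fin]) (use that n in auto)
  have m: "(\<lambda>w. \<integral>\<^sup>+z. f (w((t, k) := z)) \<partial>CN) \<in> borel_measurable (noise n)"
    using measurable_comp_upd[OF t f]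
    by (intro CN.borel_measurable_nn_integral) (simp add: split_beta)
  show ?thesis
    unfolding *[OF f] *[OF m] by (simp add: CN.emeasure_space_1[simplified])
qed

text \<open>The basic peeling step: \<open>c\<close> is the conditional mean of
  \<open>\<rho>\<close> given the other coordinates, and \<open>f\<close> is determined by those.
  For a conditional density \<open>c\<close> is 1, for an energy it is
  \<open>\<kappa>\<close>.\<close>

lemma nn_integral_drop:
  assumes t: "t < n" and [measurable]: "f \<in> borel_measurable (noise n)" "\<rho> \<in> borel_measurable (noise n)"
    and ind: "\<And>w z. f (w((t, k) := z)) = f w"
    and \<rho>: "\<And>w. (\<integral>\<^sup>+z. \<rho> (w((t, k) := z)) \<partial>CN) = c"
  shows "(\<integral>\<^sup>+w. f w * \<rho> w \<partial>noise n) = (\<integral>\<^sup>+w. f w \<partial>noise n) * c"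
proof -
  have [measurable]: "(\<lambda>z. \<rho> (w((t, k) := z))) \<in> borel_measurable CN" if "w \<in> space (noise n)" for w
    by (rule measurable_compose[OF measurable_noise_upd[OF t]]) (use that in \<open>auto intro: measurable_ident_sets\<close>)
  have "(\<integral>\<^sup>+w. f w * \<rho> w \<partial>noise n) = (\<integral>\<^sup>+w. \<integral>\<^sup>+z. f w * \<rho> (w((t, k) := z)) \<partial>CN \<partial>noise n)"
    by (subst nn_integral_resample[OF t, where k=k]) (auto simp: ind)
  also have "\<dots> = (\<integral>\<^sup>+w. f w * c \<partial>noise n)"
    by (intro nn_integral_cong) (simp add: nn_integral_cmult \<rho>)
  also have "\<dots> = (\<integral>\<^sup>+w. f w \<partial>noise n) * c" by (rule nn_integral_multc) measurable
  finally show ?thesis .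
qed

text \<open>Change of variables from output \<open>a + Z\<close> to noise \<open>Z\<close> in one
  coordinate; \<open>a\<close> is constant along that coordinate, so the shift formula for
  \<open>CN\<close> applies fibre by fibre.\<close>

lemma nn_integral_unshift:
  assumes t: "t < n" and [measurable]: "F \<in> borel_measurable (noise n)" "a \<in> borel_measurable (noise n)"
    and ind: "\<And>w z. a (w((t, k) := z)) = a w"
  shows "(\<integral>\<^sup>+w. F (w((t, k) := w (t, k) - a w)) * ennreal (shift_dens (a w) (w (t, k))) \<partial>noise n) = (\<integral>\<^sup>+w. F w \<partial>noise n)"
proof -
  have [measurable]: "(\<lambda>w. w (t, k)) \<in> borel_measurable (noise n)" using t by measurable
  have [measurable]: "(\<lambda>w. F (w((t, k) := w (t, k) - a w))) \<in> borel_measurable (noise n)"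
    by (rule measurable_compose[OF measurable_noise_upd[OF t]]) auto
  have Fm: "(\<lambda>z. F (w((t, k) := z))) \<in> borel_measurable borel" if "w \<in> space (noise n)" for w
    by (rule measurable_compose[OF measurable_noise_upd[OF t]]) (use that in auto)
  have "(\<integral>\<^sup>+w. F (w((t, k) := w (t, k) - a w)) * ennreal (shift_dens (a w) (w (t, k))) \<partial>noise n)
    = (\<integral>\<^sup>+w. \<integral>\<^sup>+z. F (w((t, k) := z - a w)) * ennreal (shift_dens (a w) z) \<partial>CN \<partial>noise n)"
    by (subst nn_integral_resample[OF t, where k=k]) (auto simp: ind)
  also have "\<dots> = (\<integral>\<^sup>+w. \<integral>\<^sup>+z. F (w((t, k) := z)) \<partial>CN \<partial>noise n)"
    by (intro nn_integral_cong nn_integral_CN_shift[where f="\<lambda>z. F (_((t, k) := z))"] Fm)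
  also have "\<dots> = (\<integral>\<^sup>+w. F w \<partial>noise n)"
    by (subst nn_integral_resample[OF t, where k=k, of F]) auto
  finally show ?thesis .
qed

text \<open>Given the other coordinates, equality would force \<open>w (t, k)\<close> to be the
  single value \<open>f w / c w\<close>, and \<open>CN\<close> has no atoms.\<close>

lemma AE_noise_neq:
  assumes t: "t < n" and [measurable]: "c \<in> borel_measurable (noise n)" "f \<in> borel_measurable (noise n)"
    and ind: "\<And>w z. c (w((t, k) := z)) = c w" "\<And>w z. f (w((t, k) := z)) = f w"
  shows "AE w in noise n. c w \<noteq> 0 \<longrightarrow> w (t, k) * c w \<noteq> (f w :: complex)"
proof -
  have [measurable]: "(\<lambda>w. w (t, k)) \<in> borel_measurable (noise n)" using t by measurable
  let ?A = "{w \<in> space (noise n). cmod (c w) \<noteq> 0 \<and> cmod (w (t, k) * c w - f w) = 0}"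
  have A[measurable]: "?A \<in> sets (noise n)" by measurable
  have "emeasure (noise n) ?A = (\<integral>\<^sup>+w. indicator ?A w \<partial>noise n)" by (rule nn_integral_indicator[OF A, symmetric])
  also have "\<dots> = (\<integral>\<^sup>+w. \<integral>\<^sup>+z. indicator ?A (w((t, k) := z)) \<partial>CN \<partial>noise n)"
    by (rule nn_integral_resample[OF t]) measurable
  also have "\<dots> \<le> (\<integral>\<^sup>+w. \<integral>\<^sup>+z. indicator {f w / c w} z \<partial>CN \<partial>noise n)"
    by (intro nn_integral_mono) (auto simp: indicator_def ind field_simps)
  also have "\<dots> = 0" by (simp add: emeasure_CN_singleton)
  finally have "emeasure (noise n) ?A = 0" by simp
  then show ?thesis using A by (intro AE_I[where N="?A"]) auto
qed

lemma nn_integral_noise_reindex: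
  assumes "inj_on p ({..<m} \<times> UNIV)" "p \<in> {..<m} \<times> UNIV \<rightarrow> {..<n} \<times> UNIV"
    and f: "f \<in> borel_measurable (noise m)"
  shows "(\<integral>\<^sup>+w. f (\<lambda>j\<in>{..<m} \<times> UNIV. w (p j)) \<partial>noise n) = (\<integral>\<^sup>+w. f w \<partial>noise m)"
    and "(\<lambda>w. \<lambda>j\<in>{..<m} \<times> UNIV. w (p j)) \<in> noise n \<rightarrow>\<^sub>M noise m"
proof -
  have d: "distr (noise n) (noise m) (\<lambda>w. \<lambda>j\<in>{..<m} \<times> UNIV. w (p j)) = noise m"
    unfolding noise_def by (rule distr_PiM_reindex) (use assms prob_space_CN in auto)
  show m: "(\<lambda>w. \<lambda>j\<in>{..<m} \<times> UNIV. w (p j)) \<in> noise n \<rightarrow>\<^sub>M noise m"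
    unfolding noise_def
    by (rule measurable_restrict) (use assms(2) in \<open>auto intro!: measurable_component_singleton\<close>)
  show "(\<integral>\<^sup>+w. f (\<lambda>j\<in>{..<m} \<times> UNIV. w (p j)) \<partial>noise n) = (\<integral>\<^sup>+w. f w \<partial>noise m)"
    using nn_integral_distr[OF m, of f] f by (simp add: d)
qed

section \<open>Likelihood of the outputs under feedback\<close>

text \<open>From here to the converse the coordinate \<open>(t, ZD p)\<close> of \<open>w\<close> stands for the output of destination \<open>p\<close>
  at time \<open>t\<close>, and \<open>x\<close> gives the relay inputs as functions of the past outputs. Then \<open>Lik\<close> is the
  density of the law of the outputs with respect to the noise measure.\<close>

definition sig :: "(nat \<Rightarrow> idx \<Rightarrow> (nat \<times> rv \<Rightarrow> complex) \<Rightarrow> complex) \<Rightarrow> idx \<Rightarrow> nat \<Rightarrow> (nat \<times> rv \<Rightarrow> complex) \<Rightarrow> complex" where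
  "sig x p t w = w (t, G p One) * x t One w + w (t, G p Two) * x t Two w"

definition lik :: "(nat \<Rightarrow> idx \<Rightarrow> (nat \<times> rv \<Rightarrow> complex) \<Rightarrow> complex) \<Rightarrow> idx \<Rightarrow> nat \<Rightarrow> (nat \<times> rv \<Rightarrow> complex) \<Rightarrow> real" where
  "lik x p t w = shift_dens (sig x p t w) (w (t, ZD p))"

definition Lik :: "(nat \<Rightarrow> idx \<Rightarrow> (nat \<times> rv \<Rightarrow> complex) \<Rightarrow> complex) \<Rightarrow> nat \<Rightarrow> (nat \<times> rv \<Rightarrow> complex) \<Rightarrow> real" where
  "Lik x t w = (\<Prod>s<t. lik x One s w * lik x Two s w)"

text \<open>Recovers the noise from the outputs of the first \<open>t\<close> channel uses.\<close>
definition unsig :: "(nat \<Rightarrow> idx \<Rightarrow> (nat \<times> rv \<Rightarrow> complex) \<Rightarrow> complex) \<Rightarrow> nat \<Rightarrow> (nat \<times> rv \<Rightarrow> complex) \<Rightarrow> (nat \<times> rv \<Rightarrow> complex)" where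
  "unsig x t w = (\<lambda>(s, k). case k of ZD p \<Rightarrow> if s < t then w (s, k) - sig x p s w else w (s, k) | _ \<Rightarrow> w (s, k))"

definition swap_users :: "nat \<Rightarrow> (nat \<times> rv \<Rightarrow> complex) \<Rightarrow> (nat \<times> rv \<Rightarrow> complex)" where
  "swap_users t w = w((t, G One One) := w (t, G Two One), (t, G Two One) := w (t, G One One),
     (t, G One Two) := w (t, G Two Two), (t, G Two Two) := w (t, G One Two),
     (t, ZD One) := w (t, ZD Two), (t, ZD Two) := w (t, ZD One))"

lemma lik_pos [simp]: "0 < lik x p t w" "0 \<le> lik x p t w" "lik x p t w \<noteq> 0" by (simp_all add: lik_def)

lemma Lik_pos [simp]: "0 < Lik x t w" by (auto simp: Lik_def intro!: prod_pos)

lemma Lik_nz [simp]: "0 \<le> Lik x t w" "Lik x t w \<noteq> 0" using Lik_pos[of x t w] by linarith+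

lemma Lik_0 [simp]: "Lik x 0 w = 1" by (simp add: Lik_def)

lemma Lik_Suc: "Lik x (Suc t) w = Lik x t w * (lik x One t w * lik x Two t w)" by (simp add: Lik_def)

lemma measurable_sig:
  assumes [measurable (raw)]: "t < n" "\<And>r. x t r \<in> borel_measurable (noise n)"
  shows "sig x p t \<in> borel_measurable (noise n)"
  unfolding sig_def by measurable

lemma noise_ext: "w \<in> space (noise n) \<Longrightarrow> n \<le> t \<Longrightarrow> w (t, k) = undefined"
  by (auto simp: noise_def space_PiM PiE_def extensional_def)

lemma measurable_unsig:
  assumes "t \<le> n" "\<And>s r. s < t \<Longrightarrow> x s r \<in> borel_measurable (noise n)"
  shows "unsig x t \<in> noise n \<rightarrow>\<^sub>M noise n"
proof -
  have "(\<lambda>w j. unsig x t w j) \<in> noise n \<rightarrow>\<^sub>M PiM ({..<n} \<times> UNIV) (\<lambda>_. CN)"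
  proof (rule measurable_PiM_single')
    fix j :: "nat \<times> rv" assume j: "j \<in> {..<n} \<times> UNIV"
    obtain s k where [simp]: "j = (s, k)" by (cases j)
    have s[simp]: "s < n" using j by auto
    have [measurable]: "(\<lambda>w. w (s, k)) \<in> borel_measurable (noise n)" for k by measurable
    have "(\<lambda>w. w (s, ZD p) - sig x p s w) \<in> borel_measurable (noise n)" if "s < t" for p
      using measurable_sig[of s n x] assms that by measurable
    then have "(\<lambda>w. unsig x t w j) \<in> borel_measurable (noise n)"
      by (cases k; cases "s < t") (simp_all add: unsig_def)
    then show "(\<lambda>w. unsig x t w j) \<in> noise n \<rightarrow>\<^sub>M CN" by (simp cong: measurable_cong_sets)
  next
    \<comment> \<open>Outside the index set \<open>w\<close> is \<open>undefined\<close>, and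
      \<open>t \<le> n\<close> ensures that \<open>unsig\<close> does not alter these
      values.\<close>
    show "(\<lambda>w j. unsig x t w j) \<in> space (noise n) \<rightarrow> ({..<n} \<times> UNIV \<rightarrow>\<^sub>E space CN)"
      using assms(1) by (auto simp: PiE_def extensional_def unsig_def noise_ext split: rv.split)
  qed
  then show ?thesis by (simp add: noise_def)
qed

lemma swap_users_eq: "swap_users t w = (\<lambda>(s, k). if s = t then (case k of
    G p q \<Rightarrow> w (t, G (if p = One then Two else One) q) | ZD p \<Rightarrow> w (t, ZD (if p = One then Two else One)) | _ \<Rightarrow> w (s, k)) else w (s, k))"
  by (auto simp: swap_users_def fun_eq_iff split: rv.split) (metis (full_types) idx.exhaust)+

lemma nn_integral_swap_users:
  assumes t: "t < n" and f: "f \<in> borel_measurable (noise n)"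
  shows "(\<integral>\<^sup>+w. f (swap_users t w) \<partial>noise n) = (\<integral>\<^sup>+w. f w \<partial>noise n)"
proof -
  define o' where "o' p = (if p = One then Two else One)" for p
  have oo: "o' (o' p) = p" for p by (cases p) (auto simp: o'_def)
  define sk where "sk k = (case k of G p q \<Rightarrow> G (o' p) q | ZD p \<Rightarrow> ZD (o' p) | _ \<Rightarrow> k)" for k
  have ss: "sk (sk k) = k" for k by (cases k) (auto simp: sk_def oo)
  define \<pi> where "\<pi> j = (if fst j = t then (t, sk (snd j)) else j)" for j
  have pp: "\<pi> (\<pi> j) = j" for j by (cases j) (auto simp: \<pi>_def ss)
  have inj: "inj_on \<pi> ({..<n} \<times> UNIV)" by (rule inj_on_inverseI[of _ \<pi>]) (rule pp)
  have fu: "\<pi> \<in> {..<n} \<times> UNIV \<rightarrow> {..<n} \<times> UNIV" using t by (auto simp: \<pi>_def)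
  have "swap_users t w = (\<lambda>j\<in>{..<n} \<times> UNIV. w (\<pi> j))" if "w \<in> space (noise n)" for w
    using t noise_ext[OF that]
    by (auto simp: swap_users_eq fun_eq_iff \<pi>_def sk_def o'_def restrict_def split: rv.split)
  then show ?thesis
    by (subst nn_integral_noise_reindex(1)[OF inj fu f, symmetric]) (auto intro!: nn_integral_cong)
qed

text \<open>\<open>x_ZD\<close> expresses the feedback delay and makes each output factor a
  conditional density; \<open>x_G\<close> expresses the delay of the second-hop knowledge and makes
  the two destinations exchangeable given the past. Current first-hop coefficients remain
  visible.\<close>

locale causal =
  fixes n :: nat and x :: "nat \<Rightarrow> idx \<Rightarrow> (nat \<times> rv \<Rightarrow> complex) \<Rightarrow> complex"
  assumes x_meas: "\<And>t r. t < n \<Longrightarrow> x t r \<in> borel_measurable (noise n)"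
    and x_ZD: "\<And>t s r p w z. t \<le> s \<Longrightarrow> x t r (w((s, ZD p) := z)) = x t r w"
    and x_G: "\<And>t s r p q w z. t \<le> s \<Longrightarrow> x t r (w((s, G p q) := z)) = x t r w"
begin

lemma sig_meas: "t < n \<Longrightarrow> sig x p t \<in> borel_measurable (noise n)"
  by (intro measurable_sig x_meas)

lemma lik_meas: "t < n \<Longrightarrow> lik x p t \<in> borel_measurable (noise n)"
  unfolding lik_def using sig_meas[of t p] by measurable

lemma Lik_meas: "t \<le> n \<Longrightarrow> Lik x t \<in> borel_measurable (noise n)"
  unfolding Lik_def by (intro borel_measurable_prod borel_measurable_times lik_meas) auto

lemma sig_ZD: "t \<le> s \<Longrightarrow> sig x p t (w((s, ZD q) := z)) = sig x p t w"
  by (simp add: sig_def x_ZD)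

lemma lik_ZD: "t < s \<or> t = s \<and> p \<noteq> q \<Longrightarrow> lik x p t (w((s, ZD q) := z)) = lik x p t w"
  by (auto simp: lik_def sig_ZD)

lemma Lik_ZD: "t \<le> s \<Longrightarrow> Lik x t (w((s, ZD q) := z)) = Lik x t w"
  unfolding Lik_def by (intro prod.cong refl) (simp add: lik_ZD)

lemma nn_integral_lik: "(\<integral>\<^sup>+z. ennreal (lik x p t (w((t, ZD p) := z))) \<partial>CN) = 1"
  by (simp add: lik_def sig_ZD nn_integral_shift_dens)

text \<open>Outputs from time \<open>t\<close> on do not affect \<open>f\<close>, so their factors
  integrate to one, starting from the latest: the factor of each output at time \<open>T\<close> is
  a density given everything before.\<close>

lemma nn_integral_Lik_drop:
  assumes t: "t \<le> n" and f[measurable]: "f \<in> borel_measurable (noise n)"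
    and ind: "\<And>s p z w. t \<le> s \<Longrightarrow> f (w((s, ZD p) := z)) = f w"
  shows "(\<integral>\<^sup>+w. f w * ennreal (Lik x n w) \<partial>noise n) = (\<integral>\<^sup>+w. f w * ennreal (Lik x t w) \<partial>noise n)"
proof -
  have "(\<integral>\<^sup>+w. f w * ennreal (Lik x T w) \<partial>noise n) = (\<integral>\<^sup>+w. f w * ennreal (Lik x t w) \<partial>noise n)"
    if "t \<le> T" "T \<le> n" for T using that
  proof (induction T rule: dec_induct)
    case (step T)
    then have T: "T < n" "t \<le> T" by auto
    note [measurable] = Lik_meas[of T] Lik_meas[of "Suc T"] lik_meas[OF T(1)]
    have TT[simp]: "T \<le> n" using T by simp
    have "(\<integral>\<^sup>+w. f w * ennreal (Lik x (Suc T) w) \<partial>noise n)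
        = (\<integral>\<^sup>+w. (f w * ennreal (Lik x T w) * ennreal (lik x One T w)) * ennreal (lik x Two T w) \<partial>noise n)"
      by (simp add: Lik_Suc ennreal_mult mult.assoc)
    also have "\<dots> = (\<integral>\<^sup>+w. f w * ennreal (Lik x T w) * ennreal (lik x One T w) \<partial>noise n) * 1"
      by (rule nn_integral_drop[OF T(1), where k="ZD Two"])
        (simp_all add: ind T Lik_ZD lik_ZD nn_integral_lik)
    also have "\<dots> = (\<integral>\<^sup>+w. f w * ennreal (Lik x T w) \<partial>noise n) * 1 * 1"
      by (subst nn_integral_drop[OF T(1), where k="ZD One" and c=1])
        (simp_all add: ind T Lik_ZD lik_ZD nn_integral_lik)
    also have "\<dots> = (\<integral>\<^sup>+w. f w * ennreal (Lik x t w) \<partial>noise n)"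
      using step.IH[OF TT] by (simp only: mult_1_right)
    finally show ?case .
  qed simp
  from this[OF t order_refl] show ?thesis .
qed

lemma nn_integral_Lik: "t \<le> n \<Longrightarrow> (\<integral>\<^sup>+w. ennreal (Lik x t w) \<partial>noise n) = 1"
  using nn_integral_Lik_drop[of t "\<lambda>_. 1"] nn_integral_Lik_drop[of 0 "\<lambda>_. 1"]
  by (simp add: noise.emeasure_space_1)

lemma unsig_Suc:
  "unsig x (Suc t) w = unsig x t (w((t, ZD Two) := w (t, ZD Two) - sig x Two t w,
      (t, ZD One) := w (t, ZD One) - sig x One t w))"
proof -
  have "sig x p s (w((t, ZD Two) := z, (t, ZD One) := z')) = sig x p s w" if "s < t" for p s z z'
    using that by (simp add: sig_ZD)
  then show ?thesis
    by (auto simp: unsig_def fun_eq_iff less_Suc_eq split: rv.split) (metis idx.exhaust)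
qed

text \<open>The map from outputs to noise is triangular: each shift depends only on earlier outputs.
  Undoing the last use first leaves the case of one use less, and the shift densities collected on
  the way multiply to \<open>Lik\<close>. This turns every integral over the true channel into one
  against \<open>Lik\<close>.\<close>

lemma nn_integral_unsig:
  assumes "t \<le> n" and f: "f \<in> borel_measurable (noise n)"
  shows "(\<integral>\<^sup>+w. f (unsig x t w) * ennreal (Lik x t w) \<partial>noise n) = (\<integral>\<^sup>+w. f w \<partial>noise n)"
  using assms(1)
proof (induction t)
  case 0
  have "unsig x 0 w = w" for w by (auto simp: unsig_def fun_eq_iff split: rv.split)
  then show ?case by simp
next
  case (Suc t)
  then have t: "t < n" "t \<le> n" by auto
  have [measurable]: "unsig x t \<in> noise n \<rightarrow>\<^sub>M noise n" using t x_meas by (intro measurable_unsig) auto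
  note [measurable] = Lik_meas[OF t(2)] lik_meas[OF t(1)] sig_meas[OF t(1)] f
  have [measurable]: "(\<lambda>w. w (t, ZD One)) \<in> borel_measurable (noise n)" using t by measurable
  define F where "F w = f (unsig x t w) * ennreal (Lik x t w)" for w
  define F1 where "F1 w = F (w((t, ZD One) := w (t, ZD One) - sig x One t w)) * ennreal (lik x One t w)" for w
  have Fm[measurable]: "F \<in> borel_measurable (noise n)" unfolding F_def by measurable
  have "(\<lambda>w. F (w((t, ZD One) := w (t, ZD One) - sig x One t w))) \<in> borel_measurable (noise n)"
    by (rule measurable_compose[OF measurable_noise_upd[OF t(1)] Fm]) auto
  then have F1m: "F1 \<in> borel_measurable (noise n)" unfolding F1_def by measurable
  have "(\<integral>\<^sup>+w. f (unsig x (Suc t) w) * ennreal (Lik x (Suc t) w) \<partial>noise n)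
    = (\<integral>\<^sup>+w. F1 (w((t, ZD Two) := w (t, ZD Two) - sig x Two t w)) * ennreal (shift_dens (sig x Two t w) (w (t, ZD Two))) \<partial>noise n)"
    unfolding F1_def F_def
    by (intro nn_integral_cong)
      (simp add: unsig_Suc Lik_Suc sig_ZD lik_ZD Lik_ZD ennreal_mult mult_ac, simp add: lik_def)
  also have "\<dots> = (\<integral>\<^sup>+w. F1 w \<partial>noise n)"
    by (rule nn_integral_unshift[OF t(1) F1m sig_meas[OF t(1)]]) (simp add: sig_ZD)
  also have "\<dots> = (\<integral>\<^sup>+w. F w \<partial>noise n)"
    unfolding F1_def lik_def
    by (rule nn_integral_unshift[OF t(1) Fm sig_meas[OF t(1)]]) (simp add: sig_ZD)
  finally show ?case using Suc by (simp add: F_def)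
qed

text \<open>With only delayed knowledge of the second hop at the relays, the two outputs at time \<open>t\<close> have the
  same law given the past.\<close>

lemma x_swap_users: "s \<le> t \<Longrightarrow> x s r (swap_users t w) = x s r w"
  by (simp add: swap_users_def x_ZD x_G)

lemma lik_swap_users: "lik x One t (swap_users t w) = lik x Two t w" "lik x Two t (swap_users t w) = lik x One t w"
  by (simp_all add: lik_def sig_def x_swap_users, simp_all add: swap_users_def)

lemma Lik_swap_users: "Lik x t (swap_users t w) = Lik x t w"
  unfolding Lik_def by (intro prod.cong refl) (simp add: lik_def sig_def x_swap_users, simp add: swap_users_def)

text \<open>Swapping the outputs of time \<open>t\<close> would change the relay inputs of later
  times. The later factors are therefore integrated out before the swap and restored after
  it.\<close>

lemma nn_integral_Lik_swap_users:
  assumes t: "t < n" and f[measurable]: "f \<in> borel_measurable (noise n)" "f' \<in> borel_measurable (noise n)"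
    and ind: "\<And>s p z w. t < s \<Longrightarrow> f (w((s, ZD p) := z)) = f w" "\<And>s p z w. t < s \<Longrightarrow> f' (w((s, ZD p) := z)) = f' w"
    and f': "\<And>w. f' w = f (swap_users t w)"
  shows "(\<integral>\<^sup>+w. f w * ennreal (Lik x n w) \<partial>noise n) = (\<integral>\<^sup>+w. f' w * ennreal (Lik x n w) \<partial>noise n)"
proof -
  have [measurable]: "Lik x (Suc t) \<in> borel_measurable (noise n)" using t by (intro Lik_meas) auto
  have "(\<integral>\<^sup>+w. f w * ennreal (Lik x n w) \<partial>noise n) = (\<integral>\<^sup>+w. f w * ennreal (Lik x (Suc t) w) \<partial>noise n)"
    by (rule nn_integral_Lik_drop) (use t ind in auto)
  also have "\<dots> = (\<integral>\<^sup>+w. f (swap_users t w) * ennreal (Lik x (Suc t) (swap_users t w)) \<partial>noise n)"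
    by (subst nn_integral_swap_users[OF t, where f="\<lambda>w. f w * ennreal (Lik x (Suc t) w)"]) auto
  also have "\<dots> = (\<integral>\<^sup>+w. f' w * ennreal (Lik x (Suc t) w) \<partial>noise n)"
    by (simp add: f' Lik_Suc Lik_swap_users lik_swap_users mult_ac)
  also have "\<dots> = (\<integral>\<^sup>+w. f' w * ennreal (Lik x n w) \<partial>noise n)"
    by (rule nn_integral_Lik_drop[symmetric]) (use t ind in auto)
  finally show ?thesis .
qed

section \<open>Second moments under the law of the outputs\<close>

lemma nn_integral_noise_sq:
  assumes t: "t < n"
  shows "(\<integral>\<^sup>+w. ennreal ((cmod (w (t, ZD p) - sig x p t w))\<^sup>2) * ennreal (Lik x n w) \<partial>noise n) = ennreal \<kappa>"
proof -
  note [measurable] = sig_meas[OF t] lik_meas[OF t]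
  have [measurable]: "Lik x t \<in> borel_measurable (noise n)" "(\<lambda>w. w (t, k)) \<in> borel_measurable (noise n)" for k
    using t by (auto intro!: Lik_meas)
  obtain p' where p': "p' \<noteq> p" and l: "lik x One t w * lik x Two t w = lik x p' t w * lik x p t w" for w
    by (cases p) (metis idx.distinct(1) mult.commute)+
  have "(\<integral>\<^sup>+w. ennreal ((cmod (w (t, ZD p) - sig x p t w))\<^sup>2) * ennreal (Lik x n w) \<partial>noise n)
    = (\<integral>\<^sup>+w. ennreal ((cmod (w (t, ZD p) - sig x p t w))\<^sup>2) * ennreal (Lik x (Suc t) w) \<partial>noise n)"
    by (rule nn_integral_Lik_drop) (use t in \<open>auto simp: sig_ZD\<close>)
  also have "\<dots> = (\<integral>\<^sup>+w. (ennreal (Lik x t w) * ennreal (lik x p' t w)) *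
       (ennreal ((cmod (w (t, ZD p) - sig x p t w))\<^sup>2) * ennreal (lik x p t w)) \<partial>noise n)"
    unfolding Lik_Suc l by (simp add: ennreal_mult mult_ac)
  also have "\<dots> = (\<integral>\<^sup>+w. ennreal (Lik x t w) * ennreal (lik x p' t w) \<partial>noise n) * ennreal \<kappa>"
  proof (rule nn_integral_drop[OF t, where k="ZD p"])
    show "(\<integral>\<^sup>+z. ennreal ((cmod ((w((t, ZD p) := z)) (t, ZD p) - sig x p t (w((t, ZD p) := z))))\<^sup>2) *
         ennreal (lik x p t (w((t, ZD p) := z))) \<partial>CN) = ennreal \<kappa>" for w
      using nn_integral_CN_shift[of "\<lambda>z. ennreal ((cmod z)\<^sup>2)" "sig x p t w"]
      by (simp add: sig_ZD lik_def nn_integral_CN_sq)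
  qed (use p' in \<open>auto simp: Lik_ZD lik_ZD\<close>)
  also have "(\<integral>\<^sup>+w. ennreal (Lik x t w) * ennreal (lik x p' t w) \<partial>noise n) = (\<integral>\<^sup>+w. ennreal (Lik x t w) \<partial>noise n) * 1"
    by (rule nn_integral_drop[OF t, where k="ZD p'"]) (simp_all add: Lik_ZD nn_integral_lik)
  finally show ?thesis using t by (simp add: nn_integral_Lik)
qed

text \<open>The input at time \<open>t\<close> and the likelihood of the past are both unaffected by
  the coefficients \<open>G\<close> of time \<open>t\<close>, so input and coefficient are
  independent and the energies multiply.\<close>

lemma nn_integral_coeff_sq:
  assumes t: "t < n"
  shows "(\<integral>\<^sup>+w. ennreal ((cmod (w (t, G p r) * x t r w))\<^sup>2) * ennreal (Lik x n w) \<partial>noise n)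
    = (\<integral>\<^sup>+w. ennreal ((cmod (x t r w))\<^sup>2) * ennreal (Lik x n w) \<partial>noise n) * ennreal \<kappa>"
proof -
  have [measurable]: "Lik x t \<in> borel_measurable (noise n)" "(\<lambda>w. w (t, k)) \<in> borel_measurable (noise n)"
     "x t r \<in> borel_measurable (noise n)" for k
    using t by (auto intro!: Lik_meas x_meas)
  have LG: "Lik x t (w((t, G p r) := z)) = Lik x t w" for w z
    unfolding Lik_def by (intro prod.cong refl) (simp add: lik_def sig_def x_G)
  have "(\<integral>\<^sup>+w. ennreal ((cmod (w (t, G p r) * x t r w))\<^sup>2) * ennreal (Lik x n w) \<partial>noise n)
    = (\<integral>\<^sup>+w. ennreal ((cmod (w (t, G p r) * x t r w))\<^sup>2) * ennreal (Lik x t w) \<partial>noise n)"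
    by (rule nn_integral_Lik_drop) (use t in \<open>auto simp: x_ZD\<close>)
  also have "\<dots> = (\<integral>\<^sup>+w. (ennreal ((cmod (x t r w))\<^sup>2) * ennreal (Lik x t w)) * ennreal ((cmod (w (t, G p r)))\<^sup>2) \<partial>noise n)"
    by (simp add: norm_mult power_mult_distrib ennreal_mult mult_ac)
  also have "\<dots> = (\<integral>\<^sup>+w. ennreal ((cmod (x t r w))\<^sup>2) * ennreal (Lik x t w) \<partial>noise n) * ennreal \<kappa>"
    by (rule nn_integral_drop[OF t, where k="G p r"]) (simp_all add: LG x_G nn_integral_CN_sq)
  also have "(\<integral>\<^sup>+w. ennreal ((cmod (x t r w))\<^sup>2) * ennreal (Lik x t w) \<partial>noise n)
     = (\<integral>\<^sup>+w. ennreal ((cmod (x t r w))\<^sup>2) * ennreal (Lik x n w) \<partial>noise n)"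
    by (rule nn_integral_Lik_drop[symmetric]) (use t in \<open>auto simp: x_ZD\<close>)
  finally show ?thesis .
qed

lemma nn_integral_output_sq:
  assumes t: "t < n"
  shows "(\<integral>\<^sup>+w. ennreal ((cmod (w (t, ZD p)))\<^sup>2) * ennreal (Lik x n w) \<partial>noise n)
    \<le> ennreal (3 * \<kappa>) * ((\<integral>\<^sup>+w. ennreal ((cmod (x t One w))\<^sup>2) * ennreal (Lik x n w) \<partial>noise n)
       + (\<integral>\<^sup>+w. ennreal ((cmod (x t Two w))\<^sup>2) * ennreal (Lik x n w) \<partial>noise n) + 1)"
proof -
  note [measurable] = sig_meas[OF t]
  have [measurable]: "Lik x n \<in> borel_measurable (noise n)" "(\<lambda>w. w (t, k)) \<in> borel_measurable (noise n)"
     "x t r \<in> borel_measurable (noise n)" for k r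
    using t by (auto intro!: Lik_meas x_meas)
  have sq: "(cmod (a + b + c))\<^sup>2 \<le> 3 * ((cmod a)\<^sup>2 + (cmod b)\<^sup>2 + (cmod c)\<^sup>2)" for a b c
  proof -
    have "cmod (a + b + c) \<le> cmod a + cmod b + cmod c"
      by (meson norm_triangle_ineq order_trans add_mono order_refl)
    then have "(cmod (a + b + c))\<^sup>2 \<le> (cmod a + cmod b + cmod c)\<^sup>2" by (intro power_mono) auto
    also have "\<dots> \<le> 3 * ((cmod a)\<^sup>2 + (cmod b)\<^sup>2 + (cmod c)\<^sup>2)"
      using sum_squares_bound[of "cmod a" "cmod b"] sum_squares_bound[of "cmod a" "cmod c"] sum_squares_bound[of "cmod b" "cmod c"]
      by (simp add: power2_eq_square algebra_simps)
    finally show ?thesis .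
  qed
  have eq: "w (t, ZD p) = w (t, G p One) * x t One w + w (t, G p Two) * x t Two w + (w (t, ZD p) - sig x p t w)" for w
    by (simp add: sig_def)
  have "(\<integral>\<^sup>+w. ennreal ((cmod (w (t, ZD p)))\<^sup>2) * ennreal (Lik x n w) \<partial>noise n)
    \<le> (\<integral>\<^sup>+w. 3 * ((ennreal ((cmod (w (t, G p One) * x t One w))\<^sup>2) * ennreal (Lik x n w)
       + ennreal ((cmod (w (t, G p Two) * x t Two w))\<^sup>2) * ennreal (Lik x n w))
       + ennreal ((cmod (w (t, ZD p) - sig x p t w))\<^sup>2) * ennreal (Lik x n w)) \<partial>noise n)"
    unfolding distrib_right[symmetric] mult.assoc[symmetric]
  proof (intro nn_integral_mono mult_right_mono)
    fix w
    show "ennreal ((cmod (w (t, ZD p)))\<^sup>2) \<le> 3 * (ennreal ((cmod (w (t, G p One) * x t One w))\<^sup>2)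
       + ennreal ((cmod (w (t, G p Two) * x t Two w))\<^sup>2) + ennreal ((cmod (w (t, ZD p) - sig x p t w))\<^sup>2))"
      using sq[of "w (t, G p One) * x t One w" "w (t, G p Two) * x t Two w" "w (t, ZD p) - sig x p t w"]
      unfolding eq[symmetric]
      by (simp add: ennreal_plus[symmetric] ennreal_numeral[symmetric] ennreal_mult[symmetric] del: ennreal_plus ennreal_numeral)
  qed simp
  also have "\<dots> = 3 * ((\<integral>\<^sup>+w. ennreal ((cmod (w (t, G p One) * x t One w))\<^sup>2) * ennreal (Lik x n w) \<partial>noise n)
       + (\<integral>\<^sup>+w. ennreal ((cmod (w (t, G p Two) * x t Two w))\<^sup>2) * ennreal (Lik x n w) \<partial>noise n)
       + (\<integral>\<^sup>+w. ennreal ((cmod (w (t, ZD p) - sig x p t w))\<^sup>2) * ennreal (Lik x n w) \<partial>noise n))"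
    by (simp add: nn_integral_cmult nn_integral_add)
  also have "\<dots> = ennreal (3 * \<kappa>) * ((\<integral>\<^sup>+w. ennreal ((cmod (x t One w))\<^sup>2) * ennreal (Lik x n w) \<partial>noise n)
       + (\<integral>\<^sup>+w. ennreal ((cmod (x t Two w))\<^sup>2) * ennreal (Lik x n w) \<partial>noise n) + 1)"
    unfolding nn_integral_coeff_sq[OF t] nn_integral_noise_sq[OF t]
    using \<kappa>_nonneg by (simp add: ennreal_mult algebra_simps)
  finally show ?thesis .
qed

end

section \<open>Two receivers with feedback\<close>

lemma ln_shift_dens: "ln (shift_dens a y) = (cmod y)\<^sup>2 - (cmod (y - a))\<^sup>2" by (simp add: shift_dens_def)

text \<open>Transfers equalities of nonnegative integrals to signed functions without an
  integrability hypothesis: when one side is not integrable, neither is the other, and both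
  integrals are 0.\<close>

lemma integral_cong_parts:
  fixes f g :: "'a \<Rightarrow> real"
  assumes "f \<in> borel_measurable M" "g \<in> borel_measurable M"
    and "(\<integral>\<^sup>+w. ennreal (f w) \<partial>M) = (\<integral>\<^sup>+w. ennreal (g w) \<partial>M)"
    and "(\<integral>\<^sup>+w. ennreal (- f w) \<partial>M) = (\<integral>\<^sup>+w. ennreal (- g w) \<partial>M)"
  shows "integral\<^sup>L M f = integral\<^sup>L M g"
proof (cases "integrable M f")
  case True
  then have "integrable M g" using assms by (simp add: real_integrable_def)
  then show ?thesis using True assms by (simp add: real_lebesgue_integral_def)
next
  case False
  then have "\<not> integrable M g" using assms by (simp add: real_integrable_def)
  then show ?thesis using False by (simp add: not_integrable_integral_eq)
qed

text \<open>Receiver \<open>u\<close> decodes \<open>a\<close> and receiver \<open>v\<close> decodes \<open>b\<close>; \<open>e\<close> is the energy of the inputs. In the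
  information-theoretic argument \<open>v\<close> may see both outputs, so nothing is required of \<open>d2\<close>.\<close>
locale bc =
  fixes n A B :: nat and u v :: idx and P :: real
    and x :: "nat \<Rightarrow> nat \<Rightarrow> nat \<Rightarrow> idx \<Rightarrow> (nat \<times> rv \<Rightarrow> complex) \<Rightarrow> complex"
    and e :: "nat \<Rightarrow> nat \<Rightarrow> nat \<Rightarrow> idx \<Rightarrow> real"
    and d1 d2 :: "(nat \<times> rv \<Rightarrow> complex) \<Rightarrow> nat"
  assumes uv: "u \<noteq> v" and AB: "0 < A" "0 < B" and P: "1 \<le> P"
    and causal: "a < A \<Longrightarrow> b < B \<Longrightarrow> causal n (x a b)"
    and e: "\<And>a b t r. a < A \<Longrightarrow> b < B \<Longrightarrow> t < n \<Longrightarrow> 0 \<le> e a b t r"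
       "\<And>a b t r. a < A \<Longrightarrow> b < B \<Longrightarrow> t < n \<Longrightarrow>
          (\<integral>\<^sup>+w. ennreal ((cmod (x a b t r w))\<^sup>2) * ennreal (Lik (x a b) n w) \<partial>noise n) = ennreal (e a b t r)"
       "\<And>a b r. a < A \<Longrightarrow> b < B \<Longrightarrow> (\<Sum>t<n. e a b t r) \<le> real n * P"
    and d1_meas [measurable]: "d1 \<in> noise n \<rightarrow>\<^sub>M count_space UNIV"
    and d2_meas [measurable]: "d2 \<in> noise n \<rightarrow>\<^sub>M count_space UNIV"
    and d1_ZD: "\<And>t w z. d1 (w((t, ZD v) := z)) = d1 w"
begin

section \<open>Mixture densities and reference laws\<close>

abbreviation L where "L a b t w \<equiv> Lik (x a b) t w"
abbreviation K where "K p a b t w \<equiv> lik (x a b) p t w"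

text \<open>\<open>S a t\<close> is \<open>B\<close> times the density of the outputs before
  \<open>t\<close> when \<open>a\<close> is sent and \<open>b\<close> is uniform;
  \<open>F p a t\<close> is the conditional density of output \<open>p\<close> at time
  \<open>t\<close> under this mixture. Given \<open>b\<close> the two outputs at time
  \<open>t\<close> are conditionally independent, in the mixture in general they are not.\<close>

definition S where "S a t w = (\<Sum>b<B. L a b t w)"
definition F where "F p a t w = (\<Sum>b<B. L a b t w * K p a b t w) / S a t w"
text \<open>The density of a centred Gaussian of variance \<open>P\<close> with respect to \<open>CN\<close>.\<close>
definition Q :: "nat \<Rightarrow> (nat \<times> rv \<Rightarrow> complex) \<Rightarrow> real" where "Q t w = exp ((cmod (w (t, ZD u)))\<^sup>2 - 1 / P * (cmod (w (t, ZD u)))\<^sup>2) / P"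

lemma S_pos [simp]: "0 < S a t w" "0 \<le> S a t w" "S a t w \<noteq> 0"
proof -
  show "0 < S a t w" unfolding S_def using AB by (intro sum_pos) auto
  then show "0 \<le> S a t w" "S a t w \<noteq> 0" by auto
qed

lemma F_pos [simp]: "0 < F p a t w" "0 \<le> F p a t w" "F p a t w \<noteq> 0"
proof -
  show "0 < F p a t w" unfolding F_def using AB by (intro divide_pos_pos sum_pos) auto
  then show "0 \<le> F p a t w" "F p a t w \<noteq> 0" by auto
qed

lemma Q_pos [simp]: "0 < Q t w" "0 \<le> Q t w" "Q t w \<noteq> 0"
  using P by (auto simp: Q_def)

lemma L_Suc: "L a b (Suc t) w = L a b t w * (K u a b t w * K v a b t w)"
  using uv by (cases u; cases v) (simp_all add: Lik_Suc)

lemma L_meas: "a < A \<Longrightarrow> b < B \<Longrightarrow> t \<le> n \<Longrightarrow> L a b t \<in> borel_measurable (noise n)"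
  by (rule causal.Lik_meas[OF causal])

lemma K_meas: "a < A \<Longrightarrow> b < B \<Longrightarrow> t < n \<Longrightarrow> K p a b t \<in> borel_measurable (noise n)"
  by (rule causal.lik_meas[OF causal])

lemma S_meas: "a < A \<Longrightarrow> t \<le> n \<Longrightarrow> S a t \<in> borel_measurable (noise n)"
  unfolding S_def by (intro borel_measurable_sum L_meas) auto

lemma F_meas: "a < A \<Longrightarrow> t < n \<Longrightarrow> F p a t \<in> borel_measurable (noise n)"
  unfolding F_def by (intro borel_measurable_divide borel_measurable_sum borel_measurable_times L_meas K_meas S_meas) auto

lemma Q_meas: "t < n \<Longrightarrow> Q t \<in> borel_measurable (noise n)"
  unfolding Q_def by measurable

lemma S_ZD: "a < A \<Longrightarrow> t \<le> s \<Longrightarrow> S a t (w((s, ZD q) := z)) = S a t w"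
  unfolding S_def by (intro sum.cong refl causal.Lik_ZD[OF causal]) auto

lemma L_ZD: "a < A \<Longrightarrow> b < B \<Longrightarrow> t \<le> s \<Longrightarrow> L a b t (w((s, ZD q) := z)) = L a b t w"
  by (rule causal.Lik_ZD[OF causal])

lemma K_ZD: "a < A \<Longrightarrow> b < B \<Longrightarrow> t < s \<or> t = s \<and> p \<noteq> q \<Longrightarrow> K p a b t (w((s, ZD q) := z)) = K p a b t w"
  by (rule causal.lik_ZD[OF causal])

lemma F_ZD: "a < A \<Longrightarrow> t < s \<or> t = s \<and> p \<noteq> q \<Longrightarrow> F p a t (w((s, ZD q) := z)) = F p a t w"
  unfolding F_def by (auto intro!: arg_cong2[where f="(/)"] sum.cong simp: S_ZD L_ZD K_ZD)

lemma Q_ZD: "t \<noteq> s \<or> q \<noteq> u \<Longrightarrow> Q t (w((s, ZD q) := z)) = Q t w"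
  by (auto simp: Q_def)

lemma prod_Q_ZD: "(\<Prod>s<t. Q s (w((t, ZD q) := z))) = (\<Prod>s<t. Q s w)"
  by (intro prod.cong refl Q_ZD) auto

lemma prod_FF_ZD: "a < A \<Longrightarrow> (\<Prod>s<t. F u a s (w((t, ZD q) := z)) * F v a s (w((t, ZD q) := z))) = (\<Prod>s<t. F u a s w * F v a s w)"
  by (intro prod.cong refl arg_cong2[where f="(*)"] F_ZD) auto

lemma prod_QF_ZD: "a < A \<Longrightarrow> (\<Prod>s<t. Q s (w((t, ZD q) := z)) / F u a s (w((t, ZD q) := z))) = (\<Prod>s<t. Q s w / F u a s w)"
  by (intro prod.cong refl arg_cong2[where f="(/)"] F_ZD Q_ZD) auto

lemma K_upd_meas: "a < A \<Longrightarrow> b < B \<Longrightarrow> (\<lambda>z. K p a b t (w((t, ZD p) := z))) \<in> borel_measurable CN"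
  by (simp add: lik_def causal.sig_ZD[OF causal] cong: measurable_cong_sets)

lemma nn_integral_mix:
  assumes a: "a < A" and c: "\<And>b. b < B \<Longrightarrow> 0 \<le> c b" "(\<Sum>b<B. c b) = 1"
  shows "(\<integral>\<^sup>+z. ennreal (\<Sum>b<B. c b * K p a b t (w((t, ZD p) := z))) \<partial>CN) = 1"
proof -
  have "(\<integral>\<^sup>+z. ennreal (\<Sum>b<B. c b * K p a b t (w((t, ZD p) := z))) \<partial>CN)
      = (\<integral>\<^sup>+z. (\<Sum>b<B. ennreal (c b) * ennreal (K p a b t (w((t, ZD p) := z)))) \<partial>CN)"
    using c(1) by (intro nn_integral_cong) (subst sum_ennreal[symmetric], auto simp: ennreal_mult'')
  also have "\<dots> = (\<Sum>b<B. ennreal (c b) * 1)"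
    using K_upd_meas[OF a]
    by (subst nn_integral_sum) (auto intro!: sum.cong simp: nn_integral_cmult causal.nn_integral_lik[OF causal[OF a]])
  also have "\<dots> = 1" using c by (simp, subst sum_ennreal) auto
  finally show ?thesis .
qed

lemma nn_integral_F: "a < A \<Longrightarrow> (\<integral>\<^sup>+z. ennreal (F p a t (w((t, ZD p) := z))) \<partial>CN) = 1"
proof -
  assume a: "a < A"
  have "F p a t (w((t, ZD p) := z)) = (\<Sum>b<B. L a b t w / S a t w * K p a b t (w((t, ZD p) := z)))" for z
    using a by (simp add: F_def S_ZD L_ZD sum_divide_distrib)
  moreover have "(\<Sum>b<B. L a b t w / S a t w) = 1"
    using S_pos(3)[of a t w] by (simp add: S_def flip: sum_divide_distrib)
  ultimately show ?thesis
    using nn_integral_mix[OF a, of "\<lambda>b. L a b t w / S a t w" p t w] by simp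
qed

lemma nn_integral_Q: "(\<integral>\<^sup>+z. ennreal (Q t (w((t, ZD u) := z))) \<partial>CN) = 1"
proof -
  have "(\<integral>\<^sup>+z. ennreal (Q t (w((t, ZD u) := z))) \<partial>CN)
     = (\<integral>\<^sup>+z. ennreal (1 / P) * ennreal (exp ((cmod z)\<^sup>2 - 1 / P * (cmod z)\<^sup>2)) \<partial>CN)"
    using P by (simp add: Q_def ennreal_mult[symmetric])
  also have "\<dots> = ennreal (1 / P) * ennreal (1 / (1 / P))"
    using P nn_integral_CN_exp[of "1 / P"]
    by (subst nn_integral_cmult) (simp_all cong: measurable_cong_sets)
  also have "\<dots> = 1" using P by (simp flip: ennreal_mult)
  finally show ?thesis .
qed

lemma nn_integral_Q_prod: "t \<le> n \<Longrightarrow> (\<integral>\<^sup>+w. ennreal (\<Prod>s<t. Q s w) \<partial>noise n) = 1"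
proof (induction t)
  case (Suc t)
  then have t: "t < n" by simp
  note [measurable] = Q_meas[OF t]
  have [measurable]: "(\<lambda>w. \<Prod>s<t. Q s w) \<in> borel_measurable (noise n)"
    using t by (intro borel_measurable_prod Q_meas) auto
  have "(\<integral>\<^sup>+w. ennreal (\<Prod>s<t. Q s w) * ennreal (Q t w) \<partial>noise n) = (\<integral>\<^sup>+w. ennreal (\<Prod>s<t. Q s w) \<partial>noise n) * 1"
    by (rule nn_integral_drop[OF t, where k="ZD u"])
      (simp_all add: prod_Q_ZD nn_integral_Q)
  then show ?case using Suc by (simp add: ennreal_mult prod_nonneg)
qed (simp add: noise.emeasure_space_1)

text \<open>Multiplying the one-output conditional densities yields a probability law that does not
  depend on \<open>b\<close>; it is the reference against which the information about
  \<open>b\<close> is measured.\<close>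

lemma nn_integral_FF_prod:
  "a < A \<Longrightarrow> t \<le> n \<Longrightarrow> (\<integral>\<^sup>+w. ennreal (\<Prod>s<t. F u a s w * F v a s w) \<partial>noise n) = 1"
proof (induction t)
  case (Suc t)
  then have t: "t < n" by simp
  note [measurable] = F_meas[OF Suc(2) t]
  let ?R = "\<lambda>w. \<Prod>s<t. F u a s w * F v a s w"
  have [measurable]: "?R \<in> borel_measurable (noise n)"
    using t Suc(2) by (intro borel_measurable_prod borel_measurable_times F_meas) auto
  have "(\<integral>\<^sup>+w. ennreal (?R w) * ennreal (F u a t w) * ennreal (F v a t w) \<partial>noise n)
      = (\<integral>\<^sup>+w. ennreal (?R w) * ennreal (F u a t w) \<partial>noise n) * 1"
    by (rule nn_integral_drop[OF t, where k="ZD v"])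
      (simp_all add: F_ZD prod_FF_ZD Suc(2) nn_integral_F uv)
  also have "\<dots> = (\<integral>\<^sup>+w. ennreal (?R w) \<partial>noise n) * 1 * 1"
    by (subst nn_integral_drop[OF t, where k="ZD u" and c=1])
      (simp_all add: F_ZD prod_FF_ZD Suc(2) nn_integral_F uv)
  finally show ?case using Suc by (simp add: ennreal_mult prod_nonneg mult.assoc)
qed (simp add: noise.emeasure_space_1)

text \<open>The law \<open>S a n * (\<Prod>s<n. Q s / F u a s)\<close> replaces the output of receiver \<open>u\<close> by independent
  Gaussian noise and keeps the conditional law of the other output, so \<open>u\<close> learns nothing about \<open>a\<close>.\<close>
lemma nn_integral_ref:
  assumes a: "a < A" and t: "t \<le> n" and h: "h \<in> borel_measurable (noise n)"
    and ind: "\<And>s w z. h (w((s, ZD v) := z)) = h w"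
  shows "(\<integral>\<^sup>+w. h w * ennreal (S a t w * (\<Prod>s<t. Q s w / F u a s w)) \<partial>noise n)
    = ennreal (real B) * (\<integral>\<^sup>+w. h w * ennreal (\<Prod>s<t. Q s w) \<partial>noise n)"
  using t h ind
proof (induction t arbitrary: h)
  case 0
  then show ?case by (simp add: S_def nn_integral_multc mult.commute)
next
  case (Suc t)
  note [measurable] = Suc.prems(2)
  have t: "t < n" "t \<le> n" using Suc.prems by auto
  note [measurable] = Q_meas[OF t(1)] F_meas[OF a t(1)] S_meas[OF a t(2)] S_meas[OF a Suc.prems(1)]
  let ?R = "\<lambda>w. \<Prod>s<t. Q s w / F u a s w"
  let ?D = "\<lambda>w. \<Sum>b<B. L a b t w * K u a b t w"
  have [measurable]: "?R \<in> borel_measurable (noise n)"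
    using t a by (intro borel_measurable_prod borel_measurable_divide F_meas Q_meas) auto
  have [measurable]: "?D \<in> borel_measurable (noise n)"
    using t a by (intro borel_measurable_sum borel_measurable_times L_meas K_meas) auto
  have Dpos: "0 < ?D w" for w using AB by (intro sum_pos) auto
  have Rnn: "0 \<le> ?R w" for w by (intro prod_nonneg) auto
  have "(\<integral>\<^sup>+w. h w * ennreal (S a (Suc t) w * (\<Prod>s<Suc t. Q s w / F u a s w)) \<partial>noise n)
    = (\<integral>\<^sup>+w. (h w * ennreal (Q t w) * ennreal (S a t w * ?R w)) * ennreal (S a (Suc t) w / ?D w) \<partial>noise n)"
  proof (intro nn_integral_cong)
    fix w
    \<comment> \<open>Since \<open>F u a t\<close> is \<open>?D / S a t\<close>, the remaining ratio
      \<open>S a (Suc t) / ?D\<close> is the conditional density of the output of \<open>v\<close>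
      at time \<open>t\<close> given the past and the output of \<open>u\<close>. It is integrated
      out next.\<close>
    have "S a (Suc t) w * (\<Prod>s<Suc t. Q s w / F u a s w) = Q t w * (S a t w * ?R w) * (S a (Suc t) w / ?D w)"
      using Dpos[of w] by (simp add: F_def field_simps)
    moreover have "ennreal (Q t w * (S a t w * ?R w) * (S a (Suc t) w / ?D w))
        = ennreal (Q t w) * ennreal (S a t w * ?R w) * ennreal (S a (Suc t) w / ?D w)"
      using Dpos[of w] Rnn[of w] by (subst ennreal_mult, simp, simp, subst ennreal_mult) auto
    ultimately show "h w * ennreal (S a (Suc t) w * (\<Prod>s<Suc t. Q s w / F u a s w))
       = (h w * ennreal (Q t w) * ennreal (S a t w * ?R w)) * ennreal (S a (Suc t) w / ?D w)"
      by (simp only: mult.assoc)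
  qed
  also have "\<dots> = (\<integral>\<^sup>+w. h w * ennreal (Q t w) * ennreal (S a t w * ?R w) \<partial>noise n) * 1"
  proof (rule nn_integral_drop[OF t(1), where k="ZD v"])
    fix w z
    show "h (w((t, ZD v) := z)) * ennreal (Q t (w((t, ZD v) := z))) * ennreal (S a t (w((t, ZD v) := z)) * ?R (w((t, ZD v) := z)))
       = h w * ennreal (Q t w) * ennreal (S a t w * ?R w)"
      using uv by (simp only: Suc.prems(3) S_ZD[OF a order_refl] prod_QF_ZD[OF a]) (simp add: Q_ZD)
  next
    fix w
    have "S a (Suc t) (w((t, ZD v) := z)) / ?D (w((t, ZD v) := z))
       = (\<Sum>b<B. L a b t w * K u a b t w / ?D w * K v a b t (w((t, ZD v) := z)))" for z
    proof -
      have "?D (w((t, ZD v) := z)) = ?D w"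
        by (intro sum.cong refl) (use uv in \<open>auto simp: L_ZD K_ZD a\<close>)
      moreover have "S a (Suc t) (w((t, ZD v) := z)) = (\<Sum>b<B. L a b t w * K u a b t w * K v a b t (w((t, ZD v) := z)))"
        unfolding S_def L_Suc by (intro sum.cong refl) (use uv in \<open>auto simp: L_ZD K_ZD a\<close>)
      ultimately show ?thesis by (simp add: sum_divide_distrib)
    qed
    then show "(\<integral>\<^sup>+z. ennreal (S a (Suc t) (w((t, ZD v) := z)) / ?D (w((t, ZD v) := z))) \<partial>CN) = 1"
      using Dpos[of w] nn_integral_mix[OF a, of "\<lambda>b. L a b t w * K u a b t w / ?D w" v t w]
      by (simp flip: sum_divide_distrib)
  qed simp_all
  \<comment> \<open>The product of \<open>h\<close> and \<open>Q t\<close> again ignores the outputs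
    of \<open>v\<close>, so the induction hypothesis applies with this product in place of
    \<open>h\<close>.\<close>
  also have "\<dots> = ennreal (real B) * (\<integral>\<^sup>+w. h w * ennreal (Q t w) * ennreal (\<Prod>s<t. Q s w) \<partial>noise n)"
    using uv by (subst Suc.IH) (simp_all add: t Suc.prems Q_ZD)
  finally show ?case by (simp add: ennreal_mult prod_nonneg mult_ac)
qed

text \<open>Expectation when \<open>a\<close> and \<open>b\<close> are sent, with the outputs as
  coordinates. Integrability is carried along as \<open>I\<close>, because the Bochner integral of a
  non-integrable function is 0.\<close>

definition E where "E a b f = (\<integral>w. f w * L a b n w \<partial>noise n)"
definition I where "I a b f \<longleftrightarrow> integrable (noise n) (\<lambda>w. f w * L a b n w)"

lemma I_bound:
  assumes ab: "a < A" "b < B" and f: "f \<in> borel_measurable (noise n)" and g: "g \<in> borel_measurable (noise n)"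
    and le: "\<And>w. \<bar>f w\<bar> \<le> g w"
    and fin: "(\<integral>\<^sup>+w. ennreal (g w) * ennreal (L a b n w) \<partial>noise n) < \<infinity>"
  shows "I a b f"
  unfolding I_def
proof (rule integrableI_bounded)
  note [measurable] = f g L_meas[OF ab order_refl]
  show "(\<lambda>w. f w * L a b n w) \<in> borel_measurable (noise n)" by measurable
  have "(\<integral>\<^sup>+w. ennreal (norm (f w * L a b n w)) \<partial>noise n) \<le> (\<integral>\<^sup>+w. ennreal (g w) * ennreal (L a b n w) \<partial>noise n)"
    using order_trans[OF abs_ge_zero le]
    by (intro nn_integral_mono) (auto simp: abs_mult ennreal_mult[symmetric] intro!: mult_right_mono le ennreal_leI)
  then show "(\<integral>\<^sup>+w. ennreal (norm (f w * L a b n w)) \<partial>noise n) < \<infinity>" using fin by (rule order.strict_trans1)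
qed

lemma I_add: "I a b f \<Longrightarrow> I a b g \<Longrightarrow> I a b (\<lambda>w. f w + g w)"
  and E_add: "I a b f \<Longrightarrow> I a b g \<Longrightarrow> E a b (\<lambda>w. f w + g w) = E a b f + E a b g"
  and I_diff: "I a b f \<Longrightarrow> I a b g \<Longrightarrow> I a b (\<lambda>w. f w - g w)"
  and E_diff: "I a b f \<Longrightarrow> I a b g \<Longrightarrow> E a b (\<lambda>w. f w - g w) = E a b f - E a b g"
  and I_cmult: "I a b f \<Longrightarrow> I a b (\<lambda>w. c * f w)"
  and E_cmult: "E a b (\<lambda>w. c * f w) = c * E a b f"
  by (simp_all add: I_def E_def distrib_right left_diff_distrib mult.assoc)

lemma I_sum: "(\<And>t. t < m \<Longrightarrow> I a b (f t)) \<Longrightarrow> I a b (\<lambda>w. \<Sum>t<(m::nat). f t w)"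
  and E_sum: "(\<And>t. t < m \<Longrightarrow> I a b (f t)) \<Longrightarrow> E a b (\<lambda>w. \<Sum>t<(m::nat). f t w) = (\<Sum>t<m. E a b (f t))"
  by (auto simp: I_def E_def sum_distrib_right)

lemma nn_L: "a < A \<Longrightarrow> b < B \<Longrightarrow> (\<integral>\<^sup>+w. ennreal (L a b n w) \<partial>noise n) = 1"
  by (rule causal.nn_integral_Lik[OF causal]) auto

lemma I_const: assumes ab: "a < A" "b < B" shows "I a b (\<lambda>_. c)"
  by (rule I_bound[OF ab, where g="\<lambda>_. \<bar>c\<bar>"])
    (use L_meas[OF ab order_refl] nn_L[OF ab] in \<open>auto simp: nn_integral_cmult\<close>)

lemma E_const: assumes ab: "a < A" "b < B" shows "E a b (\<lambda>_. c) = c"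
proof -
  have "integral\<^sup>L (noise n) (L a b n) = 1"
    using nn_L[OF ab] L_meas[OF ab order_refl] by (subst integral_eq_nn_integral) auto
  then show ?thesis by (simp add: E_def)
qed

lemma I_ind:
  assumes ab: "a < A" "b < B" and "d \<in> noise n \<rightarrow>\<^sub>M count_space UNIV"
  shows "I a b (\<lambda>w. if d w = (c::nat) then 1 else 0)"
  by (rule I_bound[OF ab, where g="\<lambda>_. 1"]) (use assms nn_L[OF ab] in \<open>auto\<close>)

lemma E_mono: "I a b f \<Longrightarrow> I a b g \<Longrightarrow> (\<And>w. f w \<le> g w) \<Longrightarrow> E a b f \<le> E a b g"
  unfolding I_def E_def by (intro integral_mono mult_right_mono) auto

lemma nn_out:
  assumes ab: "a < A" "b < B" and t: "t < n"
  shows "(\<integral>\<^sup>+w. ennreal ((cmod (w (t, ZD p)))\<^sup>2) * ennreal (L a b n w) \<partial>noise n)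
     \<le> ennreal (3 * \<kappa> * (e a b t One + e a b t Two + 1))"
  using causal.nn_integral_output_sq[OF causal[OF ab] t, of p] e(1,2)[OF ab t] \<kappa>_nonneg
  by (simp add: ennreal_mult add_nonneg_nonneg)

lemma I_out:
  assumes ab: "a < A" "b < B" and t: "t < n"
  shows "I a b (\<lambda>w. (cmod (w (t, ZD p)))\<^sup>2)"
  by (rule I_bound[OF ab, where g="\<lambda>w. (cmod (w (t, ZD p)))\<^sup>2"])
    (use nn_out[OF ab t, of p] t in \<open>auto intro: order.strict_trans1\<close>)

lemma E_out:
  assumes ab: "a < A" "b < B" and t: "t < n"
  shows "E a b (\<lambda>w. (cmod (w (t, ZD p)))\<^sup>2) \<le> 3 * \<kappa> * (e a b t One + e a b t Two + 1)"
proof -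
  have "ennreal (E a b (\<lambda>w. (cmod (w (t, ZD p)))\<^sup>2))
     = (\<integral>\<^sup>+w. ennreal ((cmod (w (t, ZD p)))\<^sup>2 * L a b n w) \<partial>noise n)"
    unfolding E_def using I_out[OF ab t, of p] by (subst nn_integral_eq_integral) (auto simp: I_def)
  then show ?thesis
    using nn_out[OF ab t, of p] e(1)[OF ab t] \<kappa>_nonneg
    by (subst ennreal_le_iff[symmetric]) (auto simp: ennreal_mult)
qed

lemma I_noise:
  assumes ab: "a < A" "b < B" and t: "t < n"
  shows "I a b (\<lambda>w. (cmod (w (t, ZD p) - sig (x a b) p t w))\<^sup>2)"
  using causal.sig_meas[OF causal[OF ab] t, of p] causal.nn_integral_noise_sq[OF causal[OF ab] t, of p] t
  by (intro I_bound[OF ab, where g="\<lambda>w. (cmod (w (t, ZD p) - sig (x a b) p t w))\<^sup>2"]) auto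

lemma I_lnK:
  assumes ab: "a < A" "b < B" and t: "t < n"
  shows "I a b (\<lambda>w. ln (K p a b t w))"
  unfolding lik_def ln_shift_dens by (intro I_diff I_out I_noise assms)

lemma ln_Q: "ln (Q t w) = (1 - 1 / P) * (cmod (w (t, ZD u)))\<^sup>2 - ln P"
  using P by (simp add: Q_def ln_div algebra_simps)

lemma I_lnQ:
  assumes ab: "a < A" "b < B" and t: "t < n"
  shows "I a b (\<lambda>w. ln (Q t w))"
  unfolding ln_Q by (intro I_diff I_cmult I_out I_const assms)

text \<open>The integrand is the reciprocal of the posterior probability of \<open>b\<close> given
  the outputs before \<open>t\<close>. Its mean is \<open>B\<close>, as the denominator cancels
  against the likelihood.\<close>

lemma I_post:
  assumes ab: "a < A" "b < B" and t: "t < n"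
  shows "I a b (\<lambda>w. S a t w / L a b t w)"
proof (rule I_bound[OF ab, where g="\<lambda>w. S a t w / L a b t w"])
  have tn: "t \<le> n" using t by simp
  note [measurable] = S_meas[OF ab(1) tn] L_meas[OF ab tn]
  show m: "(\<lambda>w. S a t w / L a b t w) \<in> borel_measurable (noise n)" by measurable
  then show "(\<lambda>w. S a t w / L a b t w) \<in> borel_measurable (noise n)" .
  have "(\<integral>\<^sup>+w. ennreal (S a t w / L a b t w) * ennreal (L a b n w) \<partial>noise n)
     = (\<integral>\<^sup>+w. ennreal (S a t w / L a b t w) * ennreal (L a b t w) \<partial>noise n)"
    by (rule causal.nn_integral_Lik_drop[OF causal[OF ab] tn]) (use m in \<open>auto simp: S_ZD L_ZD ab\<close>)
  also have "\<dots> = (\<integral>\<^sup>+w. (\<Sum>b<B. ennreal (L a b t w)) \<partial>noise n)"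
    by (intro nn_integral_cong, subst ennreal_mult[symmetric]) (simp, simp, simp add: S_def sum_ennreal)
  also have "\<dots> = (\<Sum>b<B. 1)"
    using ab tn by (subst nn_integral_sum) (auto intro!: L_meas simp: causal.nn_integral_Lik[OF causal])
  finally show "(\<integral>\<^sup>+w. ennreal (S a t w / L a b t w) * ennreal (L a b n w) \<partial>noise n) < \<infinity>"
    by (simp add: ennreal_of_nat_eq_real_of_nat)
qed simp

text \<open>From above, every shifted density is at most \<open>exp\<close> of the squared output.
  From below, the mixture is at least its summand for the message \<open>b\<close> actually sent,
  which costs the logarithm of the reciprocal posterior.\<close>

lemma lnF_bound:
  assumes ab: "a < A" "b < B"
  shows "\<bar>ln (F p a t w)\<bar> \<le> (cmod (w (t, ZD p)))\<^sup>2 + (cmod (w (t, ZD p) - sig (x a b) p t w))\<^sup>2 + S a t w / L a b t w"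
proof -
  have "F p a t w \<le> exp ((cmod (w (t, ZD p)))\<^sup>2)"
  proof -
    have "(\<Sum>b<B. L a b t w * K p a b t w) \<le> (\<Sum>b<B. L a b t w * exp ((cmod (w (t, ZD p)))\<^sup>2))"
      by (intro sum_mono mult_left_mono) (auto simp: lik_def shift_dens_def)
    then show ?thesis by (simp add: F_def S_def[symmetric] sum_distrib_right[symmetric] divide_le_eq mult.commute)
  qed
  then have up: "ln (F p a t w) \<le> (cmod (w (t, ZD p)))\<^sup>2"
    using ln_le_cancel_iff[of "F p a t w" "exp ((cmod (w (t, ZD p)))\<^sup>2)"] by simp
  have "L a b t w * K p a b t w \<le> (\<Sum>b<B. L a b t w * K p a b t w)"
    using ab by (intro member_le_sum) auto
  then have "L a b t w * K p a b t w / S a t w \<le> F p a t w"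
    by (simp add: F_def divide_right_mono)
  then have "ln (L a b t w * K p a b t w / S a t w) \<le> ln (F p a t w)"
    by (subst ln_le_cancel_iff) auto
  moreover have "ln (L a b t w * K p a b t w / S a t w) = ln (K p a b t w) - ln (S a t w / L a b t w)"
    by (simp add: ln_div ln_mult)
  moreover have "ln (S a t w / L a b t w) \<le> S a t w / L a b t w"
    using ln_le_minus_one[of "S a t w / L a b t w"] by simp
  moreover have "0 \<le> S a t w / L a b t w" by simp
  moreover note zero_le_power2[of "cmod (w (t, ZD p))"] zero_le_power2[of "cmod (w (t, ZD p) - sig (x a b) p t w)"]
  ultimately show ?thesis using up unfolding lik_def ln_shift_dens by (intro abs_leI) linarith+
qed

lemma I_lnF:
  assumes ab: "a < A" "b < B" and t: "t < n"
  shows "I a b (\<lambda>w. ln (F p a t w))"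
proof -
  note [measurable] = F_meas[OF ab(1) t, of p] L_meas[OF ab order_refl]
  have 1: "I a b (\<lambda>w. (cmod (w (t, ZD p)))\<^sup>2 + (cmod (w (t, ZD p) - sig (x a b) p t w))\<^sup>2 + S a t w / L a b t w)"
    by (intro I_add I_out I_noise I_post assms)
  show ?thesis unfolding I_def
  proof (rule Bochner_Integration.integrable_bound[OF 1[unfolded I_def]])
    show "(\<lambda>w. ln (F p a t w) * L a b n w) \<in> borel_measurable (noise n)" by measurable
    show "AE w in noise n. norm (ln (F p a t w) * L a b n w)
      \<le> norm (((cmod (w (t, ZD p)))\<^sup>2 + (cmod (w (t, ZD p) - sig (x a b) p t w))\<^sup>2 + S a t w / L a b t w) * L a b n w)"
      using lnF_bound[OF ab, of p t]
      by (auto simp: abs_mult intro!: AE_I2 mult_right_mono order_trans[OF lnF_bound[OF ab] abs_ge_self])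
  qed
qed

lemma E_swap_users:
  assumes ab: "a < A" "b < B" and t: "t < n"
    and f: "f \<in> borel_measurable (noise n)" "f' \<in> borel_measurable (noise n)"
    and ind: "\<And>s p z w. t < s \<Longrightarrow> f (w((s, ZD p) := z)) = f w" "\<And>s p z w. t < s \<Longrightarrow> f' (w((s, ZD p) := z)) = f' w"
    and f': "\<And>w. f' w = f (swap_users t w)"
  shows "E a b f = E a b f'"
proof -
  note [measurable] = f L_meas[OF ab order_refl]
  \<comment> \<open>The values \<open>c = 1\<close> and \<open>c = -1\<close> yield the positive and
    the negative part.\<close>
  have eq: "(\<integral>\<^sup>+w. ennreal (c * f w) * ennreal (L a b n w) \<partial>noise n) = (\<integral>\<^sup>+w. ennreal (c * f' w) * ennreal (L a b n w) \<partial>noise n)" for c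
    by (rule causal.nn_integral_Lik_swap_users[OF causal[OF ab] t])
      (measurable, measurable, simp add: ind, simp add: ind, simp add: f')
  show ?thesis unfolding E_def
    by (rule integral_cong_parts) (use eq[of 1] eq[of "-1"] in \<open>auto simp: ennreal_mult''[symmetric]\<close>)
qed

lemma K_swap_users: "a < A \<Longrightarrow> b < B \<Longrightarrow> K v a b t w = K u a b t (swap_users t w)"
  using uv causal.lik_swap_users[OF causal, of a b t w] by (cases u; cases v) auto

lemma F_swap_users: "a < A \<Longrightarrow> F v a t w = F u a t (swap_users t w)"
  unfolding F_def S_def using causal.Lik_swap_users[OF causal] K_swap_users by (auto intro!: arg_cong2[where f="(/)"] sum.cong)

lemma E_lnK_swap_users:
  assumes ab: "a < A" "b < B" and t: "t < n"
  shows "E a b (\<lambda>w. ln (K u a b t w)) = E a b (\<lambda>w. ln (K v a b t w))"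
  by (rule E_swap_users[OF ab t])
    (intro borel_measurable_ln K_meas ab t, intro borel_measurable_ln K_meas ab t, simp add: K_ZD ab, simp add: K_ZD ab, simp add: K_swap_users ab)

lemma E_lnF_swap_users:
  assumes ab: "a < A" "b < B" and t: "t < n"
  shows "E a b (\<lambda>w. ln (F u a t w)) = E a b (\<lambda>w. ln (F v a t w))"
  by (rule E_swap_users[OF ab t])
    (intro borel_measurable_ln F_meas ab t, intro borel_measurable_ln F_meas ab t, simp add: F_ZD ab, simp add: F_ZD ab, simp add: F_swap_users ab)

text \<open>Fano's inequality is replaced by \<open>ln g \<le> g - 1\<close> for the likelihood ratio times a factor \<open>T\<close> that rewards
  correct decisions: under the reference law the reward has mean at most 2.\<close>
lemma information_common:
  shows "(\<Sum>a<A. \<Sum>b<B. E a b (\<lambda>w. ln (real A) * (if d1 w = a then 1 else 0) + (\<Sum>t<n. ln (Q t w) - ln (F u a t w))))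
     \<le> real A * real B"
proof -
  define T where "T a w = (if d1 w = a then real A else 1)" for a w
  have T: "1 \<le> T a w" "0 < T a w" "0 \<le> T a w" for a w using AB by (auto simp: T_def)
  have T_meas[measurable]: "T a \<in> borel_measurable (noise n)" for a unfolding T_def by measurable
  define g where "g a w = T a w * (\<Prod>t<n. Q t w / F u a t w)" for a w
  have gpos: "0 < g a w" for a w unfolding g_def using T by (intro mult_pos_pos prod_pos) auto
  have g_meas: "g a \<in> borel_measurable (noise n)" if "a < A" for a
    unfolding g_def using that
    by (intro borel_measurable_times T_meas borel_measurable_prod borel_measurable_divide Q_meas F_meas) auto
  let ?f = "\<lambda>a w. ln (real A) * (if d1 w = a then 1 else 0) + (\<Sum>t<n. ln (Q t w) - ln (F u a t w))"
  have lng: "?f a w = ln (g a w)" for a w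
  proof -
    have "ln (T a w) = ln (real A) * (if d1 w = a then 1 else 0)" by (simp add: T_def)
    moreover have "ln (\<Prod>t<n. Q t w / F u a t w) = (\<Sum>t<n. ln (Q t w) - ln (F u a t w))"
      by (subst ln_prod) (auto simp: ln_div)
    moreover have "ln (g a w) = ln (T a w) + ln (\<Prod>t<n. Q t w / F u a t w)"
      unfolding g_def using T by (intro ln_mult_pos prod_pos) auto
    ultimately show ?thesis by simp
  qed
  define N where "N a = (\<integral>\<^sup>+w. ennreal (g a w * S a n w) \<partial>noise n)" for a
  have N: "N a = ennreal (real B) * (\<integral>\<^sup>+w. ennreal (T a w) * ennreal (\<Prod>t<n. Q t w) \<partial>noise n)" if a: "a < A" for a
  proof -
    have "N a = (\<integral>\<^sup>+w. ennreal (T a w) * ennreal (S a n w * (\<Prod>t<n. Q t w / F u a t w)) \<partial>noise n)"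
      unfolding N_def g_def using T by (simp add: ennreal_mult[symmetric] prod_nonneg mult_ac)
    also have "\<dots> = ennreal (real B) * (\<integral>\<^sup>+w. ennreal (T a w) * ennreal (\<Prod>t<n. Q t w) \<partial>noise n)"
      by (rule nn_integral_ref[OF a order_refl]) (simp_all add: T_def d1_ZD)
    finally show ?thesis .
  qed
  have Qm: "(\<lambda>w. \<Prod>t<n. Q t w) \<in> borel_measurable (noise n)"
    by (intro borel_measurable_prod Q_meas) auto
  have Nsum: "(\<Sum>a<A. N a) \<le> ennreal (2 * real A * real B)"
  proof -
    have "(\<Sum>a<A. N a) = ennreal (real B) * (\<integral>\<^sup>+w. (\<Sum>a<A. ennreal (T a w) * ennreal (\<Prod>t<n. Q t w)) \<partial>noise n)"
      using Qm by (subst nn_integral_sum) (auto simp: N sum_distrib_left)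
    also have "\<dots> \<le> ennreal (real B) * (\<integral>\<^sup>+w. ennreal (2 * real A) * ennreal (\<Prod>t<n. Q t w) \<partial>noise n)"
    proof (intro mult_left_mono nn_integral_mono)
      fix w
      \<comment> \<open>At most one \<open>a\<close> equals \<open>d1 w\<close>, so the rewards add
        at most \<open>A\<close> to the sum of the \<open>A\<close> ones.\<close>
      have "(\<Sum>a<A. T a w) \<le> (\<Sum>a<A. 1 + (if d1 w = a then real A else 0))"
        by (intro sum_mono) (auto simp: T_def)
      also have "\<dots> \<le> 2 * real A" by (simp add: sum.distrib)
      finally show "(\<Sum>a<A. ennreal (T a w) * ennreal (\<Prod>t<n. Q t w)) \<le> ennreal (2 * real A) * ennreal (\<Prod>t<n. Q t w)"
        using T by (simp add: sum_distrib_right[symmetric] sum_ennreal mult_right_mono ennreal_leI)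
    qed simp
    also have "\<dots> = ennreal (real B) * ennreal (2 * real A)"
      using Qm by (simp add: nn_integral_cmult nn_integral_Q_prod)
    also have "\<dots> = ennreal (2 * real A * real B)"
      by (simp only: ennreal_mult'[symmetric] of_nat_0_le_iff mult_ac)
    finally show ?thesis .
  qed
  have Nfin: "N a < \<infinity>" if "a < A" for a
  proof -
    have "N a \<le> (\<Sum>a<A. N a)" using that by (intro member_le_sum) auto
    also note Nsum
    also have "ennreal (2 * real A * real B) < \<infinity>" by simp
    finally show ?thesis .
  qed
  have gS: "integrable (noise n) (\<lambda>w. g a w * S a n w)" if a: "a < A" for a
    using g_meas[OF a] S_meas[OF a order_refl] gpos[of a] Nfin[OF a]
    by (intro integrableI_bounded) (auto simp: N_def abs_mult less_imp_le)
  have NE: "N a = ennreal (\<integral>w. g a w * S a n w \<partial>noise n)" if "a < A" for a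
    unfolding N_def using gS[OF that] gpos[of a] by (intro nn_integral_eq_integral) (auto simp: less_imp_le)
  have If: "I a b (?f a)" if "a < A" "b < B" for a b
    using that by (intro I_add I_cmult I_ind I_sum I_diff I_lnQ I_lnF d1_meas) auto
  have one: "(\<Sum>b<B. E a b (?f a)) \<le> (\<integral>w. g a w * S a n w \<partial>noise n) - real B" if a: "a < A" for a
  proof -
    have iS: "integrable (noise n) (S a n)" and eS: "(\<integral>w. S a n w \<partial>noise n) = real B"
      using I_const[OF a, of _ 1] E_const[OF a, of _ 1] unfolding I_def E_def S_def by auto
    have "(\<Sum>b<B. E a b (?f a)) = (\<integral>w. ln (g a w) * S a n w \<partial>noise n)"
      using If[OF a] unfolding lng E_def I_def S_def sum_distrib_left by (subst Bochner_Integration.integral_sum) auto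
    also have "\<dots> \<le> (\<integral>w. g a w * S a n w - S a n w \<partial>noise n)"
    proof (rule integral_mono)
      show "integrable (noise n) (\<lambda>w. ln (g a w) * S a n w)"
        using If[OF a] unfolding lng I_def S_def sum_distrib_left by auto
      show "integrable (noise n) (\<lambda>w. g a w * S a n w - S a n w)" using gS[OF a] iS by auto
      show "ln (g a w) * S a n w \<le> g a w * S a n w - S a n w" for w
        using mult_right_mono[OF ln_le_minus_one[OF gpos[of a w]], of "S a n w"] by (simp add: left_diff_distrib)
    qed
    also have "\<dots> = (\<integral>w. g a w * S a n w \<partial>noise n) - real B" using gS[OF a] iS eS by simp
    finally show ?thesis .
  qed
  have "ennreal (\<Sum>a<A. \<integral>w. g a w * S a n w \<partial>noise n) = (\<Sum>a<A. N a)"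
    by (subst sum_ennreal[symmetric])
      (auto simp: NE intro!: integral_nonneg_AE AE_I2 mult_nonneg_nonneg less_imp_le[OF gpos])
  then have "(\<Sum>a<A. \<integral>w. g a w * S a n w \<partial>noise n) \<le> 2 * real A * real B"
    using Nsum by (subst ennreal_le_iff[symmetric]) auto
  moreover have "(\<Sum>a<A. \<Sum>b<B. E a b (?f a)) \<le> (\<Sum>a<A. (\<integral>w. g a w * S a n w \<partial>noise n) - real B)"
    by (intro sum_mono one) auto
  ultimately show ?thesis by (simp add: sum_subtractf)
qed

text \<open>The same device with the product of the \<open>F\<close> densities as reference. This
  reference has mass 1 for each \<open>a\<close> and is the same for all \<open>b\<close>, so again
  at most one \<open>b\<close> is rewarded at each point, even if the decision uses both
  outputs.\<close>

lemma information_private: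
  shows "(\<Sum>a<A. \<Sum>b<B. E a b (\<lambda>w. ln (real B) * (if d2 w = b then 1 else 0)
      + (\<Sum>t<n. ln (F u a t w) + ln (F v a t w) - (ln (K u a b t w) + ln (K v a b t w)))))
     \<le> real A * real B"
proof -
  define T where "T b w = (if d2 w = b then real B else 1)" for b w
  have T: "1 \<le> T a w" "0 < T a w" "0 \<le> T a w" for a w using AB by (auto simp: T_def)
  have T_meas[measurable]: "T a \<in> borel_measurable (noise n)" for a unfolding T_def by measurable
  let ?f = "\<lambda>a b w. ln (real B) * (if d2 w = b then 1 else 0)
      + (\<Sum>t<n. ln (F u a t w) + ln (F v a t w) - (ln (K u a b t w) + ln (K v a b t w)))"
  define R where "R a w = (\<Prod>t<n. F u a t w * F v a t w)" for a w
  have Rpos: "0 < R a w" "0 \<le> R a w" for a w unfolding R_def by (intro prod_pos prod_nonneg; simp)+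
  have Rm[measurable]: "R a \<in> borel_measurable (noise n)" if "a < A" for a
    unfolding R_def using that by (intro borel_measurable_prod borel_measurable_times F_meas) auto
  have L: "L a b n w = (\<Prod>t<n. K u a b t w * K v a b t w)" for a b w
    using uv unfolding Lik_def by (cases u; cases v) (auto simp: mult.commute)
  define g where "g a b w = T b w * (R a w / L a b n w)" for a b w
  have gpos: "0 < g a b w" for a b w unfolding g_def using T Rpos by (intro mult_pos_pos divide_pos_pos) auto
  have gL: "g a b w * L a b n w = T b w * R a w" for a b w by (simp add: g_def)
  have lng: "?f a b w = ln (g a b w)" for a b w
  proof -
    have "ln (T b w) = ln (real B) * (if d2 w = b then 1 else 0)" by (simp add: T_def)
    moreover have "ln (R a w) = (\<Sum>t<n. ln (F u a t w) + ln (F v a t w))"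
      unfolding R_def by (subst ln_prod) (auto simp: ln_mult)
    moreover have "ln (L a b n w) = (\<Sum>t<n. ln (K u a b t w) + ln (K v a b t w))"
      unfolding L by (subst ln_prod) (auto simp: ln_mult)
    moreover have "ln (g a b w) = ln (T b w) + (ln (R a w) - ln (L a b n w))"
      unfolding g_def using T(2)[of b w] Rpos(1)[of a w]
      by (subst ln_mult_pos, simp, simp, subst ln_div) (auto dest: less_imp_neq)
    ultimately show ?thesis by (simp add: sum_subtractf)
  qed
  define N where "N a b = (\<integral>\<^sup>+w. ennreal (T b w * R a w) \<partial>noise n)" for a b
  have Nsum: "(\<Sum>b<B. N a b) \<le> ennreal (2 * real B)" if a: "a < A" for a
  proof -
    have "(\<Sum>b<B. N a b) = (\<integral>\<^sup>+w. (\<Sum>b<B. ennreal (T b w * R a w)) \<partial>noise n)"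
      unfolding N_def using Rm[OF a] by (subst nn_integral_sum) auto
    also have "\<dots> \<le> (\<integral>\<^sup>+w. ennreal (2 * real B) * ennreal (R a w) \<partial>noise n)"
    proof (intro nn_integral_mono)
      fix w
      have "(\<Sum>b<B. T b w) \<le> (\<Sum>b<B. 1 + (if d2 w = b then real B else 0))"
        by (intro sum_mono) (auto simp: T_def)
      also have "\<dots> \<le> 2 * real B" by (simp add: sum.distrib)
      finally have "(\<Sum>b<B. T b w) * R a w \<le> 2 * real B * R a w" using Rpos by (intro mult_right_mono) auto
      then show "(\<Sum>b<B. ennreal (T b w * R a w)) \<le> ennreal (2 * real B) * ennreal (R a w)"
        using T Rpos by (subst sum_ennreal) (auto simp: sum_distrib_right ennreal_mult'[symmetric] intro!: ennreal_leI)
    qed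
    also have "\<dots> = ennreal (2 * real B)"
      using Rm[OF a] nn_integral_FF_prod[OF a order_refl, folded R_def]
      by (subst nn_integral_cmult) simp_all
    finally show ?thesis .
  qed
  have Nfin: "N a b < \<infinity>" if "a < A" "b < B" for a b
  proof -
    have "N a b \<le> (\<Sum>b<B. N a b)" using that by (intro member_le_sum) auto
    also note Nsum[OF that(1)]
    also have "ennreal (2 * real B) < \<infinity>" by simp
    finally show ?thesis .
  qed
  have gS: "integrable (noise n) (\<lambda>w. T b w * R a w)" if ab: "a < A" "b < B" for a b
    using Rm[OF ab(1)] T(3)[of b] Rpos(2)[of a] Nfin[OF ab]
    by (intro integrableI_bounded) (auto simp: N_def abs_mult)
  have NE: "N a b = ennreal (\<integral>w. T b w * R a w \<partial>noise n)" if "a < A" "b < B" for a b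
    unfolding N_def using gS[OF that] T(3)[of b] Rpos(2)[of a] by (intro nn_integral_eq_integral) auto
  have If: "I a b (?f a b)" if "a < A" "b < B" for a b
    using that by (intro I_add I_cmult I_ind I_sum I_diff I_lnK I_lnF d2_meas) auto
  have one: "E a b (?f a b) \<le> (\<integral>w. T b w * R a w \<partial>noise n) - 1" if ab: "a < A" "b < B" for a b
  proof -
    have iL: "integrable (noise n) (L a b n)" and eL: "(\<integral>w. L a b n w \<partial>noise n) = 1"
      using I_const[OF ab, of 1] E_const[OF ab, of 1] unfolding I_def E_def by auto
    have "E a b (?f a b) \<le> (\<integral>w. T b w * R a w - L a b n w \<partial>noise n)"
      unfolding E_def
    proof (rule integral_mono)
      show "integrable (noise n) (\<lambda>w. ?f a b w * L a b n w)"
        using If[OF ab] unfolding I_def .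
      show "integrable (noise n) (\<lambda>w. T b w * R a w - L a b n w)" using gS[OF ab] iL by auto
      show "?f a b w * L a b n w \<le> T b w * R a w - L a b n w" for w
        unfolding lng gL[symmetric] using mult_right_mono[OF ln_le_minus_one[OF gpos[of a b w]], of "L a b n w"]
        by (simp add: left_diff_distrib)
    qed
    also have "\<dots> = (\<integral>w. T b w * R a w \<partial>noise n) - 1" using gS[OF ab] iL eL by simp
    finally show ?thesis .
  qed
  have "(\<Sum>b<B. E a b (?f a b)) \<le> real B" if a: "a < A" for a
  proof -
    have "ennreal (\<Sum>b<B. \<integral>w. T b w * R a w \<partial>noise n) = (\<Sum>b<B. N a b)"
      using T Rpos a by (subst sum_ennreal[symmetric]) (auto simp: NE intro!: integral_nonneg_AE AE_I2)
    then have "(\<Sum>b<B. \<integral>w. T b w * R a w \<partial>noise n) \<le> 2 * real B"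
      using Nsum[OF a] by (subst ennreal_le_iff[symmetric]) auto
    moreover have "(\<Sum>b<B. E a b (?f a b)) \<le> (\<Sum>b<B. (\<integral>w. T b w * R a w \<partial>noise n) - 1)"
      using a by (intro sum_mono one) auto
    ultimately show ?thesis by (simp add: sum_subtractf)
  qed
  then have "(\<Sum>a<A. \<Sum>b<B. E a b (?f a b)) \<le> (\<Sum>a<A. real B)" by (intro sum_mono) auto
  then show ?thesis by simp
qed

text \<open>The difference of logarithms is \<open>ln P\<close> plus the squared output divided by
  \<open>P\<close>, minus the squared noise. Variance \<open>P\<close> for the comparison Gaussian
  scales the output energy down to order one.\<close>

lemma E_gain:
  assumes ab: "a < A" "b < B" and t: "t < n"
  shows "E a b (\<lambda>w. ln (K u a b t w)) - E a b (\<lambda>w. ln (Q t w)) \<le> ln P + 3 * \<kappa> * (e a b t One + e a b t Two + 1) / P"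
proof -
  have "E a b (\<lambda>w. ln (K u a b t w)) - E a b (\<lambda>w. ln (Q t w)) = E a b (\<lambda>w. ln (K u a b t w) - ln (Q t w))"
    by (intro E_diff[symmetric] I_lnK I_lnQ assms)
  also have "\<dots> \<le> E a b (\<lambda>w. ln P + 1 / P * (cmod (w (t, ZD u)))\<^sup>2)"
    by (intro E_mono I_diff I_lnK I_lnQ I_add I_const I_cmult I_out assms)
      (simp add: lik_def ln_shift_dens ln_Q algebra_simps)
  also have "\<dots> = ln P + 1 / P * E a b (\<lambda>w. (cmod (w (t, ZD u)))\<^sup>2)"
    by (subst E_add) (auto intro!: I_const I_cmult[of _ _ _ "1 / P", simplified] I_out assms simp: E_const[OF ab] E_cmult[of _ _ "1 / P", simplified])
  also have "\<dots> \<le> ln P + 1 / P * (3 * \<kappa> * (e a b t One + e a b t Two + 1))"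
    using P by (intro add_left_mono mult_left_mono E_out assms) auto
  finally show ?thesis by simp
qed

definition succ1 where "succ1 = (\<Sum>a<A. \<Sum>b<B. E a b (\<lambda>w. if d1 w = a then 1 else 0))"
definition succ2 where "succ2 = (\<Sum>a<A. \<Sum>b<B. E a b (\<lambda>w. if d2 w = b then 1 else 0))"

text \<open>Exchangeability turns the bound for \<open>v\<close> into one with
  \<open>2 * f - 2 * k\<close>, so adding it to twice the bound for \<open>u\<close> cancels
  \<open>f\<close> and leaves \<open>2 * (k - q)\<close> per use. The 3 is 2 + 1 from the two
  right-hand sides.\<close>

theorem rate_bound:
  "2 * ln (real A) * succ1 + ln (real B) * succ2 \<le> real A * real B * (3 + 2 * real n * (ln P + 9 * \<kappa>))"
proof -
  define k where "k a b t = E a b (\<lambda>w. ln (K u a b t w))" for a b t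
  define q where "q a b t = E a b (\<lambda>w. ln (Q t w))" for a b t
  define f where "f a b t = E a b (\<lambda>w. ln (F u a t w))" for a b t
  define s1 where "s1 a b = E a b (\<lambda>w. if d1 w = a then 1 else 0)" for a b
  define s2 where "s2 a b = E a b (\<lambda>w. if d2 w = b then 1 else 0)" for a b
  have e1: "E a b (\<lambda>w. ln (real A) * (if d1 w = a then 1 else 0) + (\<Sum>t<n. ln (Q t w) - ln (F u a t w)))
      = ln (real A) * s1 a b + (\<Sum>t<n. q a b t - f a b t)" if ab: "a < A" "b < B" for a b
    unfolding s1_def q_def f_def
    by (simp add: E_add E_cmult E_sum E_diff I_add I_cmult I_ind I_sum I_diff I_lnQ I_lnF d1_meas ab)
  have e2: "E a b (\<lambda>w. ln (real B) * (if d2 w = b then 1 else 0)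
      + (\<Sum>t<n. ln (F u a t w) + ln (F v a t w) - (ln (K u a b t w) + ln (K v a b t w))))
      = ln (real B) * s2 a b + (\<Sum>t<n. 2 * f a b t - 2 * k a b t)" if ab: "a < A" "b < B" for a b
    unfolding s2_def k_def f_def
    by (simp add: E_add E_cmult E_sum E_diff I_add I_cmult I_ind I_sum I_diff I_lnK I_lnF d2_meas ab
       E_lnK_swap_users[symmetric] E_lnF_swap_users[symmetric] cong: sum.cong_simp)
  have gain: "(\<Sum>t<n. k a b t - q a b t) \<le> real n * (ln P + 9 * \<kappa>)" if ab: "a < A" "b < B" for a b
  proof -
    have "(\<Sum>t<n. k a b t - q a b t) \<le> (\<Sum>t<n. ln P + 3 * \<kappa> / P * (e a b t One + e a b t Two + 1))"
      unfolding k_def q_def using E_gain[OF ab] by (intro sum_mono) simp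
    also have "\<dots> = real n * ln P + 3 * \<kappa> / P * ((\<Sum>t<n. e a b t One) + (\<Sum>t<n. e a b t Two) + real n)"
      by (simp only: sum.distrib sum_distrib_left[symmetric]) simp
    \<comment> \<open>The two inputs and, by \<open>1 \<le> P\<close>, the noise term each
      contribute at most \<open>n * P\<close>; three times \<open>3 * \<kappa>\<close> gives
      \<open>9 * \<kappa>\<close>.\<close>
    also have "\<dots> \<le> real n * ln P + 3 * \<kappa> / P * (real n * P + real n * P + real n * P)"
      using e(3)[OF ab, of One] e(3)[OF ab, of Two] P \<kappa>_nonneg
      by (intro add_left_mono mult_left_mono add_mono) (auto simp: mult_le_cancel_left1)
    also have "\<dots> = real n * (ln P + 9 * \<kappa>)" using P by (simp add: field_simps)
    finally show ?thesis .
  qed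
  have A: "(\<Sum>a<A. \<Sum>b<B. ln (real A) * s1 a b + (\<Sum>t<n. q a b t - f a b t)) \<le> real A * real B"
    using information_common by (simp add: e1)
  have B: "(\<Sum>a<A. \<Sum>b<B. ln (real B) * s2 a b + (\<Sum>t<n. 2 * f a b t - 2 * k a b t)) \<le> real A * real B"
    using information_private by (simp add: e2)
  have "2 * ln (real A) * succ1 + ln (real B) * succ2
    = 2 * (\<Sum>a<A. \<Sum>b<B. ln (real A) * s1 a b + (\<Sum>t<n. q a b t - f a b t))
     + (\<Sum>a<A. \<Sum>b<B. ln (real B) * s2 a b + (\<Sum>t<n. 2 * f a b t - 2 * k a b t))
     + 2 * (\<Sum>a<A. \<Sum>b<B. \<Sum>t<n. k a b t - q a b t)"
    unfolding succ1_def succ2_def s1_def[symmetric] s2_def[symmetric]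
    by (simp add: sum.distrib sum_subtractf sum_distrib_left[symmetric])
  also have "\<dots> \<le> 2 * (real A * real B) + real A * real B + 2 * (\<Sum>a<A. \<Sum>b<B. real n * (ln P + 9 * \<kappa>))"
    by (intro add_mono mult_left_mono A B sum_mono gain) auto
  also have "\<dots> = real A * real B * (3 + 2 * real n * (ln P + 9 * \<kappa>))"
    by (simp add: algebra_simps)
  finally show ?thesis .
qed

end

section \<open>Converse\<close>

text \<open>\<open>xin\<close> is the relay input computed from the outputs: the coordinate \<open>(s, ZD i)\<close> of \<open>w\<close> stands
  for the output \<open>Y\<^sub>D\<^sub>i(s)\<close> here, not for the noise.\<close>

definition yview :: "code \<Rightarrow> nat \<Rightarrow> nat \<Rightarrow> (nat \<times> rv \<Rightarrow> complex) \<Rightarrow> idx \<Rightarrow> nat \<Rightarrow> nat \<Rightarrow> robs \<Rightarrow> complex" where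
  "yview c m1 m2 w i t s k =
     (case k of
        RY \<Rightarrow> if s < t then YR c m1 m2 w i s else 0
      | RDY \<Rightarrow> if s < t then w (s, ZD i) else 0
      | RH a b \<Rightarrow> if s \<le> t then w (s, H a b) else 0
      | RG a b \<Rightarrow> if s < t then w (s, G a b) else 0)"

definition xin :: "code \<Rightarrow> nat \<Rightarrow> nat \<Rightarrow> nat \<Rightarrow> idx \<Rightarrow> (nat \<times> rv \<Rightarrow> complex) \<Rightarrow> complex" where
  "xin c m1 m2 t i w = relf c i t (yview c m1 m2 w i t)"

definition ydec :: "code \<Rightarrow> nat \<Rightarrow> idx \<Rightarrow> (nat \<times> rv \<Rightarrow> complex) \<Rightarrow> nat" where
  "ydec c n i w = dec c i (\<lambda>s k. if s < n then
        (case k of DY \<Rightarrow> w (s, ZD i) | DH a b \<Rightarrow> w (s, H a b) | DG a b \<Rightarrow> w (s, G a b)) else 0)"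

lemma xin_ZD: "t \<le> s \<Longrightarrow> xin c m1 m2 t r (w((s, ZD p) := z)) = xin c m1 m2 t r w"
  unfolding xin_def
  by (rule arg_cong[where f="relf c r t"]) (auto simp: yview_def YR_def fun_eq_iff split: robs.split)

lemma xin_G: "t \<le> s \<Longrightarrow> xin c m1 m2 t r (w((s, G p q) := z)) = xin c m1 m2 t r w"
  unfolding xin_def
  by (rule arg_cong[where f="relf c r t"]) (auto simp: yview_def YR_def fun_eq_iff split: robs.split)

lemma unsig_simps [simp]:
  "unsig x t w (s, H a b) = w (s, H a b)" "unsig x t w (s, G a b) = w (s, G a b)"
  "unsig x t w (s, ZR a) = w (s, ZR a)" "s < t \<Longrightarrow> unsig x t w (s, ZD p) = w (s, ZD p) - sig x p s w"
  by (auto simp: unsig_def)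

lemma YD_unsig: "s < T \<Longrightarrow> h s = (\<lambda>i. x s i w) \<Longrightarrow> YD h (unsig x T w) i s = w (s, ZD i)"
  by (simp add: YD_def sig_def)

text \<open>Run on the noise implied by given outputs, the relay recursion reproduces those outputs,
  hence the inputs computed from them directly. The bound is \<open>Suc T\<close> because the input
  at time \<open>T\<close> needs only the outputs before \<open>T\<close>.\<close>

lemma XRhist_unsig:
  "t \<le> Suc T \<Longrightarrow> XRhist c m1 m2 (unsig (xin c m1 m2) T w) t = (\<lambda>s i. if s < t then xin c m1 m2 s i w else 0)"
proof (induction t)
  case (Suc t)
  then have t: "t \<le> T" "t \<le> Suc T" by auto
  let ?h = "\<lambda>s i. if s < t then xin c m1 m2 s i w else 0"
  have "relay_view c m1 m2 (unsig (xin c m1 m2) T w) ?h i t = yview c m1 m2 w i t" for i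
    using t by (auto simp: relay_view_def yview_def YR_def fun_eq_iff YD_unsig split: robs.split)
  then show ?case
    by (intro ext) (simp add: Suc.IH[OF t(2)] Let_def, simp add: xin_def less_Suc_eq)
qed simp

lemma XR_unsig: "t \<le> T \<Longrightarrow> XR c m1 m2 (unsig (xin c m1 m2) T w) i t = xin c m1 m2 t i w"
  unfolding XR_def by (subst XRhist_unsig) auto

lemma decoded_unsig: "decoded c n m1 m2 (unsig (xin c m1 m2) n w) i = ydec c n i w"
  unfolding decoded_def ydec_def
proof (rule arg_cong[where f="dec c i"], intro ext)
  fix s k
  show "dest_view c n m1 m2 (unsig (xin c m1 m2) n w) i s k = (if s < n then
        (case k of DY \<Rightarrow> w (s, ZD i) | DH a b \<Rightarrow> w (s, H a b) | DG a b \<Rightarrow> w (s, G a b)) else 0)"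
    unfolding dest_view_def by (subst XRhist_unsig) (auto simp: YD_unsig split: dobs.split)
qed

lemma ydec_ZD: "i \<noteq> j \<Longrightarrow> ydec c n i (w((t, ZD j) := z)) = ydec c n i w"
  unfolding ydec_def
  by (rule arg_cong[where f="dec c i"]) (auto simp: fun_eq_iff split: dobs.split)

text \<open>Validity gives measurability in the noise variables only; composing with
  \<open>unsig\<close> moves it to the output variables. The induction is strong because
  \<open>unsig\<close> up to \<open>t\<close> involves all earlier inputs.\<close>

lemma xin_meas:
  assumes "\<And>i t. t < n \<Longrightarrow> (\<lambda>w. XR c m1 m2 w i t) \<in> borel_measurable (noise n)"
  shows "t < n \<Longrightarrow> xin c m1 m2 t i \<in> borel_measurable (noise n)"
proof (induction t arbitrary: i rule: less_induct)
  case (less t)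
  have "unsig (xin c m1 m2) t \<in> noise n \<rightarrow>\<^sub>M noise n"
    using less by (intro measurable_unsig) auto
  from measurable_compose[OF this assms[OF less(2), of i]] show ?case
    by (simp add: XR_unsig)
qed

lemma causal_xin:
  assumes "valid_code P n c" "m1 < msz c One" "m2 < msz c Two"
  shows "causal n (xin c m1 m2)"
  using assms by unfold_locales (auto simp: valid_code_def xin_ZD xin_G intro!: xin_meas)

lemma ydec_meas:
  assumes v: "valid_code P n c"
  shows "ydec c n i \<in> noise n \<rightarrow>\<^sub>M count_space UNIV"
proof -
  \<comment> \<open>\<open>ydec\<close> does not depend on the messages, so any valid pair will do
    for the transfer, here 0 and 0.\<close>
  have 0: "0 < msz c One" "0 < msz c Two" using v by (auto simp: valid_code_def Suc_le_eq)
  interpret causal n "xin c 0 0" by (rule causal_xin[OF v 0])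
  have "unsig (xin c 0 0) n \<in> noise n \<rightarrow>\<^sub>M noise n" by (intro measurable_unsig x_meas) auto
  moreover have "(\<lambda>w. decoded c n 0 0 w i) \<in> noise n \<rightarrow>\<^sub>M count_space UNIV"
    using v 0 by (auto simp: valid_code_def)
  ultimately have "(\<lambda>w. decoded c n 0 0 (unsig (xin c 0 0) n w) i) \<in> noise n \<rightarrow>\<^sub>M count_space UNIV"
    by (rule measurable_compose)
  then show ?thesis by (simp add: decoded_unsig)
qed

lemma nn_integral_xin_sq:
  assumes v: "valid_code P n c" and m: "m1 < msz c One" "m2 < msz c Two" and t: "t < n"
  shows "(\<integral>\<^sup>+w. ennreal ((cmod (xin c m1 m2 t r w))\<^sup>2) * ennreal (Lik (xin c m1 m2) n w) \<partial>noise n)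
     = ennreal (\<integral>w. (cmod (XR c m1 m2 w r t))\<^sup>2 \<partial>noise n)"
proof -
  interpret causal n "xin c m1 m2" by (rule causal_xin[OF v m])
  have i: "integrable (noise n) (\<lambda>w. (cmod (XR c m1 m2 w r t))\<^sup>2)"
    using v m t by (auto simp: valid_code_def)
  then have "(\<lambda>w. ennreal ((cmod (XR c m1 m2 w r t))\<^sup>2)) \<in> borel_measurable (noise n)" by measurable
  from nn_integral_unsig[OF order_refl this] show ?thesis
    using t i by (simp add: XR_unsig nn_integral_eq_integral)
qed

lemma expectation_ydec:
  assumes v: "valid_code P n c" and m: "m1 < msz c One" "m2 < msz c Two"
  shows "(\<integral>w. (if ydec c n i w = j then 1 else 0) * Lik (xin c m1 m2) n w \<partial>noise n)
     = 1 - measure (noise n) {w \<in> space (noise n). decoded c n m1 m2 w i \<noteq> j}"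
proof -
  interpret causal n "xin c m1 m2" by (rule causal_xin[OF v m])
  note [measurable] = ydec_meas[OF v, of i] Lik_meas[OF order_refl]
  have [measurable]: "(\<lambda>w. decoded c n m1 m2 w i) \<in> noise n \<rightarrow>\<^sub>M count_space UNIV"
    using v m by (auto simp: valid_code_def)
  let ?A = "{w \<in> space (noise n). decoded c n m1 m2 w i = j}"
  have "(\<integral>w. (if ydec c n i w = j then 1 else 0) * Lik (xin c m1 m2) n w \<partial>noise n)
     = enn2real (\<integral>\<^sup>+w. ennreal (if ydec c n i w = j then 1 else 0) * ennreal (Lik (xin c m1 m2) n w) \<partial>noise n)"
    by (subst integral_eq_nn_integral) (auto simp: ennreal_mult' intro!: AE_I2)
  also have "(\<integral>\<^sup>+w. ennreal (if ydec c n i w = j then 1 else 0) * ennreal (Lik (xin c m1 m2) n w) \<partial>noise n)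
     = (\<integral>\<^sup>+w. ennreal (if decoded c n m1 m2 w i = j then 1 else 0) \<partial>noise n)"
    using nn_integral_unsig[OF order_refl, of "\<lambda>w. ennreal (if decoded c n m1 m2 w i = j then 1 else 0)"]
    by (simp add: decoded_unsig)
  also have "\<dots> = (\<integral>\<^sup>+w. indicator ?A w \<partial>noise n)"
    by (intro nn_integral_cong) auto
  also have "\<dots> = emeasure (noise n) ?A" by simp
  also have "enn2real \<dots> = measure (noise n) ?A" by (simp add: measure_def)
  also have "\<dots> = 1 - measure (noise n) (space (noise n) - ?A)"
    by (subst noise.prob_compl) auto
  also have "space (noise n) - ?A = {w \<in> space (noise n). decoded c n m1 m2 w i \<noteq> j}" by auto
  finally show ?thesis .
qed

lemma converse_code:
  assumes v: "valid_code P n c" and P: "1 \<le> P"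
  shows "2 * ln (real (msz c One)) * (1 - err_prob c n One) + ln (real (msz c Two)) * (1 - err_prob c n Two)
      \<le> 3 + 2 * real n * (ln P + 9 * \<kappa>)" (is ?one)
    and "2 * ln (real (msz c Two)) * (1 - err_prob c n Two) + ln (real (msz c One)) * (1 - err_prob c n One)
      \<le> 3 + 2 * real n * (ln P + 9 * \<kappa>)" (is ?two)
proof -
  let ?A = "msz c One" and ?B = "msz c Two"
  have pos: "0 < ?A" "0 < ?B" using v by (auto simp: valid_code_def Suc_le_eq)
  have err: "(\<Sum>a<?A. \<Sum>b<?B. 1 - measure (noise n) {w \<in> space (noise n). decoded c n a b w i \<noteq> msg a b i})
      = real ?A * real ?B * (1 - err_prob c n i)" for i
    using pos by (simp add: err_prob_def sum_subtractf field_simps)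
  have pw: "(\<Sum>t<n. \<integral>w. (cmod (XR c a b w r t))\<^sup>2 \<partial>noise n) \<le> real n * P" if "a < ?A" "b < ?B" for a b r
    using v that by (auto simp: valid_code_def)
  interpret b1: bc n ?A ?B One Two P "xin c" "\<lambda>a b t r. \<integral>w. (cmod (XR c a b w r t))\<^sup>2 \<partial>noise n" "ydec c n One" "ydec c n Two"
    using pos P causal_xin[OF v] nn_integral_xin_sq[OF v] pw
    by (intro bc.intro) (auto simp: ydec_ZD intro!: ydec_meas[OF v] integral_nonneg_AE AE_I2)
  \<comment> \<open>Exchanged roles: the first message argument of the locale belongs to
    \<open>u\<close>, hence the flipped arguments of \<open>xin\<close>.\<close>
  interpret b2: bc n ?B ?A Two One P "\<lambda>a b. xin c b a" "\<lambda>a b t r. \<integral>w. (cmod (XR c b a w r t))\<^sup>2 \<partial>noise n" "ydec c n Two" "ydec c n One"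
    using pos P causal_xin[OF v] nn_integral_xin_sq[OF v] pw
    by (intro bc.intro) (auto simp: ydec_ZD intro!: ydec_meas[OF v] integral_nonneg_AE AE_I2)
  have s1: "b1.succ1 = real ?A * real ?B * (1 - err_prob c n One)"
    unfolding b1.succ1_def b1.E_def err[of One, symmetric]
    by (intro sum.cong refl) (simp add: expectation_ydec[OF v] msg_def)
  have s2: "b1.succ2 = real ?A * real ?B * (1 - err_prob c n Two)"
    unfolding b1.succ2_def b1.E_def err[of Two, symmetric]
    by (intro sum.cong refl) (simp add: expectation_ydec[OF v] msg_def)
  have s3: "b2.succ1 = real ?A * real ?B * (1 - err_prob c n Two)"
    unfolding b2.succ1_def b2.E_def err[of Two, symmetric]
    by (subst sum.swap, intro sum.cong refl) (simp add: expectation_ydec[OF v] msg_def)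
  have s4: "b2.succ2 = real ?A * real ?B * (1 - err_prob c n One)"
    unfolding b2.succ2_def b2.E_def err[of One, symmetric]
    by (subst sum.swap, intro sum.cong refl) (simp add: expectation_ydec[OF v] msg_def)
  have AB: "0 < real ?A * real ?B" using pos by simp
  have "real ?A * real ?B * (2 * ln (real ?A) * (1 - err_prob c n One) + ln (real ?B) * (1 - err_prob c n Two))
    \<le> real ?A * real ?B * (3 + 2 * real n * (ln P + 9 * \<kappa>))"
    using b1.rate_bound unfolding s1 s2 by (simp add: algebra_simps)
  then show ?one using AB by (simp only: mult_le_cancel_left_pos)
  have "real ?A * real ?B * (2 * ln (real ?B) * (1 - err_prob c n Two) + ln (real ?A) * (1 - err_prob c n One))
    \<le> real ?A * real ?B * (3 + 2 * real n * (ln P + 9 * \<kappa>))"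
    using b2.rate_bound unfolding s3 s4 by (simp add: algebra_simps)
  then show ?two using AB by (simp only: mult_le_cancel_left_pos)
qed

text \<open>In the sum of the two weighted bounds each rate has weight 2 + 1 = 3 against
  \<open>4 * ln P\<close>. Dividing by \<open>n\<close> removes the constant 6, and the vanishing
  error probabilities remove the factors of correct decoding.\<close>

theorem sum_rate_le:
  assumes ach: "achievable P r1 r2" and P: "1 \<le> P"
  shows "r1 + r2 \<le> 4 / 3 * ((ln P + 9 * \<kappa>) / ln 2)"
proof -
  obtain c where r: "0 \<le> r1" "0 \<le> r2"
    and ev: "eventually (\<lambda>n. valid_code P n (c n) \<and> real (msz (c n) One) \<ge> 2 powr (real n * r1) \<and>
                         real (msz (c n) Two) \<ge> 2 powr (real n * r2)) sequentially"
    and e1: "(\<lambda>n. err_prob (c n) n One) \<longlonglongrightarrow> 0" and e2: "(\<lambda>n. err_prob (c n) n Two) \<longlonglongrightarrow> 0"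
    using ach unfolding achievable_def by auto
  have l1: "(\<lambda>n. 3 * ln 2 * (r1 * (1 - err_prob (c n) n One) + r2 * (1 - err_prob (c n) n Two)))
     \<longlonglongrightarrow> 3 * ln 2 * (r1 * (1 - 0) + r2 * (1 - 0))"
    by (intro tendsto_intros e1 e2)
  have l2: "(\<lambda>n. 6 / real n + 4 * (ln P + 9 * \<kappa>)) \<longlonglongrightarrow> 0 + 4 * (ln P + 9 * \<kappa>)"
    by (intro tendsto_intros lim_const_over_n)
  have "eventually (\<lambda>n. 3 * ln 2 * (r1 * (1 - err_prob (c n) n One) + r2 * (1 - err_prob (c n) n Two))
      \<le> 6 / real n + 4 * (ln P + 9 * \<kappa>)) sequentially"
    using ev eventually_gt_at_top[of 0] order_tendstoD(2)[OF e1, of 1, simplified] order_tendstoD(2)[OF e2, of 1, simplified]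
  proof eventually_elim
    case (elim n)
    have ln: "real n * r * ln 2 \<le> ln m" if "2 powr (real n * r) \<le> m" for m r
      using ln_mono[OF that] by (simp add: ln_powr)
    let ?a = "1 - err_prob (c n) n One" and ?b = "1 - err_prob (c n) n Two"
    have a: "0 \<le> ?a" "0 \<le> ?b" using elim by auto
    have "3 * (real n * r1 * ln 2 * ?a + real n * r2 * ln 2 * ?b)
       \<le> 3 * (ln (real (msz (c n) One)) * ?a + ln (real (msz (c n) Two)) * ?b)"
      using elim a by (intro mult_left_mono add_mono mult_right_mono ln) auto
    also have "\<dots> \<le> 6 + 4 * real n * (ln P + 9 * \<kappa>)"
      using converse_code[of P n "c n"] elim P by (simp add: algebra_simps)
    finally have "real n * (3 * ln 2 * (r1 * ?a + r2 * ?b)) \<le> real n * (6 / real n + 4 * (ln P + 9 * \<kappa>))"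
      using elim by (simp add: algebra_simps)
    then show ?case using elim by (simp only: mult_le_cancel_left_pos of_nat_0_less_iff)
  qed
  from tendsto_le[OF _ l2 l1 this] have "3 * ln 2 * (r1 + r2) \<le> 4 * (ln P + 9 * \<kappa>)" by simp
  then show ?thesis by (simp add: field_simps)
qed

section \<open>A code and a constellation\<close>

text \<open>Balls of radius \<open>D\<close> around a maximal separated set cover all words. The
  ball is bounded crudely by choosing the set of differing positions in at most \<open>2 ^ L\<close>
  ways; this costs one bit per position, which is negligible once the alphabet grows with the
  power.\<close>

lemma gilbert_varshamov:
  fixes Al :: "'a set"
  assumes Al: "finite Al" "Al \<noteq> {}"
  obtains C where "C \<subseteq> {..<L::nat} \<rightarrow>\<^sub>E Al" "finite C"
    "\<And>c c'. c \<in> C \<Longrightarrow> c' \<in> C \<Longrightarrow> c \<noteq> c' \<Longrightarrow> D < card {b\<in>{..<L}. c b \<noteq> c' b}"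
    "card Al ^ L \<le> card C * (2 ^ L * card Al ^ D)"
proof -
  let ?W = "{..<L} \<rightarrow>\<^sub>E Al"
  let ?N = "card Al"
  let ?sep = "\<lambda>C. \<forall>c\<in>C. \<forall>c'\<in>C. c \<noteq> c' \<longrightarrow> D < card {b\<in>{..<L}. c b \<noteq> c' b}"
  have W: "finite ?W" by (intro finite_PiE) (use Al in auto)
  have N: "1 \<le> ?N" using Al by (simp add: Suc_le_eq card_gt_0_iff)
  define \<C> where "\<C> = {C. C \<subseteq> ?W \<and> ?sep C}"
  have "finite \<C>" "\<C> \<noteq> {}" unfolding \<C>_def using W by (auto intro: exI[of _ "{}"])
  then obtain C where C: "C \<in> \<C>" and max: "\<And>C'. C' \<in> \<C> \<Longrightarrow> C \<subseteq> C' \<Longrightarrow> C = C'"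
    by (metis finite_has_maximal)
  have CW: "C \<subseteq> ?W" and sep: "?sep C" using C by (auto simp: \<C>_def)
  have fC: "finite C" using CW W finite_subset by blast
  let ?ball = "\<lambda>c. {w \<in> ?W. card {b\<in>{..<L}. w b \<noteq> c b} \<le> D}"
  have cover: "?W \<subseteq> (\<Union>c\<in>C. ?ball c)"
  proof
    fix w assume w: "w \<in> ?W"
    show "w \<in> (\<Union>c\<in>C. ?ball c)"
    proof (cases "w \<in> C")
      case True
      then show ?thesis using w by force
    next
      case False
      have "insert w C \<notin> \<C>" using max[of "insert w C"] False by auto
      then have "\<not> ?sep (insert w C)" using w CW by (auto simp: \<C>_def)
      then obtain c where c: "c \<in> C" "\<not> D < card {b\<in>{..<L}. w b \<noteq> c b} \<or> \<not> D < card {b\<in>{..<L}. c b \<noteq> w b}"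
        using sep by auto
      have "{b\<in>{..<L}. c b \<noteq> w b} = {b\<in>{..<L}. w b \<noteq> c b}" by auto
      then have "w \<in> ?ball c" using c w by auto
      then show ?thesis using c by blast
    qed
  qed
  have ball: "card (?ball c) \<le> 2 ^ L * ?N ^ D" for c
  proof -
    let ?J = "{J. J \<subseteq> {..<L} \<and> card J \<le> D}"
    let ?S = "\<lambda>J. {w \<in> ?W. \<forall>b\<in>{..<L} - J. w b = c b}"
    have sub: "?ball c \<subseteq> (\<Union>J\<in>?J. ?S J)"
    proof
      fix w assume "w \<in> ?ball c"
      then show "w \<in> (\<Union>J\<in>?J. ?S J)" by (intro UN_I[of "{b\<in>{..<L}. w b \<noteq> c b}"]) auto
    qed
    have S: "card (?S J) \<le> ?N ^ D" if J: "J \<in> ?J" for J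
    proof -
      have fJ: "finite J" using J finite_subset by blast
      have "card (?S J) \<le> card (J \<rightarrow>\<^sub>E Al)"
      proof (rule card_inj_on_le)
        show "inj_on (\<lambda>w. restrict w J) (?S J)"
        proof (rule inj_onI, rule ext)
          fix w w' b assume a: "w \<in> ?S J" "w' \<in> ?S J" "restrict w J = restrict w' J"
          consider "b \<in> J" | "b \<in> {..<L} - J" | "b \<notin> {..<L}" by auto
          then show "w b = w' b"
          proof cases
            case 1
            then show ?thesis using fun_cong[OF a(3), of b] by simp
          next
            case 2
            then show ?thesis using a by auto
          next
            case 3
            then show ?thesis using a by (auto simp: PiE_def extensional_def)
          qed
        qed
        show "(\<lambda>w. restrict w J) ` ?S J \<subseteq> J \<rightarrow>\<^sub>E Al" using J by (auto simp: PiE_def)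
        show "finite (J \<rightarrow>\<^sub>E Al)" using fJ Al by (intro finite_PiE) auto
      qed
      also have "\<dots> = ?N ^ card J" using fJ by (simp add: card_PiE)
      also have "\<dots> \<le> ?N ^ D" using J N by (intro power_increasing) auto
      finally show ?thesis .
    qed
    have fJ: "finite ?J" by simp
    have "card (?ball c) \<le> card (\<Union>J\<in>?J. ?S J)"
      by (intro card_mono sub finite_UN_I fJ) (use W in auto)
    also have "\<dots> \<le> (\<Sum>J\<in>?J. card (?S J))" by (rule card_UN_le[OF fJ])
    also have "\<dots> \<le> (\<Sum>J\<in>?J. ?N ^ D)" by (intro sum_mono S)
    also have "\<dots> = card ?J * ?N ^ D" by simp
    also have "card ?J \<le> card (Pow {..<L})" by (intro card_mono) auto
    also have "\<dots> = 2 ^ L" by (simp add: card_Pow)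
    finally show ?thesis by simp
  qed
  have "?N ^ L = card ?W" by (simp add: card_PiE)
  also have "\<dots> \<le> card (\<Union>c\<in>C. ?ball c)" by (intro card_mono cover finite_UN_I fC) (use W in auto)
  also have "\<dots> \<le> (\<Sum>c\<in>C. card (?ball c))" by (rule card_UN_le[OF fC])
  also have "\<dots> \<le> (\<Sum>c\<in>C. 2 ^ L * ?N ^ D)" by (intro sum_mono ball)
  finally have "?N ^ L \<le> card C * (2 ^ L * ?N ^ D)" by simp
  then show ?thesis using that[OF CW fC] sep by blast
qed

definition grid :: "nat \<Rightarrow> real \<Rightarrow> complex set" where
  "grid K d = (\<lambda>(a, b). Complex (d * real a) (d * real b)) ` ({..<K} \<times> {..<K})"

lemma finite_grid: "finite (grid K d)" by (simp add: grid_def)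

lemma card_grid: "0 < d \<Longrightarrow> card (grid K d) = K ^ 2"
  unfolding grid_def by (subst card_image) (auto simp: inj_on_def power2_eq_square)

lemma grid_bound: "x \<in> grid K d \<Longrightarrow> 0 \<le> d \<Longrightarrow> cmod x \<le> 2 * d * real K"
proof -
  assume x: "x \<in> grid K d" and d: "0 \<le> d"
  then obtain a b where ab: "a < K" "b < K" "x = Complex (d * real a) (d * real b)" by (auto simp: grid_def)
  have "cmod x \<le> \<bar>d * real a\<bar> + \<bar>d * real b\<bar>" using cmod_le[of x] ab by simp
  also have "\<dots> \<le> d * real K + d * real K" using ab d by (intro add_mono) (auto intro!: mult_left_mono simp: abs_mult)
  finally show ?thesis by simp
qed

lemma grid_sep: "x \<in> grid K d \<Longrightarrow> y \<in> grid K d \<Longrightarrow> x \<noteq> y \<Longrightarrow> 0 \<le> d \<Longrightarrow> d \<le> cmod (x - y)"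
proof -
  assume "x \<in> grid K d" "y \<in> grid K d" "x \<noteq> y" and d: "0 \<le> d"
  then obtain a b a' b' where ab: "x = Complex (d * real a) (d * real b)" "y = Complex (d * real a') (d * real b')"
    and ne: "a \<noteq> a' \<or> b \<noteq> b'" by (auto simp: grid_def)
  have *: "d \<le> \<bar>d * real i - d * real j\<bar>" if "i \<noteq> j" for i j :: nat
  proof -
    have "1 \<le> \<bar>real i - real j\<bar>" using that by linarith
    then have "d * 1 \<le> d * \<bar>real i - real j\<bar>" using d by (intro mult_left_mono) auto
    also have "\<dots> = \<bar>d * real i - d * real j\<bar>" using d by (simp add: right_diff_distrib[symmetric] abs_mult)
    finally show ?thesis by simp
  qed
  from ne show ?thesis
  proof
    assume "a \<noteq> a'"
    from *[OF this] show ?thesis using abs_Re_le_cmod[of "x - y"] ab by simp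
  next
    assume "b \<noteq> b'"
    from *[OF this] show ?thesis using abs_Im_le_cmod[of "x - y"] ab by simp
  qed
qed

section \<open>Interference cancellation within a block\<close>

definition sol1 :: "complex \<Rightarrow> complex \<Rightarrow> complex \<Rightarrow> complex \<Rightarrow> complex \<Rightarrow> complex \<Rightarrow> complex" where
  "sol1 a b c d p q = (p * d - b * q) / (a * d - b * c)"

definition sol2 :: "complex \<Rightarrow> complex \<Rightarrow> complex \<Rightarrow> complex \<Rightarrow> complex \<Rightarrow> complex \<Rightarrow> complex" where
  "sol2 a b c d p q = (a * q - c * p) / (a * d - b * c)"

text \<open>\<open>sol1\<close> and \<open>sol2\<close> are Cramer's rule for two equations, linear
  in the right-hand side, so disturbances of the equations become additive errors that do not depend
  on the unknowns.\<close>

lemma sol: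
  assumes "a * d - b * c \<noteq> 0"
  shows "sol1 a b c d (a * x + b * y + e) (c * x + d * y + f) = x + sol1 a b c d e f"
    and "sol2 a b c d (a * x + b * y + e) (c * x + d * y + f) = y + sol2 a b c d e f"
proof -
  have 1: "(a * x + b * y + e) * d - b * (c * x + d * y + f) = x * (a * d - b * c) + (e * d - b * f)"
   and 2: "a * (c * x + d * y + f) - c * (a * x + b * y + e) = y * (a * d - b * c) + (a * f - c * e)"
    by (simp_all add: algebra_simps)
  show "sol1 a b c d (a * x + b * y + e) (c * x + d * y + f) = x + sol1 a b c d e f"
    and "sol2 a b c d (a * x + b * y + e) (c * x + d * y + f) = y + sol2 a b c d e f"
    unfolding sol1_def sol2_def 1 2 using assms by (simp_all add: add_divide_distrib)
qed

lemma measurable_sol [measurable (raw)]: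
  assumes [measurable]: "a \<in> borel_measurable M" "b \<in> borel_measurable M" "c \<in> borel_measurable M"
    "d \<in> borel_measurable M" "p \<in> borel_measurable M" "q \<in> borel_measurable M"
  shows "(\<lambda>w. sol1 (a w) (b w) (c w) (d w) (p w) (q w)) \<in> borel_measurable M"
    and "(\<lambda>w. sol2 (a w) (b w) (c w) (d w) (p w) (q w)) \<in> borel_measurable M"
  unfolding sol1_def sol2_def by measurable

definition oth :: "idx \<Rightarrow> idx" where "oth p = (if p = One then Two else One)"

lemma oth_simps [simp]: "oth One = Two" "oth Two = One" by (simp_all add: oth_def)

text \<open>In the three uses of a block source \<open>One\<close> sends \<open>u1, u2, u2\<close> and source \<open>Two\<close> sends \<open>v1, v1, v2\<close>. So in
  the uses \<open>ph p\<close> and \<open>ph p + 1\<close> source \<open>p\<close> sends its two symbols while the other source repeats one.\<close>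
definition ph :: "idx \<Rightarrow> nat" where "ph p = (if p = One then 0 else 1)"

lemma ph_simps [simp]: "ph One = 0" "ph Two = 1" by (simp_all add: ph_def)

text \<open>Makes the power constraint of the relays hold surely at every use, although what they
  forward is unbounded. On good blocks the forwarded combinations fit below the threshold.\<close>

definition clip :: "real \<Rightarrow> complex \<Rightarrow> complex" where
  "clip P x = (if cmod x \<le> sqrt P then x else 0)"

lemma measurable_clip [measurable (raw)]:
  assumes [measurable]: "f \<in> borel_measurable M"
  shows "(\<lambda>w. clip P (f w)) \<in> borel_measurable M"
  unfolding clip_def by measurable

lemma clip_id: "cmod x \<le> sqrt P \<Longrightarrow> clip P x = x" by (simp add: clip_def)

lemma clip_bound: "0 \<le> P \<Longrightarrow> (cmod (clip P x))\<^sup>2 \<le> P"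
  by (auto simp: clip_def dest: power_mono[where n=2])

text \<open>Relay \<open>i\<close> cancels the repeated symbol of the other source: coefficients of the two symbols
  of source \<open>p\<close>, and the remaining noise. Here and below the coordinates of \<open>z\<close> are local to a block:
  \<open>H\<close>, \<open>ZR\<close> refer to its first hop, and \<open>G\<close>, \<open>ZD\<close> to the second hop three channel uses later.\<close>
definition ca where "ca p i z = z (ph p + 1, H i (oth p)) * z (ph p, H i p)" for z :: "nat \<times> rv \<Rightarrow> complex"
definition cb where "cb p i z = - z (ph p, H i (oth p)) * z (ph p + 1, H i p)" for z :: "nat \<times> rv \<Rightarrow> complex"
definition ce where "ce p i z = z (ph p + 1, H i (oth p)) * z (ph p, ZR i) - z (ph p, H i (oth p)) * z (ph p + 1, ZR i)"
  for z :: "nat \<times> rv \<Rightarrow> complex"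

definition detA where "detA p z = ca p One z * cb p Two z - cb p One z * ca p Two z"
definition detG where "detG p z = z (ph p, G p One) * z (ph p, G (oth p) Two) - z (ph p, G p Two) * z (ph p, G (oth p) One)"
  for z :: "nat \<times> rv \<Rightarrow> complex"

text \<open>The effect of the second-hop noise on the combinations recovered by destination \<open>p\<close>; then the resulting
  errors of its two symbols.\<close>
definition zeta where
  "zeta p i z = (if i = One then sol1 else sol2) (z (ph p, G p One)) (z (ph p, G p Two)) (z (ph p, G (oth p) One)) (z (ph p, G (oth p) Two))
     (z (ph p, ZD p)) (z (ph p, ZD (oth p)) + z (2, ZD p) / z (2, G p (oth p)))" for z :: "nat \<times> rv \<Rightarrow> complex"

definition xerr1 where "xerr1 p z = sol1 (ca p One z) (cb p One z) (ca p Two z) (cb p Two z)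
  (ce p One z + zeta p One z) (ce p Two z + zeta p Two z)"
definition xerr2 where "xerr2 p z = sol2 (ca p One z) (cb p One z) (ca p Two z) (cb p Two z)
  (ce p One z + zeta p One z) (ce p Two z + zeta p Two z)"

text \<open>Symbols bounded by \<open>B \<ge> 1\<close> give relay signals bounded by \<open>amp * B\<close> in the first two uses of the second
  hop, and by \<open>amp2 * B\<close> in the third; this controls the clipping.\<close>
definition amp where "amp p i z = cmod (ca p i z) + cmod (cb p i z) + cmod (ce p i z)"
definition amp2 where "amp2 p z = cmod (z (ph p, G (oth p) One)) * amp p One z + cmod (z (ph p, G (oth p) Two)) * amp p Two z
  + cmod (z (ph p, ZD (oth p)))"

definition tot where "tot p z = amp p One z + amp p Two z + amp2 p z + cmod (xerr1 p z) + cmod (xerr2 p z)"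

text \<open>A property of coefficients and noise alone, free of symbols and power. The first three
  conditions exclude divisions by 0, the last bounds signal growth and estimation error
  together.\<close>

definition bad where "bad p lam z \<longleftrightarrow> z (2, G p (oth p)) = 0 \<or> detG p z = 0 \<or> detA p z = 0 \<or> lam < tot p z"

lemma ph_less: "ph p < 3" "Suc (ph p) < 3" "ph p < 2" by (simp_all add: ph_def)

lemma measurable_ca: "ca p i \<in> borel_measurable (noise 3)" "cb p i \<in> borel_measurable (noise 3)" "ce p i \<in> borel_measurable (noise 3)"
  unfolding ca_def cb_def ce_def using ph_less[of p] by simp_all

lemma measurable_det: "detA p \<in> borel_measurable (noise 3)" "detG p \<in> borel_measurable (noise 3)"
  unfolding detA_def detG_def using ph_less[of p] measurable_ca[of p] by simp_all

lemma measurable_tot: "tot p \<in> borel_measurable (noise 3)"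
proof -
  note [measurable] = measurable_ca
  have [measurable]: "(\<lambda>z. z (ph p, k)) \<in> borel_measurable (noise 3)" "(\<lambda>z. z (2, k)) \<in> borel_measurable (noise 3)" for k
    using ph_less[of p] by simp_all
  have [measurable]: "zeta p i \<in> borel_measurable (noise 3)" for i
    unfolding zeta_def by (cases i) (simp_all, measurable)
  show ?thesis unfolding tot_def amp2_def amp_def xerr1_def xerr2_def by measurable
qed

lemma measurable_bad: "{z \<in> space (noise 3). bad p lam z} \<in> sets (noise 3)"
proof -
  note [measurable] = measurable_tot measurable_det
  have "{z \<in> space (noise 3). bad p lam z} = {z \<in> space (noise 3). cmod (z (2, G p (oth p))) = 0 \<or> cmod (detG p z) = 0
     \<or> cmod (detA p z) = 0 \<or> lam < tot p z}" by (auto simp: bad_def)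
  then show ?thesis by simp
qed

lemma AE_noise_coord: "t < n \<Longrightarrow> AE z in noise n. z (t, k) \<noteq> 0"
  using AE_noise_neq[of t n "\<lambda>_. 1" "\<lambda>_. 0" k] by simp

text \<open>Each determinant is affine in one coordinate whose coefficient is a product of others
  that are almost surely nonzero. For \<open>detA\<close> that coordinate is the cross coefficient
  of relay \<open>One\<close> in the second of the two uses: independent fading over time makes the
  combinations of the relays independent.\<close>

lemma AE_det: "AE z in noise 3. z (2, G p (oth p)) \<noteq> 0 \<and> detG p z \<noteq> 0 \<and> detA p z \<noteq> 0"
proof -
  have [measurable]: "(\<lambda>z. z (ph p, k)) \<in> borel_measurable (noise 3)" "(\<lambda>z. z (Suc (ph p), k)) \<in> borel_measurable (noise 3)" for k
    using ph_less[of p] by simp_all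
  have po: "p \<noteq> oth p" "oth p \<noteq> p" by (cases p; simp)+
  have 1: "AE z in noise 3. z (ph p, G (oth p) Two) \<noteq> 0 \<longrightarrow>
      z (ph p, G p One) * z (ph p, G (oth p) Two) \<noteq> z (ph p, G p Two) * z (ph p, G (oth p) One)"
    by (rule AE_noise_neq[OF ph_less(1)]) (use po in \<open>simp_all\<close>)
  have 2: "AE z in noise 3. z (ph p, H One p) * (z (ph p, H Two (oth p)) * z (Suc (ph p), H Two p)) \<noteq> 0 \<longrightarrow>
      z (Suc (ph p), H One (oth p)) * (z (ph p, H One p) * (z (ph p, H Two (oth p)) * z (Suc (ph p), H Two p)))
        \<noteq> z (ph p, H One (oth p)) * (z (Suc (ph p), H One p) * (z (Suc (ph p), H Two (oth p)) * z (ph p, H Two p)))"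
    by (rule AE_noise_neq[OF ph_less(2)]) (use po in \<open>simp_all\<close>)
  have c: "AE z in noise 3. z (ph p, k) \<noteq> 0" "AE z in noise 3. z (Suc (ph p), k) \<noteq> 0" "AE z in noise 3. z (2, k) \<noteq> 0" for k
    using ph_less[of p] by (auto intro!: AE_noise_coord)
  show ?thesis
    using 1 2 c(1)[of "G (oth p) Two"] c(1)[of "H One p"] c(1)[of "H Two (oth p)"] c(2)[of "H Two p"] c(3)[of "G p (oth p)"]
    by eventually_elim (auto simp: detG_def detA_def ca_def cb_def mult_ac)
qed

text \<open>\<open>tot\<close> is finite everywhere, so its tail events decrease to the empty set;
  the degenerate cases are null.\<close>

lemma prob_bad_small:
  assumes "0 < \<rho>"
  obtains l0 where "\<And>lam. l0 \<le> lam \<Longrightarrow> measure (noise 3) {z \<in> space (noise 3). bad p lam z} \<le> \<rho>"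
proof -
  note [measurable] = measurable_tot
  let ?A = "\<lambda>i::nat. {z \<in> space (noise 3). real i < tot p z}"
  have "(\<lambda>i. measure (noise 3) (?A i)) \<longlonglongrightarrow> measure (noise 3) (\<Inter>i. ?A i)"
    by (rule noise.finite_Lim_measure_decseq) (auto simp: decseq_def)
  moreover have "(\<Inter>i. ?A i) = {}" by (auto simp: not_less) (meson not_less real_arch_simple)
  ultimately have "(\<lambda>i. measure (noise 3) (?A i)) \<longlonglongrightarrow> 0" by simp
  from order_tendstoD(2)[OF this assms] obtain i where i: "measure (noise 3) (?A i) < \<rho>"
    by (auto simp: eventually_sequentially)
  show ?thesis
  proof
    fix lam assume lam: "real i \<le> lam"
    have "measure (noise 3) {z \<in> space (noise 3). bad p lam z} \<le> measure (noise 3) (?A i)"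
    proof (rule noise.finite_measure_mono_AE)
      show "AE z in noise 3. z \<in> {z \<in> space (noise 3). bad p lam z} \<longrightarrow> z \<in> ?A i"
        using AE_det[of p] by eventually_elim (use lam in \<open>auto simp: bad_def\<close>)
    qed simp
    with i show "measure (noise 3) {z \<in> space (noise 3). bad p lam z} \<le> \<rho>" by simp
  qed
qed

section \<open>Block errors\<close>

text \<open>The second hop of a block shares its channel uses with the first hop of the next one.
  They involve different kinds of coordinates, so the index sets are disjoint and the blocks
  independent.\<close>

definition bidx :: "nat \<Rightarrow> nat \<times> rv \<Rightarrow> nat \<times> rv" where
  "bidx b = (\<lambda>(r, k). (3 * b + r + (case k of G _ _ \<Rightarrow> 3 | ZD _ \<Rightarrow> 3 | _ \<Rightarrow> 0), k))"

definition blk :: "nat \<Rightarrow> (nat \<times> rv \<Rightarrow> complex) \<Rightarrow> nat \<times> rv \<Rightarrow> complex" where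
  "blk b w = (\<lambda>j\<in>{..<3} \<times> UNIV. w (bidx b j))"

lemma blk_simps:
  "r < 3 \<Longrightarrow> blk b w (r, H i j) = w (3 * b + r, H i j)" "r < 3 \<Longrightarrow> blk b w (r, ZR i) = w (3 * b + r, ZR i)"
  "r < 3 \<Longrightarrow> blk b w (r, G i j) = w (3 * b + 3 + r, G i j)" "r < 3 \<Longrightarrow> blk b w (r, ZD i) = w (3 * b + 3 + r, ZD i)"
  by (simp_all add: blk_def bidx_def algebra_simps)

lemma inj_bidx: "inj_on (bidx b) A" by (auto simp: inj_on_def bidx_def)

lemma bidx_disjoint: "b \<noteq> b' \<Longrightarrow> bidx b ` ({..<3} \<times> UNIV) \<inter> bidx b' ` ({..<3} \<times> UNIV) = {}"
proof -
  assume ne: "b \<noteq> b'"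
  have False if "(r, k) \<in> {..<3} \<times> UNIV" "(r', k') \<in> {..<3} \<times> UNIV" "bidx b (r, k) = bidx b' (r', k')" for r r' k k'
  proof -
    have "3 * b + r = 3 * b' + r'" "r < 3" "r' < 3" using that by (auto simp: bidx_def)
    then have "b = b'" by presburger
    then show False using ne by simp
  qed
  then show ?thesis by fastforce
qed

lemma bidx_range: "3 * b + 6 \<le> n \<Longrightarrow> bidx b ` ({..<3} \<times> UNIV) \<subseteq> {..<n} \<times> UNIV"
  by (auto simp: bidx_def split: rv.split)

lemma indep_coords: "noise.indep_vars n (\<lambda>_. CN) (\<lambda>j w. w j) ({..<n} \<times> UNIV)" if "0 < n"
proof (subst noise.indep_vars_iff_distr_eq_PiM')
  show "{..<n} \<times> UNIV \<noteq> ({} :: (nat \<times> rv) set)" using that by auto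
  show "(\<lambda>w. w j) \<in> noise n \<rightarrow>\<^sub>M CN" if "j \<in> {..<n} \<times> UNIV" for j
    unfolding noise_def by (rule measurable_component_singleton[OF that])
  have "distr (noise n) (PiM ({..<n} \<times> UNIV) (\<lambda>_. CN)) (\<lambda>w. restrict w ({..<n} \<times> UNIV)) = distr (noise n) (noise n) (\<lambda>w. w)"
    by (rule distr_cong) (auto simp: noise_def space_PiM)
  also have "\<dots> = noise n" by (simp add: distr_id2)
  also have "\<dots> = PiM ({..<n} \<times> UNIV) (\<lambda>j. distr (noise n) CN (\<lambda>w. w j))"
  proof -
    interpret P: product_prob_space "\<lambda>_::nat \<times> rv. CN" "{..<n} \<times> UNIV" by standard
    show ?thesis unfolding noise_def by (intro PiM_cong refl) (simp add: P.PiM_component)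
  qed
  finally show "distr (noise n) (PiM ({..<n} \<times> UNIV) (\<lambda>_. CN)) (\<lambda>w. \<lambda>j\<in>{..<n} \<times> UNIV. w j)
     = PiM ({..<n} \<times> UNIV) (\<lambda>j. distr (noise n) CN (\<lambda>w. w j))" .
qed

lemma blk_meas: "3 * b + 6 \<le> n \<Longrightarrow> blk b \<in> noise n \<rightarrow>\<^sub>M noise 3"
  unfolding blk_def using bidx_range[of b n]
  by (intro nn_integral_noise_reindex(2)[where f="\<lambda>_. 0"] inj_bidx) auto

lemma prob_blk:
  assumes b: "3 * b + 6 \<le> n" and Q: "{z \<in> space (noise 3). Q z} \<in> sets (noise 3)"
  shows "measure (noise n) {w \<in> space (noise n). Q (blk b w)} = measure (noise 3) {z \<in> space (noise 3). Q z}"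
proof -
  have d: "distr (noise n) (noise 3) (blk b) = noise 3"
    unfolding noise_def blk_def
    by (rule distr_PiM_reindex) (use bidx_range[OF b] prob_space_CN in \<open>auto intro!: inj_bidx\<close>)
  have "measure (noise 3) {z \<in> space (noise 3). Q z} = measure (distr (noise n) (noise 3) (blk b)) {z \<in> space (noise 3). Q z}"
    by (simp add: d)
  also have "\<dots> = measure (noise n) (blk b -` {z \<in> space (noise 3). Q z} \<inter> space (noise n))"
    by (rule measure_distr[OF blk_meas[OF b] Q])
  also have "blk b -` {z \<in> space (noise 3). Q z} \<inter> space (noise n) = {w \<in> space (noise n). Q (blk b w)}"
    using measurable_space[OF blk_meas[OF b]] by auto
  finally show ?thesis ..
qed

lemma prob_all_blk:
  assumes n: "3 * L + 3 \<le> n" and J: "J \<subseteq> {..<L}" "J \<noteq> {}" and Q: "{z \<in> space (noise 3). Q z} \<in> sets (noise 3)"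
  shows "measure (noise n) (\<Inter>b\<in>J. {w \<in> space (noise n). Q (blk b w)}) = measure (noise 3) {z \<in> space (noise 3). Q z} ^ card J"
proof -
  let ?I = "{..<3::nat} \<times> (UNIV :: rv set)"
  have Jn: "3 * b + 6 \<le> n" if "b \<in> J" for b using J n that by force
  have fin: "finite J" using J finite_subset by blast
  have iv: "noise.indep_vars n (\<lambda>b. PiM (bidx b ` ?I) (\<lambda>_. CN)) (\<lambda>b w. restrict (\<lambda>j. w j) (bidx b ` ?I)) J"
    using noise.indep_vars_restrict[OF indep_coords, of n J "\<lambda>b. bidx b ` ?I"] n Jn bidx_range bidx_disjoint
    by (auto simp: disjoint_family_on_def)
  define A where "A b = {y \<in> space (PiM (bidx b ` ?I) (\<lambda>_. CN)). Q (\<lambda>j\<in>?I. y (bidx b j))}" for b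
  have A: "A b \<in> sets (PiM (bidx b ` ?I) (\<lambda>_. CN))" for b
  proof -
    have m: "(\<lambda>y. \<lambda>j\<in>?I. y (bidx b j)) \<in> PiM (bidx b ` ?I) (\<lambda>_. CN) \<rightarrow>\<^sub>M noise 3"
      unfolding noise_def by (rule measurable_restrict) (auto intro!: measurable_component_singleton)
    have "A b = (\<lambda>y. \<lambda>j\<in>?I. y (bidx b j)) -` {z \<in> space (noise 3). Q z} \<inter> space (PiM (bidx b ` ?I) (\<lambda>_. CN))"
      using measurable_space[OF m] by (auto simp: A_def)
    then show ?thesis using measurable_sets[OF m Q] by simp
  qed
  have eq: "(\<lambda>w. restrict (\<lambda>j. w j) (bidx b ` ?I)) -` A b \<inter> space (noise n) = {w \<in> space (noise n). Q (blk b w)}" for b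
  proof -
    have "(\<lambda>j\<in>?I. (restrict w (bidx b ` ?I)) (bidx b j)) = blk b w" for w
      by (auto simp: blk_def fun_eq_iff)
    moreover have "restrict w (bidx b ` ?I) \<in> space (PiM (bidx b ` ?I) (\<lambda>_. CN))" for w by (simp add: space_PiM)
    ultimately show ?thesis by (auto simp: A_def)
  qed
  have "measure (noise n) (\<Inter>b\<in>J. {w \<in> space (noise n). Q (blk b w)}) = (\<Prod>b\<in>J. measure (noise n) {w \<in> space (noise n). Q (blk b w)})"
    using noise.indep_varsD[OF iv J(2) fin subset_refl A] unfolding eq .
  also have "\<dots> = (\<Prod>b\<in>J. measure (noise 3) {z \<in> space (noise 3). Q z})"
    by (intro prod.cong refl prob_blk Jn Q)
  finally show ?thesis by simp
qed

text \<open>Union bound over the sets of more than \<open>\<tau> * L\<close> blocks. There are at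
  most \<open>2 ^ L\<close> of them, and the level \<open>4 powr (- 1 / \<tau>)\<close> is chosen so
  that each has probability at most \<open>(1 / 4) ^ L\<close> of consisting of bad blocks
  only.\<close>

lemma prob_many_blk:
  assumes n: "3 * L + 3 \<le> n" and Q: "{z \<in> space (noise 3). Q z} \<in> sets (noise 3)" and \<tau>: "0 < \<tau>"
    and small: "measure (noise 3) {z \<in> space (noise 3). Q z} \<le> 4 powr (- 1 / \<tau>)"
  shows "measure (noise n) {w \<in> space (noise n). \<tau> * real L < real (card {b\<in>{..<L}. Q (blk b w)})} \<le> (1 / 2) ^ L"
proof -
  let ?pr = "measure (noise 3) {z \<in> space (noise 3). Q z}"
  let ?E = "\<lambda>b. {w \<in> space (noise n). Q (blk b w)}"
  let ?J = "{J. J \<subseteq> {..<L} \<and> \<tau> * real L < real (card J)}"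
  have E: "?E b \<in> sets (noise n)" if "b < L" for b
  proof -
    have b: "3 * b + 6 \<le> n" using that n by simp
    have "?E b = blk b -` {z \<in> space (noise 3). Q z} \<inter> space (noise n)"
      using measurable_space[OF blk_meas[OF b]] by auto
    then show ?thesis using measurable_sets[OF blk_meas[OF b] Q] by simp
  qed
  have ne: "J \<noteq> {}" if "J \<in> ?J" for J
    using that \<tau> by (auto simp: mult_less_0_iff)
  have fJ: "finite ?J" by simp
  have IE: "(\<Inter>b\<in>J. ?E b) \<in> sets (noise n)" if "J \<in> ?J" for J
    using that ne[OF that] finite_subset[of J "{..<L}"] by (intro sets.finite_INT E) auto
  have "measure (noise n) {w \<in> space (noise n). \<tau> * real L < real (card {b\<in>{..<L}. Q (blk b w)})}
     \<le> measure (noise n) (\<Union>J\<in>?J. \<Inter>b\<in>J. ?E b)"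
  proof (rule noise.finite_measure_mono)
    show "{w \<in> space (noise n). \<tau> * real L < real (card {b\<in>{..<L}. Q (blk b w)})} \<subseteq> (\<Union>J\<in>?J. \<Inter>b\<in>J. ?E b)"
    proof
      fix w assume "w \<in> {w \<in> space (noise n). \<tau> * real L < real (card {b\<in>{..<L}. Q (blk b w)})}"
      then show "w \<in> (\<Union>J\<in>?J. \<Inter>b\<in>J. ?E b)" by (intro UN_I[of "{b\<in>{..<L}. Q (blk b w)}"]) auto
    qed
    show "(\<Union>J\<in>?J. \<Inter>b\<in>J. ?E b) \<in> sets (noise n)" using fJ IE by (intro sets.finite_UN) auto
  qed
  also have "\<dots> \<le> (\<Sum>J\<in>?J. measure (noise n) (\<Inter>b\<in>J. ?E b))"
    by (rule noise.finite_measure_subadditive_finite[OF fJ]) (use IE in auto)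
  also have "\<dots> \<le> (\<Sum>J\<in>?J. (1 / 4) ^ L)"
  proof (intro sum_mono)
    fix J assume J: "J \<in> ?J"
    have "measure (noise n) (\<Inter>b\<in>J. ?E b) = ?pr ^ card J"
      using J ne[OF J] by (intro prob_all_blk[OF n _ _ Q]) auto
    also have "\<dots> \<le> (4 powr (- 1 / \<tau>)) ^ card J" using small by (intro power_mono) auto
    also have "\<dots> = 4 powr (- (real (card J) / \<tau>))" by (simp add: powr_powr flip: powr_realpow)
    also have "\<dots> \<le> 4 powr (- real L)" using J \<tau> by (intro powr_mono) (auto simp: field_simps)
    also have "\<dots> = (1 / 4) ^ L" by (simp add: powr_minus powr_realpow power_one_over inverse_eq_divide)
    finally show "measure (noise n) (\<Inter>b\<in>J. ?E b) \<le> (1 / 4) ^ L" .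
  qed
  also have "\<dots> = real (card ?J) * (1 / 4) ^ L" by simp
  also have "\<dots> \<le> 2 ^ L * (1 / 4) ^ L"
  proof (intro mult_right_mono)
    have "card ?J \<le> card (Pow {..<L})" by (intro card_mono) auto
    also have "\<dots> = 2 ^ L" by (simp add: card_Pow)
    finally have "real (card ?J) \<le> real (2 ^ L)" by (rule of_nat_mono)
    then show "real (card ?J) \<le> 2 ^ L" by simp
  qed simp
  also have "\<dots> = (1 / 2) ^ L" by (simp flip: power_mult_distrib)
  finally show ?thesis .
qed

section \<open>The coding scheme\<close>

lemma XRhist_XR: "s < t \<Longrightarrow> XRhist c m1 m2 w t s = (\<lambda>i. XR c m1 m2 w i s)"
proof (induction t)
  case (Suc t)
  then show ?case by (cases "s = t") (auto simp: XR_def Let_def)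
qed simp

definition Yd where "Yd c m1 m2 w i s = YD (\<lambda>s i. XR c m1 m2 w i s) w i s"

lemma YD_XRhist: "s < t \<Longrightarrow> YD (XRhist c m1 m2 w t) w i s = Yd c m1 m2 w i s"
  by (simp add: YD_def Yd_def XRhist_XR)

text \<open>Fixed-point form of the relay recursion: past entries of the history never change later,
  so the view can be written with the final inputs and outputs.\<close>

lemma XR_eq: "XR c m1 m2 w i t = relf c i t (\<lambda>s k. case k of
        RY \<Rightarrow> if s < t then YR c m1 m2 w i s else 0
      | RDY \<Rightarrow> if s < t then Yd c m1 m2 w i s else 0
      | RH a b \<Rightarrow> if s \<le> t then w (s, H a b) else 0
      | RG a b \<Rightarrow> if s < t then w (s, G a b) else 0)"
proof -
  have "relay_view c m1 m2 w (XRhist c m1 m2 w t) i t = (\<lambda>s k. case k of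
        RY \<Rightarrow> if s < t then YR c m1 m2 w i s else 0
      | RDY \<Rightarrow> if s < t then Yd c m1 m2 w i s else 0
      | RH a b \<Rightarrow> if s \<le> t then w (s, H a b) else 0
      | RG a b \<Rightarrow> if s < t then w (s, G a b) else 0)"
    by (auto simp: relay_view_def fun_eq_iff YD_XRhist split: robs.split)
  then show ?thesis by (simp add: XR_def Let_def)
qed

lemma dest_view_eq: "dest_view c n m1 m2 w i = (\<lambda>s k. if s < n then (case k of
           DY \<Rightarrow> Yd c m1 m2 w i s | DH a b \<Rightarrow> w (s, H a b) | DG a b \<Rightarrow> w (s, G a b)) else 0)"
  by (auto simp: dest_view_def fun_eq_iff YD_XRhist split: dobs.split)

text \<open>What destination \<open>p\<close> infers, from the third use, about the output of the
  other destination in the phase of its own symbols. Its relay repeats a clipped output that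
  \<open>p\<close> has itself received, so that part is subtracted with the same clipping.\<close>

definition yoh where "yoh P p b y = (y (3*b+5) DY - y (3*b+5) (DG p p) * clip P (y (3*b+3 + ph (oth p)) DY)) / y (3*b+5) (DG p (oth p))"
definition gamh where "gamh P p i b y = (if i = One then sol1 else sol2)
   (y (3*b+3+ph p) (DG p One)) (y (3*b+3+ph p) (DG p Two)) (y (3*b+3+ph p) (DG (oth p) One)) (y (3*b+3+ph p) (DG (oth p) Two))
   (y (3*b+3+ph p) DY) (yoh P p b y)"
definition yca where "yca p i b y = y (3*b+ph p+1) (DH i (oth p)) * y (3*b+ph p) (DH i p)" for y :: "nat \<Rightarrow> dobs \<Rightarrow> complex"
definition ycb where "ycb p i b y = - y (3*b+ph p) (DH i (oth p)) * y (3*b+ph p+1) (DH i p)" for y :: "nat \<Rightarrow> dobs \<Rightarrow> complex"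
definition est1 where "est1 P p b y = sol1 (yca p One b y) (ycb p One b y) (yca p Two b y) (ycb p Two b y) (gamh P p One b y) (gamh P p Two b y)"
definition est2 where "est2 P p b y = sol2 (yca p One b y) (ycb p One b y) (yca p Two b y) (ycb p Two b y) (gamh P p One b y) (gamh P p Two b y)"
definition ok where "ok P d p b y x \<longleftrightarrow> cmod (est1 P p b y - fst x) < d / 2 \<and> cmod (est2 P p b y - snd x) < d / 2"

text \<open>\<open>s\<close> is the corresponding use of the previous triple, whose successor is
  also past; both users share the codebook \<open>cw\<close>. In the first triple no block is
  forwarded yet, and the natural subtraction then only leads to masked entries in the first two
  uses. The disjunct \<open>M \<le> m\<close> guarantees that \<open>LEAST\<close> ranges over a
  nonempty set.\<close>

definition mac :: "real \<Rightarrow> real \<Rightarrow> real \<Rightarrow> nat \<Rightarrow> nat \<Rightarrow> (nat \<Rightarrow> nat \<Rightarrow> complex \<times> complex) \<Rightarrow> code" where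
  "mac P d \<tau> L M cw = \<lparr> msz = (\<lambda>_. M),
     enc = (\<lambda>i m t. if t div 3 < L then (if t mod 3 \<le> ph i then fst (cw m (t div 3)) else snd (cw m (t div 3))) else 0),
     relf = (\<lambda>i t y. clip P
        (if t mod 3 < 2 then
           (let s = 3 * (t div 3) - 3 + t mod 3; o' = (if t mod 3 = 0 then Two else One) in
             y (s + 1) (RH i o') * y s RY - y s (RH i o') * y (s + 1) RY)
         else y (t - 2 + ph (oth i)) RDY)),
     dec = (\<lambda>p y. LEAST m. M \<le> m \<or> real (card {b\<in>{..<L}. \<not> ok P d p b y (cw m b)}) \<le> \<tau> * real L) \<rparr>"

lemma msz_mac [simp]: "msz (mac P d \<tau> L M cw) i = M" by (simp add: mac_def)

lemma cmod_XR_mac: "0 \<le> P \<Longrightarrow> (cmod (XR (mac P d \<tau> L M cw) m1 m2 w i t))\<^sup>2 \<le> P"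
  by (subst XR_eq) (simp add: mac_def clip_bound)

lemma div_mod_3: "r < 3 \<Longrightarrow> (3 * b + r) div 3 = (b::nat)" "r < 3 \<Longrightarrow> (3 * b + r) mod 3 = r"
  by auto

lemma XR_mac_gamma:
  "XR (mac P d \<tau> L M cw) m1 m2 w i (3*b+3+ph p) = clip P
     (w (3*b+ph p+1, H i (oth p)) * YR (mac P d \<tau> L M cw) m1 m2 w i (3*b+ph p)
      - w (3*b+ph p, H i (oth p)) * YR (mac P d \<tau> L M cw) m1 m2 w i (3*b+ph p+1))"
proof -
  have "3*b+3+ph p = 3*(b+1) + ph p" by simp
  then have dm: "(3*b+3+ph p) div 3 = b + 1" "(3*b+3+ph p) mod 3 = ph p"
    using div_mod_3[OF ph_less(1)[of p], of "b + 1"] by metis+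
  have o: "(if ph p = 0 then Two else One) = oth p" by (cases p) auto
  show ?thesis
    apply (subst XR_eq)
    apply (subst (1) mac_def)
    using ph_less(3)[of p] by (simp add: dm Let_def o)
qed

lemma XR_mac_fb:
  "XR (mac P d \<tau> L M cw) m1 m2 w i (3*b+5) = clip P (Yd (mac P d \<tau> L M cw) m1 m2 w i (3*b+3+ph (oth i)))"
proof -
  have dm: "(3*b+5) mod 3 = 2" by presburger
  have "3*b+5 - 2 + ph (oth i) = 3*b+3+ph (oth i)" by simp
  then show ?thesis
    apply (subst XR_eq)
    apply (subst (1) mac_def)
    using ph_less(3)[of "oth i"] by (simp add: dm add_ac)
qed

text \<open>\<open>s\<close> is the symbol that the other source repeats. It is common to both uses
  and both relays, which is what the cancellation relies on.\<close>

lemma YR_mac: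
  assumes b: "b < L"
  obtains s where
    "\<And>i. YR (mac P d \<tau> L M cw) m1 m2 w i (3*b+ph p) = w (3*b+ph p, H i p) * fst (cw (msg m1 m2 p) b)
       + w (3*b+ph p, H i (oth p)) * s + w (3*b+ph p, ZR i)"
    "\<And>i. YR (mac P d \<tau> L M cw) m1 m2 w i (3*b+ph p+1) = w (3*b+ph p+1, H i p) * snd (cw (msg m1 m2 p) b)
       + w (3*b+ph p+1, H i (oth p)) * s + w (3*b+ph p+1, ZR i)"
proof -
  have *: "XS (mac P d \<tau> L M cw) m1 m2 i (3*b+r) = (if r \<le> ph i then fst (cw (msg m1 m2 i) b) else snd (cw (msg m1 m2 i) b))"
    if "r < 3" for i r
    using that b by (simp add: XS_def mac_def div_mod_3)
  show ?thesis
  proof (cases p)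
    case One
    then show ?thesis using *[of 0] *[of 1]
      by (intro that[of "fst (cw (msg m1 m2 Two) b)"]) (auto simp: YR_def)
  next
    case Two
    then show ?thesis using *[of 1] *[of 2]
      by (intro that[of "snd (cw (msg m1 m2 One) b)"]) (auto simp: YR_def)
  qed
qed

lemma measurable_XR_mac: "t < n \<Longrightarrow> (\<lambda>w. XR (mac P d \<tau> L M cw) m1 m2 w i t) \<in> borel_measurable (noise n)"
proof (induction t arbitrary: i rule: less_induct)
  case (less t)
  let ?c = "mac P d \<tau> L M cw"
  have YR_m: "(\<lambda>w. YR ?c m1 m2 w i s) \<in> borel_measurable (noise n)" if "s < n" for i s
    unfolding YR_def using that by simp
  have Yd_m: "(\<lambda>w. Yd ?c m1 m2 w i s) \<in> borel_measurable (noise n)" if "s < t" for i s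
    unfolding Yd_def YD_def using that less by (intro borel_measurable_add borel_measurable_times) auto
  have view[measurable]: "(\<lambda>w. case k of
        RY \<Rightarrow> if s < t then YR ?c m1 m2 w i s else 0
      | RDY \<Rightarrow> if s < t then Yd ?c m1 m2 w i s else 0
      | RH a b \<Rightarrow> if s \<le> t then w (s, H a b) else 0
      | RG a b \<Rightarrow> if s < t then w (s, G a b) else 0) \<in> borel_measurable (noise n)" for s k
    using less.prems by (cases k; cases "s < t"; cases "s \<le> t") (auto intro!: YR_m Yd_m)
  show ?case
    apply (subst XR_eq)
    apply (subst (1) mac_def)
    unfolding code.simps Let_def
    by (intro measurable_clip measurable_If borel_measurable_diff borel_measurable_times view) auto
qed

lemma measurable_Yd_mac: "t < n \<Longrightarrow> (\<lambda>w. Yd (mac P d \<tau> L M cw) m1 m2 w i t) \<in> borel_measurable (noise n)"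
  unfolding Yd_def YD_def by (intro borel_measurable_add borel_measurable_times measurable_XR_mac) auto

lemma measurable_dest_view_mac [measurable]:
  "(\<lambda>w. dest_view (mac P d \<tau> L M cw) n m1 m2 w i s k) \<in> borel_measurable (noise n)"
  unfolding dest_view_eq by (cases "s < n"; cases k) (auto intro!: measurable_Yd_mac)

lemma decoded_mac_eq: "decoded (mac P d \<tau> L M cw) n m1 m2 w p = (LEAST m. M \<le> m \<or>
    real (card {b\<in>{..<L}. \<not> ok P d p b (dest_view (mac P d \<tau> L M cw) n m1 m2 w p) (cw m b)}) \<le> \<tau> * real L)"
  unfolding decoded_def by (subst (1) mac_def) (simp only: code.simps)

lemma measurable_decoded_mac: "(\<lambda>w. decoded (mac P d \<tau> L M cw) n m1 m2 w i) \<in> noise n \<rightarrow>\<^sub>M count_space UNIV"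
proof -
  let ?v = "\<lambda>w. dest_view (mac P d \<tau> L M cw) n m1 m2 w i"
  have e[measurable]: "(\<lambda>w. est1 P i b (?v w)) \<in> borel_measurable (noise n)" "(\<lambda>w. est2 P i b (?v w)) \<in> borel_measurable (noise n)" for b
    unfolding est1_def est2_def gamh_def yoh_def yca_def ycb_def by (simp_all, measurable)
  have [measurable]: "Measurable.pred (noise n) (\<lambda>w. ok P d i b (?v w) y)" for b y
    unfolding ok_def by measurable
  have eq: "real (card {b\<in>{..<L}. \<not> ok P d i b (?v w) (cw m b)}) = (\<Sum>b<L. if ok P d i b (?v w) (cw m b) then 0 else 1)" for w m
    by (simp add: sum.If_cases Int_def)
  show ?thesis
    unfolding decoded_mac_eq eq by measurable
qed

text \<open>On a good block the needed relay signals are at most \<open>lam * B\<close>, hence not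
  clipped. The estimates are then exact up to \<open>xerr1\<close> and \<open>xerr2\<close>, which
  are at most \<open>lam\<close> and so below half the spacing.\<close>

lemma ok_mac:
  assumes P: "0 \<le> P" and B: "1 \<le> B" "lam * B \<le> sqrt P" and lam: "2 * lam < d"
    and cw: "cmod (fst (cw (msg m1 m2 p) b)) \<le> B" "cmod (snd (cw (msg m1 m2 p) b)) \<le> B"
    and b: "b < L" and n: "3 * L + 3 \<le> n" and good: "\<not> bad p lam (blk b w)"
  shows "ok P d p b (dest_view (mac P d \<tau> L M cw) n m1 m2 w p) (cw (msg m1 m2 p) b)"
proof -
  let ?c = "mac P d \<tau> L M cw"
  let ?y = "dest_view ?c n m1 m2 w p"
  define z where "z = blk b w"
  define x1 where "x1 = fst (cw (msg m1 m2 p) b)"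
  define x2 where "x2 = snd (cw (msg m1 m2 p) b)"
  note l = ph_less[of p]
  note zs = blk_simps[of "ph p" b w, OF l(1), folded z_def] blk_simps[of "ph p + 1" b w, OF l(2)[unfolded Suc_eq_plus1], folded z_def]
  have z2: "z (2, G i j) = w (3*b+5, G i j)" "z (2, ZD i) = w (3*b+5, ZD i)" for i j
    using blk_simps(3,4)[of 2 b w] by (simp_all add: z_def add_ac)
  define \<gamma> where "\<gamma> i = ca p i z * x1 + cb p i z * x2 + ce p i z" for i
  have g0: "z (2, G p (oth p)) \<noteq> 0" and dG: "detG p z \<noteq> 0" and dA: "detA p z \<noteq> 0" and tot: "tot p z \<le> lam"
    using good by (auto simp: bad_def z_def[symmetric])
  have amp0: "0 \<le> amp p i z" for i by (simp add: amp_def)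
  have amp20: "0 \<le> amp2 p z" by (simp add: amp2_def amp0)
  have amp_le: "amp p i z \<le> lam" "amp2 p z \<le> lam" "cmod (xerr1 p z) \<le> lam" "cmod (xerr2 p z) \<le> lam" for i
    using tot amp0[of One] amp0[of Two] amp20 norm_ge_zero[of "xerr1 p z"] norm_ge_zero[of "xerr2 p z"]
    unfolding tot_def by (cases i; simp; linarith)+
  have sq: "x * B \<le> sqrt P" if "x \<le> lam" for x
    using mult_right_mono[OF that, of B] B by linarith
  have \<gamma>_le: "cmod (\<gamma> i) \<le> amp p i z * B" for i
  proof -
    have "cmod (\<gamma> i) \<le> cmod (ca p i z * x1) + cmod (cb p i z * x2) + cmod (ce p i z)"
      unfolding \<gamma>_def by (meson norm_triangle_ineq order_trans add_mono order_refl)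
    also have "\<dots> \<le> cmod (ca p i z) * B + cmod (cb p i z) * B + cmod (ce p i z) * B"
      using cw B unfolding x1_def x2_def norm_mult
      by (intro add_mono mult_left_mono mult_left_mono[of 1 B "cmod (ce p i z)", simplified]) auto
    finally show ?thesis by (simp add: amp_def distrib_right)
  qed
  have XR\<gamma>: "XR ?c m1 m2 w i (3*b+3+ph p) = \<gamma> i" for i
  proof -
    obtain s where s: "\<And>i. YR ?c m1 m2 w i (3*b+ph p) = w (3*b+ph p, H i p) * x1 + w (3*b+ph p, H i (oth p)) * s + w (3*b+ph p, ZR i)"
      "\<And>i. YR ?c m1 m2 w i (3*b+ph p+1) = w (3*b+ph p+1, H i p) * x2 + w (3*b+ph p+1, H i (oth p)) * s + w (3*b+ph p+1, ZR i)"
      using YR_mac[OF b] unfolding x1_def x2_def by blast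
    have "w (3*b+ph p+1, H i (oth p)) * YR ?c m1 m2 w i (3*b+ph p) - w (3*b+ph p, H i (oth p)) * YR ?c m1 m2 w i (3*b+ph p+1) = \<gamma> i"
      unfolding s \<gamma>_def ca_def cb_def ce_def zs by (simp add: algebra_simps)
    then show ?thesis
      unfolding XR_mac_gamma using order_trans[OF \<gamma>_le sq[OF amp_le(1)]] by (simp add: clip_id)
  qed
  have Ydq: "Yd ?c m1 m2 w i (3*b+3+ph p) = z (ph p, G i One) * \<gamma> One + z (ph p, G i Two) * \<gamma> Two + z (ph p, ZD i)" for i
    unfolding Yd_def YD_def XR\<gamma> zs ..
  let ?o = "oth p"
  have "cmod (Yd ?c m1 m2 w ?o (3*b+3+ph p)) \<le> cmod (z (ph p, G ?o One) * \<gamma> One) + cmod (z (ph p, G ?o Two) * \<gamma> Two) + cmod (z (ph p, ZD ?o))"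
    unfolding Ydq by (meson norm_triangle_ineq order_trans add_mono order_refl)
  also have "\<dots> \<le> cmod (z (ph p, G ?o One)) * (amp p One z * B) + cmod (z (ph p, G ?o Two)) * (amp p Two z * B) + cmod (z (ph p, ZD ?o)) * B"
    using B unfolding norm_mult
    by (intro add_mono mult_left_mono \<gamma>_le mult_left_mono[of 1 B "cmod (z (ph p, ZD ?o))", simplified]) auto
  also have "\<dots> = amp2 p z * B" by (simp add: amp2_def algebra_simps)
  also have "\<dots> \<le> sqrt P" by (rule sq[OF amp_le(2)])
  finally have clipo: "clip P (Yd ?c m1 m2 w ?o (3*b+3+ph p)) = Yd ?c m1 m2 w ?o (3*b+3+ph p)" by (rule clip_id)
  have oo: "oth ?o = p" by (cases p) auto
  \<comment> \<open>Goodness for \<open>p\<close> does not control the phase of the other user, so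
    the signal of relay \<open>p\<close> may well be clipped; the destination can compute the
    clipped value.\<close>
  have Yd5: "Yd ?c m1 m2 w p (3*b+5) = z (2, G p p) * clip P (Yd ?c m1 m2 w p (3*b+3+ph ?o))
      + z (2, G p ?o) * Yd ?c m1 m2 w ?o (3*b+3+ph p) + z (2, ZD p)"
  proof -
    have "XR ?c m1 m2 w ?o (3*b+5) = Yd ?c m1 m2 w ?o (3*b+3+ph p)" by (simp only: XR_mac_fb oo clipo)
    moreover have "XR ?c m1 m2 w p (3*b+5) = clip P (Yd ?c m1 m2 w p (3*b+3+ph ?o))" by (rule XR_mac_fb)
    ultimately show ?thesis
      unfolding Yd_def[of _ _ _ _ p "3*b+5"] YD_def z2 by (cases p) simp_all
  qed
  have tn: "3*b+5 < n" "3*b+3+ph q < n" "3*b+ph q < n" "3*b+ph q+1 < n" for q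
    using b n ph_less[of q] by linarith+
  have yv: "?y (3*b+5) DY = Yd ?c m1 m2 w p (3*b+5)" "?y (3*b+5) (DG i j) = z (2, G i j)"
    "?y (3*b+3+ph q) DY = Yd ?c m1 m2 w p (3*b+3+ph q)" "?y (3*b+3+ph p) (DG i j) = z (ph p, G i j)"
    "?y (3*b+ph p) (DH i j) = z (ph p, H i j)" "?y (3*b+ph p+1) (DH i j) = z (ph p+1, H i j)" for i j q
    unfolding dest_view_eq zs z2 using tn by simp_all
  have yoh: "yoh P p b ?y = z (ph p, G ?o One) * \<gamma> One + z (ph p, G ?o Two) * \<gamma> Two + (z (ph p, ZD ?o) + z (2, ZD p) / z (2, G p ?o))"
    unfolding yoh_def yv Yd5 Ydq[of ?o] using g0 by (simp add: field_simps)
  have gam: "gamh P p i b ?y = \<gamma> i + zeta p i z" for i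
    unfolding gamh_def yv yoh zeta_def Ydq using sol[OF dG[unfolded detG_def]] by (cases i) simp_all
  have yA: "yca p i b ?y = ca p i z" "ycb p i b ?y = cb p i z" for i
    unfolding yca_def ycb_def ca_def cb_def yv by simp_all
  have g: "\<gamma> i + zeta p i z = ca p i z * x1 + cb p i z * x2 + (ce p i z + zeta p i z)" for i
    by (simp add: \<gamma>_def)
  have "est1 P p b ?y = x1 + xerr1 p z" "est2 P p b ?y = x2 + xerr2 p z"
    unfolding est1_def est2_def xerr1_def xerr2_def yA gam g using sol[OF dA[unfolded detA_def]] by simp_all
  then show ?thesis using amp_le(3,4) lam by (simp add: ok_def x1_def x2_def)
qed

text \<open>If two messages both fail in at most \<open>\<tau> * L\<close> blocks, then in every
  block where neither fails the estimates are within \<open>d / 2\<close> of both symbol pairs,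
  which forces these to coincide. The codewords would differ in at most
  \<open>2 * \<tau> * L\<close> places.\<close>

lemma decoded_mac:
  assumes m: "msg m1 m2 p < M"
    and sep: "\<And>m m'. m < M \<Longrightarrow> m' < M \<Longrightarrow> m \<noteq> m' \<Longrightarrow> 2 * \<tau> * real L < real (card {b\<in>{..<L}. cw m b \<noteq> cw m' b})"
    and dist: "\<And>m m' b. m < M \<Longrightarrow> m' < M \<Longrightarrow> b < L \<Longrightarrow> cw m b \<noteq> cw m' b \<Longrightarrow>
       d \<le> cmod (fst (cw m b) - fst (cw m' b)) \<or> d \<le> cmod (snd (cw m b) - snd (cw m' b))"
    and few: "real (card {b\<in>{..<L}. \<not> ok P d p b (dest_view (mac P d \<tau> L M cw) n m1 m2 w p) (cw (msg m1 m2 p) b)}) \<le> \<tau> * real L"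
  shows "decoded (mac P d \<tau> L M cw) n m1 m2 w p = msg m1 m2 p"
proof -
  let ?y = "dest_view (mac P d \<tau> L M cw) n m1 m2 w p"
  let ?bad = "\<lambda>m. {b\<in>{..<L}. \<not> ok P d p b ?y (cw m b)}"
  let ?m = "msg m1 m2 p"
  define m0 where "m0 = (LEAST m. M \<le> m \<or> real (card (?bad m)) \<le> \<tau> * real L)"
  have dec: "decoded (mac P d \<tau> L M cw) n m1 m2 w p = m0"
    unfolding decoded_mac_eq m0_def ..
  have le: "m0 \<le> ?m" unfolding m0_def by (rule Least_le) (use few in simp)
  have "M \<le> m0 \<or> real (card (?bad m0)) \<le> \<tau> * real L"
    unfolding m0_def by (rule LeastI[of _ ?m]) (use few in simp)
  then have m0: "real (card (?bad m0)) \<le> \<tau> * real L" and m0M: "m0 < M" using le m by auto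
  have "m0 = ?m"
  proof (rule ccontr)
    assume ne: "m0 \<noteq> ?m"
    have sub: "{b\<in>{..<L}. cw m0 b \<noteq> cw ?m b} \<subseteq> ?bad m0 \<union> ?bad ?m"
    proof
      fix b assume "b \<in> {b\<in>{..<L}. cw m0 b \<noteq> cw ?m b}"
      then have b: "b < L" "cw m0 b \<noteq> cw ?m b" by auto
      have tri: "cmod (x - y) < d" if "cmod (e - x) < d / 2" "cmod (e - y) < d / 2" for e x y
        using norm_triangle_ineq4[of "e - y" "e - x"] that by simp
      show "b \<in> ?bad m0 \<union> ?bad ?m"
        using dist[OF m0M m b] b tri by (force simp: ok_def)
    qed
    have "2 * \<tau> * real L < real (card {b\<in>{..<L}. cw m0 b \<noteq> cw ?m b})" by (rule sep[OF m0M m ne])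
    also have "card {b\<in>{..<L}. cw m0 b \<noteq> cw ?m b} \<le> card (?bad m0 \<union> ?bad ?m)" by (intro card_mono sub) auto
    also have "card (?bad m0 \<union> ?bad ?m) \<le> card (?bad m0) + card (?bad ?m)" by (rule card_Un_le)
    finally show False using m0 few by simp
  qed
  then show ?thesis using dec by simp
qed

section \<open>Rates\<close>

text \<open>\<open>B\<close> bounds the symbols, \<open>d\<close> is the grid spacing,
  \<open>lam\<close> the tolerated disturbance. One of the \<open>n div 3\<close> triples is lost
  because the second hop lags by one triple; the \<open>- 1\<close> in the rate pays for the factor
  \<open>2 ^ L\<close> in the size of a Hamming ball.\<close>

lemma mac_exists:
  fixes P d B lam \<tau> :: real and K n :: nat
  assumes P: "1 \<le> P" and d: "0 < d" and B: "1 \<le> B" "2 * d * real K \<le> B" "lam * B \<le> sqrt P" "B\<^sup>2 \<le> P"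
    and lam: "2 * lam < d" and \<tau>: "0 < \<tau>" and K: "1 \<le> K" and n: "3 \<le> n"
    and small: "\<And>p. measure (noise 3) {z \<in> space (noise 3). bad p lam z} \<le> 4 powr (- 1 / \<tau>)"
  defines "L \<equiv> n div 3 - 1"
  shows "\<exists>c. valid_code P n c \<and> (\<forall>i. 2 powr (real L * ((1 - 2 * \<tau>) * log 2 (real K ^ 4) - 1)) \<le> real (msz c i))
      \<and> (\<forall>i. err_prob c n i \<le> (1 / 2) ^ L)"
proof -
  have nL: "3 * L + 3 \<le> n" using n unfolding L_def by simp
  let ?Al = "grid K d \<times> grid K d"
  \<comment> \<open>For integer distances, exceeding \<open>D\<close> is the same as exceeding
    \<open>2 * \<tau> * L\<close>.\<close>
  define D where "D = nat \<lfloor>2 * \<tau> * real L\<rfloor>"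
  have D: "real D \<le> 2 * \<tau> * real L" "2 * \<tau> * real L < real D + 1"
    using \<tau> unfolding D_def by (simp_all add: of_nat_nat)
  have cardAl: "card ?Al = K ^ 4" using d by (simp add: card_cartesian_product card_grid flip: power_add)
  have "card ?Al \<noteq> 0" unfolding cardAl using K by simp
  then have Al: "finite ?Al" "?Al \<noteq> {}" using finite_grid by auto
  obtain C where C: "C \<subseteq> {..<L} \<rightarrow>\<^sub>E ?Al" "finite C"
    "\<And>c c'. c \<in> C \<Longrightarrow> c' \<in> C \<Longrightarrow> c \<noteq> c' \<Longrightarrow> D < card {b\<in>{..<L}. c b \<noteq> c' b}"
    "card ?Al ^ L \<le> card C * (2 ^ L * card ?Al ^ D)"
    using gilbert_varshamov[OF Al, of L D] by blast
  define M where "M = card C"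
  obtain cw where cw: "bij_betw cw {0..<M} C" unfolding M_def using ex_bij_betw_nat_finite[OF C(2)] by blast
  have cwC: "cw m \<in> C" if "m < M" for m using cw that by (auto simp: bij_betw_def)
  have cwA: "fst (cw m b) \<in> grid K d" "snd (cw m b) \<in> grid K d" if "m < M" "b < L" for m b
    using cwC[OF that(1)] C(1) that(2) by (auto simp: PiE_def Pi_def mem_Times_iff)
  have cwB: "cmod (fst (cw m b)) \<le> B" "cmod (snd (cw m b)) \<le> B" if "m < M" "b < L" for m b
    using grid_bound[OF cwA(1)[OF that]] grid_bound[OF cwA(2)[OF that]] d B by auto
  have sep: "2 * \<tau> * real L < real (card {b\<in>{..<L}. cw m b \<noteq> cw m' b})" if "m < M" "m' < M" "m \<noteq> m'" for m m'
  proof -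
    have "cw m \<noteq> cw m'" using cw that by (auto simp: bij_betw_def inj_on_def)
    from C(3)[OF cwC cwC this] that D(2) show ?thesis by linarith
  qed
  have dist: "d \<le> cmod (fst (cw m b) - fst (cw m' b)) \<or> d \<le> cmod (snd (cw m b) - snd (cw m' b))"
    if "m < M" "m' < M" "b < L" "cw m b \<noteq> cw m' b" for m m' b
    using that grid_sep[OF cwA(1)[OF that(1,3)] cwA(1)[OF that(2,3)]] grid_sep[OF cwA(2)[OF that(1,3)] cwA(2)[OF that(2,3)]] d
    by (auto simp: prod_eq_iff)
  have N1: "1 \<le> real K ^ 4" using K by simp
  have M: "2 powr (real L * ((1 - 2 * \<tau>) * log 2 (real K ^ 4) - 1)) \<le> real M"
  proof -
    let ?N = "real K ^ 4"
    have "real (card ?Al ^ L) \<le> real (card C * (2 ^ L * card ?Al ^ D))" by (rule of_nat_mono[OF C(4)])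
    then have c4: "?N ^ L \<le> real M * (2 ^ L * ?N ^ D)" unfolding cardAl M_def by simp
    have N2: "?N = 2 powr log 2 ?N" by (subst powr_log_cancel) (use K in simp_all)
    have "2 powr (real L * ((1 - 2 * \<tau>) * log 2 ?N - 1)) * (2 ^ L * ?N ^ D)
       \<le> 2 powr (real L * ((1 - 2 * \<tau>) * log 2 ?N - 1)) * (2 ^ L * ?N powr (2 * \<tau> * real L))"
    proof (intro mult_left_mono)
      have "?N ^ D = ?N powr real D" using K by (subst powr_realpow) auto
      also have "\<dots> \<le> ?N powr (2 * \<tau> * real L)" using N1 D by (intro powr_mono) auto
      finally show "?N ^ D \<le> ?N powr (2 * \<tau> * real L)" .
    qed auto
    also have "\<dots> = 2 powr (real L * ((1 - 2 * \<tau>) * log 2 ?N - 1)) * (2 powr (real L) * (2 powr log 2 ?N) powr (2 * \<tau> * real L))"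
      using N2 by (simp add: powr_realpow)
    also have "\<dots> = 2 powr (real L * log 2 ?N)"
      unfolding powr_powr powr_add[symmetric] by (simp add: algebra_simps)
    also have "\<dots> = (2 powr log 2 ?N) powr real L" by (simp add: powr_powr mult.commute)
    also have "\<dots> = ?N ^ L" unfolding N2[symmetric] using K by (subst powr_realpow) auto
    also note c4
    finally show ?thesis using K by (subst (asm) mult_le_cancel_right_pos) auto
  qed
  have "0 < real M" by (rule less_le_trans[OF _ M]) simp
  then have M1: "1 \<le> M" by simp
  let ?c = "mac P d \<tau> L M cw"
  have P0: "0 \<le> P" using P by simp
  have int: "integrable (noise n) (\<lambda>w. (cmod (XR ?c m1 m2 w i t))\<^sup>2)" if "t < n" for m1 m2 i t
    by (rule noise.integrable_const_bound[where B=P])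
      (use measurable_XR_mac[OF that] cmod_XR_mac[OF P0] in auto)
  have valid: "valid_code P n ?c"
    unfolding valid_code_def
  proof (intro conjI allI impI)
    fix i m assume m: "m < msz ?c i"
    have "(\<Sum>t<n. (cmod (enc ?c i m t))\<^sup>2) \<le> (\<Sum>t<n. P)"
    proof (intro sum_mono)
      fix t
      have "cmod (enc ?c i m t) \<le> B"
        using m cwB[of m "t div 3"] B(1) by (auto simp: mac_def)
      then have "(cmod (enc ?c i m t))\<^sup>2 \<le> B\<^sup>2" by (intro power_mono) auto
      then show "(cmod (enc ?c i m t))\<^sup>2 \<le> P" using B(4) by simp
    qed
    then show "(\<Sum>t<n. (cmod (enc ?c i m t))\<^sup>2) \<le> real n * P" by simp
  next
    fix m1 m2 i
    have "(\<Sum>t<n. \<integral>w. (cmod (XR ?c m1 m2 w i t))\<^sup>2 \<partial>noise n) \<le> (\<Sum>t<n. P)"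
    proof (intro sum_mono)
      fix t assume "t \<in> {..<n}"
      then have t: "t < n" by simp
      have "(\<integral>w. (cmod (XR ?c m1 m2 w i t))\<^sup>2 \<partial>noise n) \<le> (\<integral>w. P \<partial>noise n)"
        by (intro integral_mono int[OF t]) (auto intro: cmod_XR_mac[OF P0])
      then show "(\<integral>w. (cmod (XR ?c m1 m2 w i t))\<^sup>2 \<partial>noise n) \<le> P"
        by (simp add: noise.prob_space)
    qed
    then show "(\<Sum>t<n. \<integral>w. (cmod (XR ?c m1 m2 w i t))\<^sup>2 \<partial>noise n) \<le> real n * P" by simp
  qed (use M1 int measurable_XR_mac measurable_decoded_mac in auto)
  have p_err: "measure (noise n) {w \<in> space (noise n). decoded ?c n m1 m2 w i \<noteq> msg m1 m2 i} \<le> (1 / 2) ^ L"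
    if m: "m1 < M" "m2 < M" for m1 m2 i
  proof -
    have mi: "msg m1 m2 i < M" using m by (cases i) (auto simp: msg_def)
    have sub: "{w \<in> space (noise n). decoded ?c n m1 m2 w i \<noteq> msg m1 m2 i}
      \<subseteq> {w \<in> space (noise n). \<tau> * real L < real (card {b\<in>{..<L}. bad i lam (blk b w)})}"
    proof safe
      fix w assume w: "w \<in> space (noise n)" "decoded ?c n m1 m2 w i \<noteq> msg m1 m2 i"
      show "\<tau> * real L < real (card {b\<in>{..<L}. bad i lam (blk b w)})"
      proof (rule ccontr)
        assume "\<not> ?thesis"
        moreover have "card {b\<in>{..<L}. \<not> ok P d i b (dest_view ?c n m1 m2 w i) (cw (msg m1 m2 i) b)}
           \<le> card {b\<in>{..<L}. bad i lam (blk b w)}"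
        proof (intro card_mono)
          show "{b\<in>{..<L}. \<not> ok P d i b (dest_view ?c n m1 m2 w i) (cw (msg m1 m2 i) b)} \<subseteq> {b\<in>{..<L}. bad i lam (blk b w)}"
            using ok_mac[OF P0 B(1,3) lam, of cw m1 m2 i _ L n] cwB[OF mi] nL by blast
        qed simp
        ultimately have "real (card {b\<in>{..<L}. \<not> ok P d i b (dest_view ?c n m1 m2 w i) (cw (msg m1 m2 i) b)}) \<le> \<tau> * real L"
          by linarith
        from decoded_mac[OF mi sep dist this] w show False by simp
      qed
    qed
    have meas: "{w \<in> space (noise n). \<tau> * real L < real (card {b\<in>{..<L}. bad i lam (blk b w)})} \<in> sets (noise n)"
    proof -
      have [measurable]: "Measurable.pred (noise n) (\<lambda>w. bad i lam (blk b w))" if "b < L" for b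
      proof -
        have b: "3 * b + 6 \<le> n" using that nL by simp
        have "Measurable.pred (noise 3) (bad i lam)" using measurable_bad[of i lam] by (simp add: pred_def)
        from measurable_compose[OF blk_meas[OF b] this] show ?thesis by simp
      qed
      have eq: "real (card {b\<in>{..<L}. bad i lam (blk b w)}) = (\<Sum>b<L. if bad i lam (blk b w) then 1 else 0)" for w
        by (simp add: sum.If_cases Int_def)
      show ?thesis unfolding eq by measurable
    qed
    show ?thesis
      using noise.finite_measure_mono[OF sub meas] prob_many_blk[OF nL measurable_bad \<tau> small, of i] by linarith
  qed
  have err: "err_prob ?c n i \<le> (1 / 2) ^ L" for i
  proof -
    have "(\<Sum>m1<M. \<Sum>m2<M. measure (noise n) {w \<in> space (noise n). decoded ?c n m1 m2 w i \<noteq> msg m1 m2 i})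
       \<le> (\<Sum>m1<M. \<Sum>m2<M. (1 / 2) ^ L)"
      by (intro sum_mono p_err) auto
    then show ?thesis using M1 by (simp add: err_prob_def field_simps)
  qed
  show ?thesis using valid M err by (intro exI[of _ ?c]) auto
qed

text \<open>\<open>X\<close> is the number of bits per block and user. As \<open>n div 3 - 1\<close>
  is at least \<open>n / 3 - 2\<close>, the loss is at most \<open>2 * X\<close> bits, which is
  absorbed by one bit per channel use once \<open>n\<close> reaches \<open>2 * X\<close>.\<close>

lemma mac_achievable:
  fixes P d B lam \<tau> :: real and K :: nat
  assumes "1 \<le> P" "0 < d" "1 \<le> B" "2 * d * real K \<le> B" "lam * B \<le> sqrt P" "B\<^sup>2 \<le> P"
    "2 * lam < d" "0 < \<tau>" "1 \<le> K"
    "\<And>p. measure (noise 3) {z \<in> space (noise 3). bad p lam z} \<le> 4 powr (- 1 / \<tau>)"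
  defines "X \<equiv> (1 - 2 * \<tau>) * log 2 (real K ^ 4) - 1"
  assumes X: "3 \<le> X"
  shows "achievable P (X / 3 - 1) (X / 3 - 1)"
proof -
  have "\<exists>c. \<forall>n\<ge>3. valid_code P n (c n) \<and> (\<forall>i. 2 powr (real (n div 3 - 1) * X) \<le> real (msz (c n) i))
      \<and> (\<forall>i. err_prob (c n) n i \<le> (1 / 2) ^ (n div 3 - 1))"
    unfolding X_def using mac_exists[OF assms(1-9) _ assms(10)] by (intro choice) blast
  then obtain c where c: "\<And>n. 3 \<le> n \<Longrightarrow> valid_code P n (c n)"
    "\<And>n i. 3 \<le> n \<Longrightarrow> 2 powr (real (n div 3 - 1) * X) \<le> real (msz (c n) i)"
    "\<And>n i. 3 \<le> n \<Longrightarrow> err_prob (c n) n i \<le> (1 / 2) ^ (n div 3 - 1)" by blast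
  have rate: "2 powr (real n * (X / 3 - 1)) \<le> real (msz (c n) i)" if n: "3 \<le> n" "2 * X \<le> real n" for n i
  proof -
    have "real n / 3 - 2 \<le> real (n div 3 - 1)" using n by linarith
    then have "(real n / 3 - 2) * X \<le> real (n div 3 - 1) * X" using X by (intro mult_right_mono) auto
    moreover have "real n * (X / 3 - 1) \<le> (real n / 3 - 2) * X" using n by (simp add: algebra_simps)
    ultimately have "2 powr (real n * (X / 3 - 1)) \<le> 2 powr (real (n div 3 - 1) * X)" by (intro powr_mono) auto
    also note c(2)[OF n(1)]
    finally show ?thesis .
  qed
  have lim: "(\<lambda>n. (1 / 2 :: real) ^ (n div 3 - 1)) \<longlonglongrightarrow> 0"
  proof (rule filterlim_compose[OF LIMSEQ_power_zero])
    show "filterlim (\<lambda>n::nat. n div 3 - 1) sequentially sequentially"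
      unfolding filterlim_at_top
    proof
      fix Z :: nat
      show "eventually (\<lambda>n::nat. Z \<le> n div 3 - 1) sequentially"
        using eventually_ge_at_top[of "3 * Z + 3"] by eventually_elim linarith
    qed
  qed simp
  have err: "(\<lambda>n. err_prob (c n) n i) \<longlonglongrightarrow> 0" for i
  proof (rule tendsto_sandwich[OF _ _ tendsto_const lim])
    show "eventually (\<lambda>n. 0 \<le> err_prob (c n) n i) sequentially"
      unfolding err_prob_def by (intro always_eventually allI divide_nonneg_nonneg sum_nonneg) auto
    show "eventually (\<lambda>n. err_prob (c n) n i \<le> (1 / 2) ^ (n div 3 - 1)) sequentially"
      using eventually_ge_at_top[of 3] by eventually_elim (rule c(3))
  qed
  have "eventually (\<lambda>n. 2 * X \<le> real n) sequentially"
    using filterlim_real_sequentially by (auto simp: filterlim_at_top)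
  then have "eventually (\<lambda>n. valid_code P n (c n) \<and> real (msz (c n) One) \<ge> 2 powr (real n * (X / 3 - 1)) \<and>
      real (msz (c n) Two) \<ge> 2 powr (real n * (X / 3 - 1))) sequentially"
    using eventually_ge_at_top[of 3] by eventually_elim (auto intro: c rate)
  then show ?thesis unfolding achievable_def using X err by (auto intro!: exI[of _ c])
qed

lemma achievable_sum_rate:
  assumes \<epsilon>: "0 < \<epsilon>" "\<epsilon> \<le> 1 / 16"
  shows "eventually (\<lambda>P. \<exists>r. achievable P r r \<and> (4 / 3 - 8 * \<epsilon>) * log 2 P - 8 \<le> r + r) at_top"
proof -
  obtain l1 where l1: "\<And>lam. l1 \<le> lam \<Longrightarrow> measure (noise 3) {z \<in> space (noise 3). bad One lam z} \<le> 4 powr (- 1 / \<epsilon>)"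
    using prob_bad_small[of "4 powr (- 1 / \<epsilon>)" One] by auto
  obtain l2 where l2: "\<And>lam. l2 \<le> lam \<Longrightarrow> measure (noise 3) {z \<in> space (noise 3). bad Two lam z} \<le> 4 powr (- 1 / \<epsilon>)"
    using prob_bad_small[of "4 powr (- 1 / \<epsilon>)" Two] by auto
  have small: "measure (noise 3) {z \<in> space (noise 3). bad p lam z} \<le> 4 powr (- 1 / \<epsilon>)" if "l1 \<le> lam" "l2 \<le> lam" for p lam
    using l1 l2 that by (cases p) auto
  have f: "filterlim (\<lambda>P::real. P powr a) at_top at_top" if "0 < a" for a
    using that by real_asymp
  have g: "filterlim (\<lambda>P::real. log 2 P) at_top at_top" by real_asymp
  have "eventually (\<lambda>P. 3 * l1 \<le> P powr \<epsilon> \<and> 3 * l2 \<le> P powr \<epsilon> \<and> 4 \<le> P powr (1 / 2 - 2 * \<epsilon>) \<and> 24 \<le> log 2 P \<and> 1 \<le> P) at_top"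
    using f[OF \<epsilon>(1)] f[of "1 / 2 - 2 * \<epsilon>"] g \<epsilon> eventually_ge_at_top[of "1::real"]
    by (auto simp: filterlim_at_top eventually_conj_iff)
  then show ?thesis
  proof eventually_elim
    case (elim P)
    \<comment> \<open>\<open>lam\<close> must grow so that \<open>bad\<close> becomes rare,
      \<open>d\<close> must exceed twice \<open>lam\<close>, and \<open>lam * B\<close> must stay
      below \<open>sqrt P\<close>. The ratio \<open>b\<close> of \<open>B\<close> to
      \<open>d\<close> then determines the number of grid points per real dimension, and
      \<open>\<epsilon>\<close> also serves as the correctable fraction
      \<open>\<tau>\<close>.\<close>
    define d where "d = P powr \<epsilon>"
    define B where "B = P powr (1 / 2 - \<epsilon>)"
    define lam where "lam = P powr \<epsilon> / 3"
    define b where "b = P powr (1 / 2 - 2 * \<epsilon>)"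
    define K where "K = nat \<lfloor>b / 2\<rfloor>"
    define X where "X = (1 - 2 * \<epsilon>) * log 2 (real K ^ 4) - 1"
    have P: "1 \<le> P" "0 < P" using elim by auto
    have dpos: "0 < d" using P by (simp add: d_def)
    have b4: "4 \<le> b" using elim by (simp add: b_def)
    have "real K = of_int \<lfloor>b / 2\<rfloor>" using b4 unfolding K_def by simp
    \<comment> \<open>Rounding loses less than 1, hence at most \<open>b / 4\<close>, because
      \<open>4 \<le> b\<close>.\<close>
    then have K: "real K \<le> b / 2" "b / 4 \<le> real K"
      using b4 of_int_floor_le[of "b / 2"] floor_correct[of "b / 2"] by linarith+
    have db: "d * b = B" by (simp add: d_def b_def B_def powr_add[symmetric])
    have B1: "1 \<le> B" using P \<epsilon> by (simp add: B_def ge_one_powr_ge_zero)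
    have c1: "2 * d * real K \<le> B" using mult_left_mono[OF K(1), of "2 * d"] dpos db by simp
    have "P powr \<epsilon> * B = P powr (1 / 2)" by (simp add: B_def powr_add[symmetric])
    then have c2: "lam * B \<le> sqrt P" using P by (simp add: lam_def powr_half_sqrt)
    have "B\<^sup>2 = P powr (2 * (1 / 2 - \<epsilon>))" by (simp add: B_def power2_eq_square powr_add[symmetric])
    also have "\<dots> \<le> P powr 1" using P \<epsilon> by (intro powr_mono) auto
    finally have c3: "B\<^sup>2 \<le> P" using P by simp
    have c4: "2 * lam < d" using dpos by (simp add: lam_def d_def)
    have c5: "1 \<le> K" using K(2) b4 by linarith
    have c6: "measure (noise 3) {z \<in> space (noise 3). bad p lam z} \<le> 4 powr (- 1 / \<epsilon>)" for p
      using elim by (intro small) (simp_all add: lam_def)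
    let ?l = "log 2 P"
    have "log 2 (b / 4) \<le> log 2 (real K)" using b4 K c5 by (subst log_le_cancel_iff) auto
    moreover have "log 2 (b / 4) = (1 / 2 - 2 * \<epsilon>) * ?l - 2"
    proof -
      have "log 2 (4::real) = 2" using log_pow_cancel[of "2::real" 2] by simp
      then show ?thesis using P by (simp add: b_def log_divide log_powr)
    qed
    ultimately have "(2 - 8 * \<epsilon>) * ?l - 8 \<le> 4 * log 2 (real K)" by (simp add: algebra_simps)
    then have "(2 - 8 * \<epsilon>) * ?l - 8 \<le> log 2 (real K ^ 4)" using c5 by (simp add: log_nat_power)
    then have "(1 - 2 * \<epsilon>) * ((2 - 8 * \<epsilon>) * ?l - 8) \<le> X + 1"
      unfolding X_def using \<epsilon> by (simp add: mult_left_mono)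
    moreover have "(1 - 2 * \<epsilon>) * ((2 - 8 * \<epsilon>) * ?l - 8) = (2 - 12 * \<epsilon>) * ?l - 8 + 16 * (\<epsilon> * \<epsilon> * ?l) + 16 * \<epsilon>"
      by (simp add: algebra_simps)
    moreover have "0 \<le> \<epsilon> * \<epsilon> * ?l" using \<epsilon> elim by simp
    ultimately have X: "(2 - 12 * \<epsilon>) * ?l - 9 \<le> X" using \<epsilon> by linarith
    have "(2 - 12 * \<epsilon>) * 24 \<le> (2 - 12 * \<epsilon>) * ?l" using elim \<epsilon> by (intro mult_left_mono) auto
    then have "(2 - 12 * \<epsilon>) * 24 - 9 \<le> X" using X by (rule order_trans[OF diff_right_mono])
    then have "3 \<le> X" using \<epsilon> by (simp add: algebra_simps)
    then have "achievable P (X / 3 - 1) (X / 3 - 1)"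
      using mac_achievable[OF P(1) dpos B1 c1 c2 c3 c4 \<epsilon>(1) c5 c6] unfolding X_def by blast
    \<comment> \<open>Two users at \<open>X / 3 - 1\<close> turn the losses
      \<open>12 * \<epsilon>\<close> and 9 into \<open>8 * \<epsilon>\<close> and 6 + 2 = 8.\<close>
    moreover have "(4 / 3 - 8 * \<epsilon>) * ?l - 8 \<le> (X / 3 - 1) + (X / 3 - 1)"
      using X by (simp add: algebra_simps)
    ultimately show ?case by blast
  qed
qed

text \<open>A supremum of reals is informative only for a nonempty set that is bounded above. The
  given achievable pair provides the former here; in the lower bound the converse provides the
  latter.\<close>

lemma Csum_upper:
  assumes "1 \<le> P" "achievable P r s"
  shows "Csum P \<le> 4 / 3 * ((ln P + 9 * \<kappa>) / ln 2)"
  unfolding Csum_def using assms sum_rate_le by (intro cSup_least) blast+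

lemma Csum_lower:
  assumes "1 \<le> P" "achievable P r s"
  shows "r + s \<le> Csum P"
  unfolding Csum_def
proof (rule cSup_upper)
  show "bdd_above {r1 + r2 |r1 r2. achievable P r1 r2}"
    unfolding bdd_above_def using assms(1) sum_rate_le by blast
qed (use assms in blast)

theorem theorem4:
  shows "((\<lambda>P. Csum P / log 2 P) \<longlongrightarrow> 4 / 3) at_top"
proof (rule tendstoI)
  fix \<eta> :: real assume \<eta>: "0 < \<eta>"
  \<comment> \<open>Budget for the lower bound: \<open>8 * \<epsilon>\<close> takes a quarter of
    \<open>\<eta>\<close>, and the constant 8 another quarter once \<open>log 2 P\<close> reaches
    \<open>32 / \<eta>\<close>. In the upper bound \<open>k\<close> takes half of
    \<open>\<eta>\<close> once it reaches \<open>2 * k / \<eta>\<close>.\<close>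
  define \<epsilon> where "\<epsilon> = min (1 / 16) (\<eta> / 32)"
  define k where "k = 12 * \<kappa> / ln 2"
  have \<epsilon>: "0 < \<epsilon>" "\<epsilon> \<le> 1 / 16" "8 * \<epsilon> \<le> \<eta> / 4" using \<eta> by (auto simp: \<epsilon>_def)
  have "filterlim (\<lambda>P::real. log 2 P) at_top at_top" by real_asymp
  then have "eventually (\<lambda>P. max 1 (max (2 * k / \<eta>) (32 / \<eta>)) \<le> log 2 P) at_top"
    unfolding filterlim_at_top by blast
  then show "eventually (\<lambda>P. dist (Csum P / log 2 P) (4 / 3) < \<eta>) at_top"
    using achievable_sum_rate[OF \<epsilon>(1,2)] eventually_ge_at_top[of 1]
  proof eventually_elim
    case (elim P)
    define l where "l = log 2 P"
    have l: "1 \<le> l" "k \<le> \<eta> / 2 * l" "8 \<le> \<eta> / 4 * l"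
      using elim(1) \<eta> by (auto simp: l_def field_simps)
    obtain r where r: "achievable P r r" "(4 / 3 - 8 * \<epsilon>) * l - 8 \<le> r + r"
      using elim(2) unfolding l_def by blast
    have "Csum P \<le> 4 / 3 * l + k"
      using Csum_upper[OF elim(3) r(1)] by (simp add: l_def k_def log_def field_simps)
    also have "\<dots> < (4 / 3 + \<eta>) * l" using l(2) mult_pos_pos[OF \<eta>, of l] l(1) by (simp add: distrib_right)
    finally have up: "Csum P / l < 4 / 3 + \<eta>" using l by (simp add: divide_less_eq)
    have "8 * \<epsilon> * l \<le> \<eta> / 4 * l" using \<epsilon>(3) l(1) by (intro mult_right_mono) auto
    moreover have "0 < \<eta> * l" using \<eta> l(1) by simp
    ultimately have "(4 / 3 - \<eta>) * l < (4 / 3 - 8 * \<epsilon>) * l - 8"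
      using l(3) by (simp add: left_diff_distrib)
    also note r(2)
    also note Csum_lower[OF elim(3) r(1)]
    finally have "4 / 3 - \<eta> < Csum P / l" using l by (simp add: less_divide_eq)
    with up show ?case unfolding l_def dist_real_def by (simp add: abs_less_iff)
  qed
qed

end
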